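(* Let $n\ge1$ and let $(\mathscr C,\mathbb E,\mathfrak s)$ be an $n$-exangulated category in which every $\mathfrak s$-inflation is a monomorphism and every $\mathfrak s$-deflation is an epimorphism. Let $\mathcal X$ be the class of all $\mathfrak s$-conflations. Then: (1) The pair $(\mathscr C,\mathcal X)$ satisfies the conditions (EC'), (E0), (E1), (E1$^{op}$), (E2'), (E2'$^{op}$) stated in the context. (2) Suppose moreover that for every pair of morphisms $A\xrightarrow{a}B\xrightarrow{b}C$ in $\mathscr C$: (a) if $b\circ a$ is an $\mathfrak s$-inflation then so is $a$; (b) if $b\circ a$ is an $\mathfrak s$-deflation then so is $b$. Then $(\mathscr C,\mathcal X)$ also satisfies condition (EI) stated in the context, and hence $(\mathscr C,\mathcal X)$ is an $n$-exact category in the sense of Jasso.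
   Context: **Complexes.** For an additive category $\mathscr C$ and $n\ge1$, $\mathbf C^{n+2}_{\mathscr C}$ is the category of complexes $X^\bullet=(X^0\xrightarrow{d_X^0}\cdots\xrightarrow{d_X^n}X^{n+1})$ concentrated in degrees $0,\dots,n+1$, with usual chain homotopy. $\mathbf C^{n+2}_{(A,C)}$ has as objects the complexes with $X^0=A$, $X^{n+1}=C$ and as morphisms the chain maps with $f^0=1_A$, $f^{n+1}=1_C$; homotopy is the same relation, homotopy equivalences are taken within this category, and $[X^\bullet]$ is the homotopy equivalence class in it. Cones: for $f^\bullet:X^\bullet\to Y^\bullet$ with $f^0=1$, $M_f^\bullet$ is $X^1\to X^2\oplus Y^1\to\cdots\to X^{n+1}\oplus Y^n\to Y^{n+1}$ with $d^0=\begin{bmatrix}-d_X^1\\ f^1\end{bmatrix}$, $d^i=\begin{bmatrix}-d_X^{i+1}&0\\ f^{i+1}&d_Y^i\end{bmatrix}$ ($1\le i\le n-1$), $d^n=[f^{n+1}\ d_Y^n]$. Dually for $h^\bullet$ with $h^{n+1}=1$, the mapping cocone is $X^0\to X^1\oplus Y^0\to\cdots\to X^n\oplus Y^{n-1}\to Y^n$ with $\begin{bmatrix}d_X^0\\ h^0\end{bmatrix}$, $\begin{bmatrix}d_X^i&0\\ h^i&-d_Y^{i-1}\end{bmatrix}$, $[h^n\ -d_Y^{n-1}]$. **$n$-exangulated categories.** Let $\mathbb E:\mathscr C^{op}\times\mathscr C\to Ab$ be biadditive. Put $a_*\delta=\mathbb E(C,a)(\delta)$, $c^*\delta=\mathbb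 E(c,A)(\delta)$ for $\delta\in\mathbb E(C,A)$. For $\delta\in\mathbb E(C,A)$, $\rho\in\mathbb E(D,B)$ a morphism $(a,c):\delta\to\rho$ is a pair $a:A\to B$, $c:C\to D$ with $a_*\delta=c^*\rho$. Put $\delta_\sharp:\mathscr C(-,C)\to\mathbb E(-,A)$, $f\mapsto f^*\delta$, $\delta^\sharp:\mathscr C(A,-)\to\mathbb E(C,-)$, $g\mapsto g_*\delta$. A pair $\langle X^\bullet,\delta\rangle$, $\delta\in\mathbb E(X^{n+1},X^0)$, is an $n$-exangle if $\mathscr C(-,X^0)\to\cdots\to\mathscr C(-,X^{n+1})\xrightarrow{\delta_\sharp}\mathbb E(-,X^0)$ and $\mathscr C(X^{n+1},-)\to\cdots\to\mathscr C(X^0,-)\xrightarrow{\delta^\sharp}\mathbb E(X^{n+1},-)$ are exact (at all inner terms). An exact realization $\mathfrak s$ assigns to each $\delta\in\mathbb E(C,A)$ a class $\mathfrak s(\delta)=[X^\bullet]$ of an object of $\mathbf C^{n+2}_{(A,C)}$ such that: (R0) if $\mathfrak s(\delta)=[X^\bullet]$, $\mathfrak s(\rho)=[Y^\bullet]$, every morphism $(a,c):\delta\to\rho$ has a lift, i.e. a chain map $f^\bullet:X^\bullet\to Y^\bullet$ with $f^0=a$, $f^{n+1}=c$; (R1) $\mathfrak s(\delta)=[X^\bullet]$ implies $\langle X^\bullet,\delta\rangle$ is an $n$-exangle; (R2) $0\in\mathbb E(0,A)$ has $\mathfrak s(0)=[A\xrightarrow{1}A\to0\to\cdots\to0]$ and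 $0\in\mathbb E(A,0)$ has $\mathfrak s(0)=[0\to\cdots\to0\to A\xrightarrow{1}A]$. If $\mathfrak s(\delta)=[X^\bullet]$, $\langle X^\bullet,\delta\rangle$ is distinguished, $X^\bullet$ is an $\mathfrak s$-conflation, $d_X^0$ an $\mathfrak s$-inflation, $d_X^n$ an $\mathfrak s$-deflation. $(\mathscr C,\mathbb E,\mathfrak s)$ is $n$-exangulated if $\mathfrak s$ is an exact realization and: (EA1) inflations are closed under composition, and so are deflations; (EA2) for $\rho\in\mathbb E(D,A)$, $c:C\to D$ and distinguished $\langle X^\bullet,c^*\rho\rangle$, $\langle Y^\bullet,\rho\rangle$, $(1_A,c)$ has a lift $f^\bullet$ such that $\langle M_f^\bullet,(d_X^0)_*\rho\rangle$ is distinguished; (EA2$^{op}$) for $\delta\in\mathbb E(C,A)$, $a:A\to B$ and distinguished $\langle X^\bullet,\delta\rangle$, $\langle Y^\bullet,a_*\delta\rangle$, $(a,1_C)$ has a lift whose mapping cocone with extension $(d_Y^n)^*\delta$ is distinguished. **$n$-exact sequences and the conditions.** $X^\bullet\in\mathbf C^{n+2}_{\mathscr C}$ is an $n$-kernel sequence if $0\to\mathscr C(-,X^0)\to\cdots\to\mathscr C(-,X^{n+1})$ is exact, an $n$-cokernel sequence if $0\to\mathscr C(X^{n+1},-)\to\cdots\to\mathscr C(X^0,-)$ is exact, $n$-exact if both. (Under the hypotheses of the statement all $\mathfrak s$-conflations are $n$-exact.) For a class $\mathcal X$ of $n$-exact sequences, a morphism is an $\mathcal X$-admissible monomorphism (epimorphism)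 if it is $d_X^0$ (resp. $d_X^n$) of some $X^\bullet\in\mathcal X$. (EC') For all $A,C$, $\{X^\bullet\in\mathcal X: X^0=A,X^{n+1}=C\}$ is closed under homotopy equivalence in $\mathbf C^{n+2}_{(A,C)}$. (E0) $0\to\cdots\to0$ is in $\mathcal X$. (E1), (E1$^{op}$) $\mathcal X$-admissible monomorphisms (resp. epimorphisms) are closed under composition. (E2'$^{op}$) (i) For $c:C'\to C$ and $Y^\bullet\in\mathcal X$ with $Y^0=A$, $Y^{n+1}=C$, there is $X^\bullet\in\mathcal X$ with $X^0=A$, $X^{n+1}=C'$ and a chain map $f^\bullet:X^\bullet\to Y^\bullet$ with $f^0=1_A$, $f^{n+1}=c$. (ii) For $X^\bullet,Y^\bullet\in\mathcal X$ with $X^0=Y^0=A$ and $f^\bullet:X^\bullet\to Y^\bullet$ with $f^0=1_A$, $M_f^\bullet\in\mathcal X$. (E2') The dual: (i) for $a:A\to A'$ and $X^\bullet\in\mathcal X$ with $X^0=A$, $X^{n+1}=C$, there is $Y^\bullet\in\mathcal X$ with $Y^0=A'$, $Y^{n+1}=C$ and a chain map $f^\bullet:X^\bullet\to Y^\bullet$ with $f^0=a$, $f^{n+1}=1_C$; (ii) for $X^\bullet,Y^\bullet\in\mathcal X$ with the same last term and $f^\bullet$ with $f^{n+1}=1$, the mapping cocone is in $\mathcal X$. (EI) For every $X^\bullet\in\mathcal X$ with $X^0=A$, $X^{n+1}=C$: if $X'^\bullet\in\mathbf C^{n+2}_{(A,C)}$ is any $n$-exact sequence such that there is a morphism $X^\bullet\to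 X'^\bullet$ or $X'^\bullet\to X^\bullet$ in $\mathbf C^{n+2}_{(A,C)}$, then $[X^\bullet]=[X'^\bullet]$. **$n$-exact categories (Jasso).** A commutative diagram with rows $X^1\to\cdots\to X^{n+1}$ and $Y^1\to\cdots\to Y^{n+1}$ and vertical maps $f^i$ is an $n$-pullback diagram if $X^1\to X^2\oplus Y^1\to\cdots\to X^{n+1}\oplus Y^n\to Y^{n+1}$, with the same matrices as in the mapping cone, is an $n$-kernel sequence; an $n$-pushout diagram, with rows $X^0\to\cdots\to X^n$, $Y^0\to\cdots\to Y^n$, is defined dually. For a class $\mathcal X$ of $n$-exact sequences, $(\mathscr C,\mathcal X)$ is an $n$-exact category if (E0), (E1), (E1$^{op}$) hold and: (EC) for a chain map $f^\bullet:X^\bullet\to Y^\bullet$ between $n$-exact sequences, if $f^k,f^{k+1}$ are isomorphisms for some $0\le k\le n$, or if $f^0,f^{n+1}$ are isomorphisms, then $X^\bullet\in\mathcal X\iff Y^\bullet\in\mathcal X$; (E2) for $X^\bullet\in\mathcal X$ and $f^0:X^0\to Y^0$ there is an $n$-pushout diagram from $X^0\to\cdots\to X^n$ to some $Y^0\to\cdots\to Y^n$ extending $f^0$, with $d_Y^0$ an $\mathcal X$-admissible monomorphism; (E2$^{op}$) for $Y^\bullet\in\mathcal X$ and $f^{n+1}:X^{n+1}\to Y^{n+1}$ there is an $n$-pullback diagram from some $X^1\to\cdots\to X^{n+1}$ to $Y^1\to\cdots\to Y^{n+1}$ extending $f^{n+1}$, with $d_X^n$ an $\mathcal X$-admissible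 epimorphism. *)

theory Defs
  imports "HOL-Algebra.AbelCoset"
begin

section \<open>Additive categories and biadditive functors\<close>

text \<open>
  Abelian groups are written additively, as HOL-Algebra does for rings and modules: they are
  structures of type \<open>'a ring\<close> satisfying \<open>abelian_group\<close>, whose multiplicative fields play no
  role.  The zero object and the direct sums are chosen once and for all as part of the structure;
  everything below is universally quantified over that choice.
\<close>

record ('o, 'm) addcat =
  Ob   :: "'o set"
  Hom  :: "'o \<Rightarrow> 'o \<Rightarrow> 'm ring"
  Idt  :: "'o \<Rightarrow> 'm"
  cmp  :: "'m \<Rightarrow> 'm \<Rightarrow> 'm"  (infixr "\<cdot>\<index>" 75)
  Zob  :: "'o"
  Sum  :: "'o \<Rightarrow> 'o \<Rightarrow> 'o"
  In1  :: "'o \<Rightarrow> 'o \<Rightarrow> 'm"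
  In2  :: "'o \<Rightarrow> 'o \<Rightarrow> 'm"
  Pr1  :: "'o \<Rightarrow> 'o \<Rightarrow> 'm"
  Pr2  :: "'o \<Rightarrow> 'o \<Rightarrow> 'm"

abbreviation Mor :: "('o, 'm) addcat \<Rightarrow> 'o \<Rightarrow> 'o \<Rightarrow> 'm set" where
  "Mor K A B \<equiv> carrier (Hom K A B)"

locale additive_category =
  fixes K :: "('o, 'm) addcat" (structure)
  assumes hom_disjoint:
      "\<lbrakk>A \<in> Ob K; B \<in> Ob K; A' \<in> Ob K; B' \<in> Ob K; f \<in> Mor K A B; f \<in> Mor K A' B'\<rbrakk>
        \<Longrightarrow> A = A' \<and> B = B'"
    and id_mor: "A \<in> Ob K \<Longrightarrow> Idt K A \<in> Mor K A A"
    and comp_mor: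
      "\<lbrakk>A \<in> Ob K; B \<in> Ob K; C \<in> Ob K; f \<in> Mor K A B; g \<in> Mor K B C\<rbrakk> \<Longrightarrow> g \<cdot> f \<in> Mor K A C"
    and comp_id_right: "\<lbrakk>A \<in> Ob K; B \<in> Ob K; f \<in> Mor K A B\<rbrakk> \<Longrightarrow> f \<cdot> Idt K A = f"
    and comp_id_left: "\<lbrakk>A \<in> Ob K; B \<in> Ob K; f \<in> Mor K A B\<rbrakk> \<Longrightarrow> Idt K B \<cdot> f = f"
    and comp_assoc:
      "\<lbrakk>A \<in> Ob K; B \<in> Ob K; C \<in> Ob K; D \<in> Ob K; f \<in> Mor K A B; g \<in> Mor K B C; h \<in> Mor K C D\<rbrakk>
        \<Longrightarrow> h \<cdot> (g \<cdot> f) = (h \<cdot> g) \<cdot> f"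
    and hom_abelian: "\<lbrakk>A \<in> Ob K; B \<in> Ob K\<rbrakk> \<Longrightarrow> abelian_group (Hom K A B)"
    and comp_add_right:
      "\<lbrakk>A \<in> Ob K; B \<in> Ob K; C \<in> Ob K; f \<in> Mor K A B; f' \<in> Mor K A B; g \<in> Mor K B C\<rbrakk>
        \<Longrightarrow> g \<cdot> (f \<oplus>\<^bsub>Hom K A B\<^esub> f') = (g \<cdot> f) \<oplus>\<^bsub>Hom K A C\<^esub> (g \<cdot> f')"
    and comp_add_left:
      "\<lbrakk>A \<in> Ob K; B \<in> Ob K; C \<in> Ob K; f \<in> Mor K A B; g \<in> Mor K B C; g' \<in> Mor K B C\<rbrakk>
        \<Longrightarrow> (g \<oplus>\<^bsub>Hom K B C\<^esub> g') \<cdot> f = (g \<cdot> f) \<oplus>\<^bsub>Hom K A C\<^esub> (g' \<cdot> f)"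
    and zero_ob: "Zob K \<in> Ob K"
    and zero_terminal: "A \<in> Ob K \<Longrightarrow> Mor K A (Zob K) = {\<zero>\<^bsub>Hom K A (Zob K)\<^esub>}"
    and zero_initial: "A \<in> Ob K \<Longrightarrow> Mor K (Zob K) A = {\<zero>\<^bsub>Hom K (Zob K) A\<^esub>}"
    and sum_ob: "\<lbrakk>A \<in> Ob K; B \<in> Ob K\<rbrakk> \<Longrightarrow> Sum K A B \<in> Ob K"
    and sum_mor:
      "\<lbrakk>A \<in> Ob K; B \<in> Ob K\<rbrakk> \<Longrightarrow>
        In1 K A B \<in> Mor K A (Sum K A B) \<and> In2 K A B \<in> Mor K B (Sum K A B) \<and>
        Pr1 K A B \<in> Mor K (Sum K A B) A \<and> Pr2 K A B \<in> Mor K (Sum K A B) B"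
    and sum_biproduct:
      "\<lbrakk>A \<in> Ob K; B \<in> Ob K\<rbrakk> \<Longrightarrow>
        Pr1 K A B \<cdot> In1 K A B = Idt K A \<and> Pr2 K A B \<cdot> In2 K A B = Idt K B \<and>
        Pr1 K A B \<cdot> In2 K A B = \<zero>\<^bsub>Hom K B A\<^esub> \<and> Pr2 K A B \<cdot> In1 K A B = \<zero>\<^bsub>Hom K A B\<^esub> \<and>
        (In1 K A B \<cdot> Pr1 K A B) \<oplus>\<^bsub>Hom K (Sum K A B) (Sum K A B)\<^esub> (In2 K A B \<cdot> Pr2 K A B)
          = Idt K (Sum K A B)"

text \<open>The column \<open>[f; g] : A \<rightarrow> B \<oplus> C\<close>.\<close>
definition col_mor :: "('o, 'm) addcat \<Rightarrow> 'o \<Rightarrow> 'o \<Rightarrow> 'o \<Rightarrow> 'm \<Rightarrow> 'm \<Rightarrow> 'm" where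
  "col_mor K A B C f g =
     (In1 K B C \<cdot>\<^bsub>K\<^esub> f) \<oplus>\<^bsub>Hom K A (Sum K B C)\<^esub> (In2 K B C \<cdot>\<^bsub>K\<^esub> g)"

text \<open>The row \<open>[f g] : A \<oplus> B \<rightarrow> C\<close>.\<close>
definition row_mor :: "('o, 'm) addcat \<Rightarrow> 'o \<Rightarrow> 'o \<Rightarrow> 'o \<Rightarrow> 'm \<Rightarrow> 'm \<Rightarrow> 'm" where
  "row_mor K A B C f g =
     (f \<cdot>\<^bsub>K\<^esub> Pr1 K A B) \<oplus>\<^bsub>Hom K (Sum K A B) C\<^esub> (g \<cdot>\<^bsub>K\<^esub> Pr2 K A B)"

text \<open>The matrix \<open>[[p, q], [r, t]] : A \<oplus> B \<rightarrow> C \<oplus> D\<close>, given by its rows.\<close>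
definition mat_mor ::
  "('o, 'm) addcat \<Rightarrow> 'o \<Rightarrow> 'o \<Rightarrow> 'o \<Rightarrow> 'o \<Rightarrow> 'm \<Rightarrow> 'm \<Rightarrow> 'm \<Rightarrow> 'm \<Rightarrow> 'm" where
  "mat_mor K A B C D p q r t =
     col_mor K (Sum K A B) C D (row_mor K A B C p q) (row_mor K A B D r t)"

definition monic :: "('o, 'm) addcat \<Rightarrow> 'm \<Rightarrow> bool" where
  "monic K f \<longleftrightarrow> (\<exists>A\<in>Ob K. \<exists>B\<in>Ob K. f \<in> Mor K A B \<and>
     (\<forall>W\<in>Ob K. \<forall>g\<in>Mor K W A. \<forall>h\<in>Mor K W A. f \<cdot>\<^bsub>K\<^esub> g = f \<cdot>\<^bsub>K\<^esub> h \<longrightarrow> g = h))"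

definition epic :: "('o, 'm) addcat \<Rightarrow> 'm \<Rightarrow> bool" where
  "epic K f \<longleftrightarrow> (\<exists>A\<in>Ob K. \<exists>B\<in>Ob K. f \<in> Mor K A B \<and>
     (\<forall>W\<in>Ob K. \<forall>g\<in>Mor K B W. \<forall>h\<in>Mor K B W. g \<cdot>\<^bsub>K\<^esub> f = h \<cdot>\<^bsub>K\<^esub> f \<longrightarrow> g = h))"

definition isomor :: "('o, 'm) addcat \<Rightarrow> 'm \<Rightarrow> bool" where
  "isomor K f \<longleftrightarrow> (\<exists>A\<in>Ob K. \<exists>B\<in>Ob K. f \<in> Mor K A B \<and>
     (\<exists>g\<in>Mor K B A. g \<cdot>\<^bsub>K\<^esub> f = Idt K A \<and> f \<cdot>\<^bsub>K\<^esub> g = Idt K B))"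

text \<open>
  A functor \<open>K\<^sup>o\<^sup>p \<times> K \<rightarrow> Ab\<close>: \<open>EOb E C A\<close> is \<open>E(C, A)\<close> and, for \<open>c : C' \<rightarrow> C\<close> and
  \<open>a : A \<rightarrow> A'\<close>, \<open>EMor E c a\<close> is \<open>E(c, a) : E(C, A) \<rightarrow> E(C', A')\<close>.  The groups \<open>E(C, A)\<close> may
  share elements, so an extension is always accompanied by its \<open>C\<close> and \<open>A\<close>.
\<close>

record ('o, 'm, 'e) bifun =
  EOb  :: "'o \<Rightarrow> 'o \<Rightarrow> 'e ring"
  EMor :: "'m \<Rightarrow> 'm \<Rightarrow> 'e \<Rightarrow> 'e"

abbreviation Ex :: "('o, 'm, 'e) bifun \<Rightarrow> 'o \<Rightarrow> 'o \<Rightarrow> 'e set" where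
  "Ex E C A \<equiv> carrier (EOb E C A)"

locale biadditive_functor =
  fixes K :: "('o, 'm) addcat" (structure) and E :: "('o, 'm, 'e) bifun"
  assumes E_abelian: "\<lbrakk>C \<in> Ob K; A \<in> Ob K\<rbrakk> \<Longrightarrow> abelian_group (EOb E C A)"
    and E_hom:
      "\<lbrakk>C \<in> Ob K; C' \<in> Ob K; A \<in> Ob K; A' \<in> Ob K; c \<in> Mor K C' C; a \<in> Mor K A A'\<rbrakk>
        \<Longrightarrow> abelian_group_hom (EOb E C A) (EOb E C' A') (EMor E c a)"
    and E_id: "\<lbrakk>C \<in> Ob K; A \<in> Ob K; \<delta> \<in> Ex E C A\<rbrakk> \<Longrightarrow> EMor E (Idt K C) (Idt K A) \<delta> = \<delta>"
    and E_comp: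
      "\<lbrakk>C \<in> Ob K; C' \<in> Ob K; C'' \<in> Ob K; A \<in> Ob K; A' \<in> Ob K; A'' \<in> Ob K;
        c \<in> Mor K C' C; c' \<in> Mor K C'' C'; a \<in> Mor K A A'; a' \<in> Mor K A' A''; \<delta> \<in> Ex E C A\<rbrakk>
        \<Longrightarrow> EMor E (c \<cdot> c') (a' \<cdot> a) \<delta> = EMor E c' a' (EMor E c a \<delta>)"
    and E_add_left:
      "\<lbrakk>C \<in> Ob K; C' \<in> Ob K; A \<in> Ob K; A' \<in> Ob K;
        c \<in> Mor K C' C; c' \<in> Mor K C' C; a \<in> Mor K A A'; \<delta> \<in> Ex E C A\<rbrakk>
        \<Longrightarrow> EMor E (c \<oplus>\<^bsub>Hom K C' C\<^esub> c') a \<delta> = EMor E c a \<delta> \<oplus>\<^bsub>EOb E C' A'\<^esub> EMor E c' a \<delta>"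
    and E_add_right:
      "\<lbrakk>C \<in> Ob K; C' \<in> Ob K; A \<in> Ob K; A' \<in> Ob K;
        c \<in> Mor K C' C; a \<in> Mor K A A'; a' \<in> Mor K A A'; \<delta> \<in> Ex E C A\<rbrakk>
        \<Longrightarrow> EMor E c (a \<oplus>\<^bsub>Hom K A A'\<^esub> a') \<delta> = EMor E c a \<delta> \<oplus>\<^bsub>EOb E C' A'\<^esub> EMor E c a' \<delta>"

text \<open>\<open>push K E C a \<delta>\<close> is \<open>a\<^sub>* \<delta>\<close> for \<open>\<delta> \<in> E(C, A)\<close>; \<open>pull K E A c \<delta>\<close> is \<open>c\<^sup>* \<delta>\<close>.\<close>

definition push :: "('o, 'm) addcat \<Rightarrow> ('o, 'm, 'e) bifun \<Rightarrow> 'o \<Rightarrow> 'm \<Rightarrow> 'e \<Rightarrow> 'e" where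
  "push K E C a = EMor E (Idt K C) a"

definition pull :: "('o, 'm) addcat \<Rightarrow> ('o, 'm, 'e) bifun \<Rightarrow> 'o \<Rightarrow> 'm \<Rightarrow> 'e \<Rightarrow> 'e" where
  "pull K E A c = EMor E c (Idt K A)"


section \<open>Complexes, homotopy, cones\<close>

text \<open>
  For a complex concentrated in degrees \<open>0, \<dots>, n + 1\<close> only \<open>ob X i\<close> for \<open>i \<le> n + 1\<close> and
  \<open>df X i\<close> for \<open>i \<le> n\<close> are meaningful; all notions below ignore the other values.
\<close>

record ('o, 'm) cpx =
  ob :: "nat \<Rightarrow> 'o"
  df :: "nat \<Rightarrow> 'm"

definition complexes :: "('o, 'm) addcat \<Rightarrow> nat \<Rightarrow> ('o, 'm) cpx set" where
  "complexes K n = {X.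
     (\<forall>i\<le>n+1. ob X i \<in> Ob K) \<and>
     (\<forall>i\<le>n. df X i \<in> Mor K (ob X i) (ob X (i+1))) \<and>
     (\<forall>i<n. df X (i+1) \<cdot>\<^bsub>K\<^esub> df X i = \<zero>\<^bsub>Hom K (ob X i) (ob X (i+2))\<^esub>)}"

text \<open>The objects of \<open>\<^bold>C\<^sup>n\<^sup>+\<^sup>2\<close> with end terms \<open>A\<close> and \<open>C\<close>.\<close>
definition complexes_ends :: "('o, 'm) addcat \<Rightarrow> nat \<Rightarrow> 'o \<Rightarrow> 'o \<Rightarrow> ('o, 'm) cpx set" where
  "complexes_ends K n A C = {X \<in> complexes K n. ob X 0 = A \<and> ob X (n+1) = C}"

definition chain_map ::
  "('o, 'm) addcat \<Rightarrow> nat \<Rightarrow> ('o, 'm) cpx \<Rightarrow> ('o, 'm) cpx \<Rightarrow> (nat \<Rightarrow> 'm) \<Rightarrow> bool" where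
  "chain_map K n X Y f \<longleftrightarrow>
     (\<forall>i\<le>n+1. f i \<in> Mor K (ob X i) (ob Y i)) \<and>
     (\<forall>i\<le>n. f (i+1) \<cdot>\<^bsub>K\<^esub> df X i = df Y i \<cdot>\<^bsub>K\<^esub> f i)"

text \<open>Morphisms in the category of complexes with fixed end terms \<open>A\<close> and \<open>C\<close>.\<close>
definition chain_map_ends ::
  "('o, 'm) addcat \<Rightarrow> nat \<Rightarrow> 'o \<Rightarrow> 'o \<Rightarrow> ('o, 'm) cpx \<Rightarrow> ('o, 'm) cpx \<Rightarrow> (nat \<Rightarrow> 'm) \<Rightarrow> bool" where
  "chain_map_ends K n A C X Y f \<longleftrightarrow>
     chain_map K n X Y f \<and> f 0 = Idt K A \<and> f (n+1) = Idt K C"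

definition homotopic ::
  "('o, 'm) addcat \<Rightarrow> nat \<Rightarrow> ('o, 'm) cpx \<Rightarrow> ('o, 'm) cpx \<Rightarrow> (nat \<Rightarrow> 'm) \<Rightarrow> (nat \<Rightarrow> 'm) \<Rightarrow> bool" where
  "homotopic K n X Y f g \<longleftrightarrow> (\<exists>h.
     (\<forall>i\<in>{1..n+1}. h i \<in> Mor K (ob X i) (ob Y (i-1))) \<and>
     f 0 \<ominus>\<^bsub>Hom K (ob X 0) (ob Y 0)\<^esub> g 0 = h 1 \<cdot>\<^bsub>K\<^esub> df X 0 \<and>
     (\<forall>i\<in>{1..n}. f i \<ominus>\<^bsub>Hom K (ob X i) (ob Y i)\<^esub> g i =
        (df Y (i-1) \<cdot>\<^bsub>K\<^esub> h i) \<oplus>\<^bsub>Hom K (ob X i) (ob Y i)\<^esub> (h (i+1) \<cdot>\<^bsub>K\<^esub> df X i)) \<and>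
     f (n+1) \<ominus>\<^bsub>Hom K (ob X (n+1)) (ob Y (n+1))\<^esub> g (n+1) = df Y n \<cdot>\<^bsub>K\<^esub> h (n+1))"

definition homotopy_equiv ::
  "('o, 'm) addcat \<Rightarrow> nat \<Rightarrow> 'o \<Rightarrow> 'o \<Rightarrow> ('o, 'm) cpx \<Rightarrow> ('o, 'm) cpx \<Rightarrow> bool" where
  "homotopy_equiv K n A C X Y \<longleftrightarrow> (\<exists>f g.
     chain_map_ends K n A C X Y f \<and> chain_map_ends K n A C Y X g \<and>
     homotopic K n X X (\<lambda>i. g i \<cdot>\<^bsub>K\<^esub> f i) (\<lambda>i. Idt K (ob X i)) \<and>
     homotopic K n Y Y (\<lambda>i. f i \<cdot>\<^bsub>K\<^esub> g i) (\<lambda>i. Idt K (ob Y i)))"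

text \<open>The class \<open>[X]\<close> in the category of complexes with fixed end terms \<open>A\<close> and \<open>C\<close>.\<close>
definition hclass :: "('o, 'm) addcat \<Rightarrow> nat \<Rightarrow> 'o \<Rightarrow> 'o \<Rightarrow> ('o, 'm) cpx \<Rightarrow> ('o, 'm) cpx set" where
  "hclass K n A C X = {Y \<in> complexes_ends K n A C. homotopy_equiv K n A C X Y}"

text \<open>The cone depends only on \<open>X\<close>, \<open>Y\<close>, \<open>f\<close> in degrees \<open>1, \<dots>, n + 1\<close>.\<close>
definition cone ::
  "('o, 'm) addcat \<Rightarrow> nat \<Rightarrow> ('o, 'm) cpx \<Rightarrow> ('o, 'm) cpx \<Rightarrow> (nat \<Rightarrow> 'm) \<Rightarrow> ('o, 'm) cpx" where
  "cone K n X Y f =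
    \<lparr> ob = (\<lambda>i. if i = 0 then ob X 1
                else if i \<le> n then Sum K (ob X (i+1)) (ob Y i)
                else ob Y (n+1)),
      df = (\<lambda>i. if i = 0 then
                  col_mor K (ob X 1) (ob X 2) (ob Y 1) (\<ominus>\<^bsub>Hom K (ob X 1) (ob X 2)\<^esub> df X 1) (f 1)
                else if i < n then
                  mat_mor K (ob X (i+1)) (ob Y i) (ob X (i+2)) (ob Y (i+1))
                    (\<ominus>\<^bsub>Hom K (ob X (i+1)) (ob X (i+2))\<^esub> df X (i+1))
                    \<zero>\<^bsub>Hom K (ob Y i) (ob X (i+2))\<^esub>
                    (f (i+1)) (df Y i)
                else
                  row_mor K (ob X (n+1)) (ob Y n) (ob Y (n+1)) (f (n+1)) (df Y n)) \<rparr>"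

text \<open>The cocone depends only on \<open>X\<close>, \<open>Y\<close>, \<open>h\<close> in degrees \<open>0, \<dots>, n\<close>.\<close>
definition cocone ::
  "('o, 'm) addcat \<Rightarrow> nat \<Rightarrow> ('o, 'm) cpx \<Rightarrow> ('o, 'm) cpx \<Rightarrow> (nat \<Rightarrow> 'm) \<Rightarrow> ('o, 'm) cpx" where
  "cocone K n X Y h =
    \<lparr> ob = (\<lambda>i. if i = 0 then ob X 0
                else if i \<le> n then Sum K (ob X i) (ob Y (i-1))
                else ob Y n),
      df = (\<lambda>i. if i = 0 then
                  col_mor K (ob X 0) (ob X 1) (ob Y 0) (df X 0) (h 0)
                else if i < n then
                  mat_mor K (ob X i) (ob Y (i-1)) (ob X (i+1)) (ob Y i)
                    (df X i) \<zero>\<^bsub>Hom K (ob Y (i-1)) (ob X (i+1))\<^esub>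
                    (h i) (\<ominus>\<^bsub>Hom K (ob Y (i-1)) (ob Y i)\<^esub> df Y (i-1))
                else
                  row_mor K (ob X n) (ob Y (n-1)) (ob Y n)
                    (h n) (\<ominus>\<^bsub>Hom K (ob Y (n-1)) (ob Y n)\<^esub> df Y (n-1))) \<rparr>"


section \<open>n-exangulated categories\<close>

text \<open>The two conditions are exactness at the inner terms of the sequences
  \<open>K(W, X\<^sup>0) \<rightarrow> \<dots> \<rightarrow> K(W, X\<^sup>n\<^sup>+\<^sup>1) \<rightarrow> E(W, X\<^sup>0)\<close> and
  \<open>K(X\<^sup>n\<^sup>+\<^sup>1, W) \<rightarrow> \<dots> \<rightarrow> K(X\<^sup>0, W) \<rightarrow> E(X\<^sup>n\<^sup>+\<^sup>1, W)\<close> for every object \<open>W\<close>.\<close>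

definition exact_cov :: "('o, 'm) addcat \<Rightarrow> 'o \<Rightarrow> ('o, 'm) cpx \<Rightarrow> nat \<Rightarrow> bool" where
  "exact_cov K W X i \<longleftrightarrow>
     (\<lambda>g. df X (i-1) \<cdot>\<^bsub>K\<^esub> g) ` Mor K W (ob X (i-1)) =
     a_kernel (Hom K W (ob X i)) (Hom K W (ob X (i+1))) (\<lambda>g. df X i \<cdot>\<^bsub>K\<^esub> g)"

definition exact_contra :: "('o, 'm) addcat \<Rightarrow> 'o \<Rightarrow> ('o, 'm) cpx \<Rightarrow> nat \<Rightarrow> bool" where
  "exact_contra K W X i \<longleftrightarrow>
     (\<lambda>g. g \<cdot>\<^bsub>K\<^esub> df X i) ` Mor K (ob X (i+1)) W =
     a_kernel (Hom K (ob X i) W) (Hom K (ob X (i-1)) W) (\<lambda>g. g \<cdot>\<^bsub>K\<^esub> df X (i-1))"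

definition n_exangle ::
  "('o, 'm) addcat \<Rightarrow> ('o, 'm, 'e) bifun \<Rightarrow> nat \<Rightarrow> ('o, 'm) cpx \<Rightarrow> 'e \<Rightarrow> bool" where
  "n_exangle K E n X \<delta> \<longleftrightarrow>
     X \<in> complexes K n \<and> \<delta> \<in> Ex E (ob X (n+1)) (ob X 0) \<and>
     (\<forall>W\<in>Ob K.
        (\<forall>i\<in>{1..n}. exact_cov K W X i) \<and>
        (\<lambda>g. df X n \<cdot>\<^bsub>K\<^esub> g) ` Mor K W (ob X n) =
          a_kernel (Hom K W (ob X (n+1))) (EOb E W (ob X 0)) (\<lambda>g. pull K E (ob X 0) g \<delta>)) \<and>
     (\<forall>W\<in>Ob K.
        (\<forall>i\<in>{1..n}. exact_contra K W X i) \<and>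
        (\<lambda>g. g \<cdot>\<^bsub>K\<^esub> df X 0) ` Mor K (ob X 1) W =
          a_kernel (Hom K (ob X 0) W) (EOb E (ob X (n+1)) W) (\<lambda>g. push K E (ob X (n+1)) g \<delta>))"

text \<open>\<open>s C A \<delta>\<close> is the class assigned to \<open>\<delta> \<in> E(C, A)\<close>.\<close>
type_synonym ('o, 'm, 'e) realiz = "'o \<Rightarrow> 'o \<Rightarrow> 'e \<Rightarrow> ('o, 'm) cpx set"

text \<open>\<open>A \<rightarrow> A \<rightarrow> 0 \<rightarrow> \<dots> \<rightarrow> 0\<close> and \<open>0 \<rightarrow> \<dots> \<rightarrow> 0 \<rightarrow> A \<rightarrow> A\<close>, with \<open>A \<rightarrow> A\<close> the identity.\<close>

definition triv_left :: "('o, 'm) addcat \<Rightarrow> 'o \<Rightarrow> ('o, 'm) cpx" where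
  "triv_left K A = (let t = (\<lambda>i::nat. if i \<le> 1 then A else Zob K) in
     \<lparr> ob = t, df = (\<lambda>i. if i = 0 then Idt K A else \<zero>\<^bsub>Hom K (t i) (t (i+1))\<^esub>) \<rparr>)"

definition triv_right :: "('o, 'm) addcat \<Rightarrow> nat \<Rightarrow> 'o \<Rightarrow> ('o, 'm) cpx" where
  "triv_right K n A = (let t = (\<lambda>i::nat. if i < n then Zob K else A) in
     \<lparr> ob = t, df = (\<lambda>i. if i = n then Idt K A else \<zero>\<^bsub>Hom K (t i) (t (i+1))\<^esub>) \<rparr>)"

definition R0 ::
  "('o, 'm) addcat \<Rightarrow> ('o, 'm, 'e) bifun \<Rightarrow> ('o, 'm, 'e) realiz \<Rightarrow> nat \<Rightarrow> bool" where
  "R0 K E s n \<longleftrightarrow>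
     (\<forall>A\<in>Ob K. \<forall>B\<in>Ob K. \<forall>C\<in>Ob K. \<forall>D\<in>Ob K. \<forall>\<delta>\<in>Ex E C A. \<forall>\<rho>\<in>Ex E D B.
        \<forall>X\<in>s C A \<delta>. \<forall>Y\<in>s D B \<rho>. \<forall>a\<in>Mor K A B. \<forall>c\<in>Mor K C D.
          push K E C a \<delta> = pull K E B c \<rho> \<longrightarrow>
          (\<exists>f. chain_map K n X Y f \<and> f 0 = a \<and> f (n+1) = c))"

definition R1 ::
  "('o, 'm) addcat \<Rightarrow> ('o, 'm, 'e) bifun \<Rightarrow> ('o, 'm, 'e) realiz \<Rightarrow> nat \<Rightarrow> bool" where
  "R1 K E s n \<longleftrightarrow>
     (\<forall>A\<in>Ob K. \<forall>C\<in>Ob K. \<forall>\<delta>\<in>Ex E C A. \<forall>X\<in>s C A \<delta>. n_exangle K E n X \<delta>)"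

definition R2 ::
  "('o, 'm) addcat \<Rightarrow> ('o, 'm, 'e) bifun \<Rightarrow> ('o, 'm, 'e) realiz \<Rightarrow> nat \<Rightarrow> bool" where
  "R2 K E s n \<longleftrightarrow>
     (\<forall>A\<in>Ob K.
        s (Zob K) A \<zero>\<^bsub>EOb E (Zob K) A\<^esub> = hclass K n A (Zob K) (triv_left K A) \<and>
        s A (Zob K) \<zero>\<^bsub>EOb E A (Zob K)\<^esub> = hclass K n (Zob K) A (triv_right K n A))"

definition exact_realization ::
  "('o, 'm) addcat \<Rightarrow> ('o, 'm, 'e) bifun \<Rightarrow> ('o, 'm, 'e) realiz \<Rightarrow> nat \<Rightarrow> bool" where
  "exact_realization K E s n \<longleftrightarrow>
     (\<forall>C\<in>Ob K. \<forall>A\<in>Ob K. \<forall>\<delta>\<in>Ex E C A.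
        \<exists>X\<in>complexes_ends K n A C. s C A \<delta> = hclass K n A C X) \<and>
     R0 K E s n \<and> R1 K E s n \<and> R2 K E s n"

definition conflations ::
  "('o, 'm) addcat \<Rightarrow> ('o, 'm, 'e) bifun \<Rightarrow> ('o, 'm, 'e) realiz \<Rightarrow> ('o, 'm) cpx set" where
  "conflations K E s = (\<Union>C\<in>Ob K. \<Union>A\<in>Ob K. \<Union>\<delta>\<in>Ex E C A. s C A \<delta>)"

text \<open>Admissible monomorphisms and epimorphisms of a class of complexes; for the class of
  conflations these are the inflations and the deflations.\<close>

definition adm_mono :: "('o, 'm) cpx set \<Rightarrow> 'm \<Rightarrow> bool" where
  "adm_mono \<X> f \<longleftrightarrow> (\<exists>X\<in>\<X>. f = df X 0)"

definition adm_epi :: "nat \<Rightarrow> ('o, 'm) cpx set \<Rightarrow> 'm \<Rightarrow> bool" where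
  "adm_epi n \<X> f \<longleftrightarrow> (\<exists>X\<in>\<X>. f = df X n)"

abbreviation inflation ::
  "('o, 'm) addcat \<Rightarrow> ('o, 'm, 'e) bifun \<Rightarrow> ('o, 'm, 'e) realiz \<Rightarrow> 'm \<Rightarrow> bool" where
  "inflation K E s \<equiv> adm_mono (conflations K E s)"

abbreviation deflation ::
  "('o, 'm) addcat \<Rightarrow> ('o, 'm, 'e) bifun \<Rightarrow> ('o, 'm, 'e) realiz \<Rightarrow> nat \<Rightarrow> 'm \<Rightarrow> bool" where
  "deflation K E s n \<equiv> adm_epi n (conflations K E s)"

definition comp_closed :: "('o, 'm) addcat \<Rightarrow> ('m \<Rightarrow> bool) \<Rightarrow> bool" where
  "comp_closed K P \<longleftrightarrow>
     (\<forall>A\<in>Ob K. \<forall>B\<in>Ob K. \<forall>C\<in>Ob K. \<forall>f\<in>Mor K A B. \<forall>g\<in>Mor K B C.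
        P f \<longrightarrow> P g \<longrightarrow> P (g \<cdot>\<^bsub>K\<^esub> f))"

definition EA1 ::
  "('o, 'm) addcat \<Rightarrow> ('o, 'm, 'e) bifun \<Rightarrow> ('o, 'm, 'e) realiz \<Rightarrow> nat \<Rightarrow> bool" where
  "EA1 K E s n \<longleftrightarrow> comp_closed K (inflation K E s) \<and> comp_closed K (deflation K E s n)"

definition EA2 ::
  "('o, 'm) addcat \<Rightarrow> ('o, 'm, 'e) bifun \<Rightarrow> ('o, 'm, 'e) realiz \<Rightarrow> nat \<Rightarrow> bool" where
  "EA2 K E s n \<longleftrightarrow>
     (\<forall>A\<in>Ob K. \<forall>C\<in>Ob K. \<forall>D\<in>Ob K. \<forall>\<rho>\<in>Ex E D A. \<forall>c\<in>Mor K C D.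
        \<forall>X\<in>s C A (pull K E A c \<rho>). \<forall>Y\<in>s D A \<rho>.
          \<exists>f. chain_map K n X Y f \<and> f 0 = Idt K A \<and> f (n+1) = c \<and>
              cone K n X Y f \<in> s D (ob X 1) (push K E D (df X 0) \<rho>))"

definition EA2_op ::
  "('o, 'm) addcat \<Rightarrow> ('o, 'm, 'e) bifun \<Rightarrow> ('o, 'm, 'e) realiz \<Rightarrow> nat \<Rightarrow> bool" where
  "EA2_op K E s n \<longleftrightarrow>
     (\<forall>A\<in>Ob K. \<forall>B\<in>Ob K. \<forall>C\<in>Ob K. \<forall>\<delta>\<in>Ex E C A. \<forall>a\<in>Mor K A B.
        \<forall>X\<in>s C A \<delta>. \<forall>Y\<in>s C B (push K E C a \<delta>).
          \<exists>f. chain_map K n X Y f \<and> f 0 = a \<and> f (n+1) = Idt K C \<and>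
              cocone K n X Y f \<in> s (ob Y n) A (pull K E A (df Y n) \<delta>))"

definition n_exangulated ::
  "('o, 'm) addcat \<Rightarrow> ('o, 'm, 'e) bifun \<Rightarrow> ('o, 'm, 'e) realiz \<Rightarrow> nat \<Rightarrow> bool" where
  "n_exangulated K E s n \<longleftrightarrow>
     additive_category K \<and> biadditive_functor K E \<and> exact_realization K E s n \<and>
     EA1 K E s n \<and> EA2 K E s n \<and> EA2_op K E s n"


section \<open>n-exact sequences and n-exact categories\<close>

definition n_kernel_seq :: "('o, 'm) addcat \<Rightarrow> nat \<Rightarrow> ('o, 'm) cpx \<Rightarrow> bool" where
  "n_kernel_seq K n X \<longleftrightarrow> X \<in> complexes K n \<and>
     (\<forall>W\<in>Ob K.
        a_kernel (Hom K W (ob X 0)) (Hom K W (ob X 1)) (\<lambda>g. df X 0 \<cdot>\<^bsub>K\<^esub> g)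
          = {\<zero>\<^bsub>Hom K W (ob X 0)\<^esub>} \<and>
        (\<forall>i\<in>{1..n}. exact_cov K W X i))"

definition n_cokernel_seq :: "('o, 'm) addcat \<Rightarrow> nat \<Rightarrow> ('o, 'm) cpx \<Rightarrow> bool" where
  "n_cokernel_seq K n X \<longleftrightarrow> X \<in> complexes K n \<and>
     (\<forall>W\<in>Ob K.
        a_kernel (Hom K (ob X (n+1)) W) (Hom K (ob X n) W) (\<lambda>g. g \<cdot>\<^bsub>K\<^esub> df X n)
          = {\<zero>\<^bsub>Hom K (ob X (n+1)) W\<^esub>} \<and>
        (\<forall>i\<in>{1..n}. exact_contra K W X i))"

definition n_exact_seq :: "('o, 'm) addcat \<Rightarrow> nat \<Rightarrow> ('o, 'm) cpx \<Rightarrow> bool" where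
  "n_exact_seq K n X \<longleftrightarrow> n_kernel_seq K n X \<and> n_cokernel_seq K n X"

definition EC' :: "('o, 'm) addcat \<Rightarrow> nat \<Rightarrow> ('o, 'm) cpx set \<Rightarrow> bool" where
  "EC' K n \<X> \<longleftrightarrow>
     (\<forall>A\<in>Ob K. \<forall>C\<in>Ob K. \<forall>X\<in>\<X> \<inter> complexes_ends K n A C. \<forall>Y\<in>complexes_ends K n A C.
        homotopy_equiv K n A C X Y \<longrightarrow> Y \<in> \<X>)"

definition E0 :: "('o, 'm) addcat \<Rightarrow> ('o, 'm) cpx set \<Rightarrow> bool" where
  "E0 K \<X> \<longleftrightarrow> \<lparr> ob = (\<lambda>_. Zob K), df = (\<lambda>_. \<zero>\<^bsub>Hom K (Zob K) (Zob K)\<^esub>) \<rparr> \<in> \<X>"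

definition E1 :: "('o, 'm) addcat \<Rightarrow> ('o, 'm) cpx set \<Rightarrow> bool" where
  "E1 K \<X> \<longleftrightarrow> comp_closed K (adm_mono \<X>)"

definition E1_op :: "('o, 'm) addcat \<Rightarrow> nat \<Rightarrow> ('o, 'm) cpx set \<Rightarrow> bool" where
  "E1_op K n \<X> \<longleftrightarrow> comp_closed K (adm_epi n \<X>)"

definition E2'_op :: "('o, 'm) addcat \<Rightarrow> nat \<Rightarrow> ('o, 'm) cpx set \<Rightarrow> bool" where
  "E2'_op K n \<X> \<longleftrightarrow>
     (\<forall>A\<in>Ob K. \<forall>C\<in>Ob K. \<forall>C'\<in>Ob K. \<forall>c\<in>Mor K C' C. \<forall>Y\<in>\<X>. ob Y 0 = A \<longrightarrow> ob Y (n+1) = C \<longrightarrow>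
        (\<exists>X\<in>\<X>. ob X 0 = A \<and> ob X (n+1) = C' \<and>
           (\<exists>f. chain_map K n X Y f \<and> f 0 = Idt K A \<and> f (n+1) = c))) \<and>
     (\<forall>A\<in>Ob K. \<forall>X\<in>\<X>. \<forall>Y\<in>\<X>. \<forall>f. ob X 0 = A \<longrightarrow> ob Y 0 = A \<longrightarrow>
        chain_map K n X Y f \<longrightarrow> f 0 = Idt K A \<longrightarrow> cone K n X Y f \<in> \<X>)"

definition E2' :: "('o, 'm) addcat \<Rightarrow> nat \<Rightarrow> ('o, 'm) cpx set \<Rightarrow> bool" where
  "E2' K n \<X> \<longleftrightarrow>
     (\<forall>A\<in>Ob K. \<forall>C\<in>Ob K. \<forall>A'\<in>Ob K. \<forall>a\<in>Mor K A A'. \<forall>X\<in>\<X>. ob X 0 = A \<longrightarrow> ob X (n+1) = C \<longrightarrow>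
        (\<exists>Y\<in>\<X>. ob Y 0 = A' \<and> ob Y (n+1) = C \<and>
           (\<exists>f. chain_map K n X Y f \<and> f 0 = a \<and> f (n+1) = Idt K C))) \<and>
     (\<forall>C\<in>Ob K. \<forall>X\<in>\<X>. \<forall>Y\<in>\<X>. \<forall>f. ob X (n+1) = C \<longrightarrow> ob Y (n+1) = C \<longrightarrow>
        chain_map K n X Y f \<longrightarrow> f (n+1) = Idt K C \<longrightarrow> cocone K n X Y f \<in> \<X>)"

definition EI :: "('o, 'm) addcat \<Rightarrow> nat \<Rightarrow> ('o, 'm) cpx set \<Rightarrow> bool" where
  "EI K n \<X> \<longleftrightarrow>
     (\<forall>A\<in>Ob K. \<forall>C\<in>Ob K. \<forall>X\<in>\<X> \<inter> complexes_ends K n A C. \<forall>X'\<in>complexes_ends K n A C.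
        n_exact_seq K n X' \<longrightarrow>
        (\<exists>f. chain_map_ends K n A C X X' f) \<or> (\<exists>f. chain_map_ends K n A C X' X f) \<longrightarrow>
        hclass K n A C X = hclass K n A C X')"

text \<open>Of \<open>X\<close>, \<open>Y\<close>, \<open>f\<close> only the degrees \<open>1, \<dots>, n + 1\<close> (for the pullback) or \<open>0, \<dots>, n\<close> (for
  the pushout) are used.  That the rows are complexes follows from the (co)cone being one.\<close>

definition n_pullback ::
  "('o, 'm) addcat \<Rightarrow> nat \<Rightarrow> ('o, 'm) cpx \<Rightarrow> ('o, 'm) cpx \<Rightarrow> (nat \<Rightarrow> 'm) \<Rightarrow> bool" where
  "n_pullback K n X Y f \<longleftrightarrow>
     (\<forall>i\<in>{1..n+1}. ob X i \<in> Ob K \<and> ob Y i \<in> Ob K \<and> f i \<in> Mor K (ob X i) (ob Y i)) \<and>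
     (\<forall>i\<in>{1..n}. df X i \<in> Mor K (ob X i) (ob X (i+1)) \<and> df Y i \<in> Mor K (ob Y i) (ob Y (i+1)) \<and>
        f (i+1) \<cdot>\<^bsub>K\<^esub> df X i = df Y i \<cdot>\<^bsub>K\<^esub> f i) \<and>
     n_kernel_seq K n (cone K n X Y f)"

definition n_pushout ::
  "('o, 'm) addcat \<Rightarrow> nat \<Rightarrow> ('o, 'm) cpx \<Rightarrow> ('o, 'm) cpx \<Rightarrow> (nat \<Rightarrow> 'm) \<Rightarrow> bool" where
  "n_pushout K n X Y f \<longleftrightarrow>
     (\<forall>i\<le>n. ob X i \<in> Ob K \<and> ob Y i \<in> Ob K \<and> f i \<in> Mor K (ob X i) (ob Y i)) \<and>
     (\<forall>i<n. df X i \<in> Mor K (ob X i) (ob X (i+1)) \<and> df Y i \<in> Mor K (ob Y i) (ob Y (i+1)) \<and>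
        f (i+1) \<cdot>\<^bsub>K\<^esub> df X i = df Y i \<cdot>\<^bsub>K\<^esub> f i) \<and>
     n_cokernel_seq K n (cocone K n X Y f)"

definition EC :: "('o, 'm) addcat \<Rightarrow> nat \<Rightarrow> ('o, 'm) cpx set \<Rightarrow> bool" where
  "EC K n \<X> \<longleftrightarrow>
     (\<forall>X Y f. n_exact_seq K n X \<longrightarrow> n_exact_seq K n Y \<longrightarrow> chain_map K n X Y f \<longrightarrow>
        (\<exists>k\<le>n. isomor K (f k) \<and> isomor K (f (k+1))) \<or> (isomor K (f 0) \<and> isomor K (f (n+1))) \<longrightarrow>
        (X \<in> \<X> \<longleftrightarrow> Y \<in> \<X>))"

definition E2 :: "('o, 'm) addcat \<Rightarrow> nat \<Rightarrow> ('o, 'm) cpx set \<Rightarrow> bool" where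
  "E2 K n \<X> \<longleftrightarrow>
     (\<forall>X\<in>\<X>. \<forall>B\<in>Ob K. \<forall>a\<in>Mor K (ob X 0) B.
        \<exists>Y f. ob Y 0 = B \<and> f 0 = a \<and> n_pushout K n X Y f \<and> adm_mono \<X> (df Y 0))"

definition E2_op :: "('o, 'm) addcat \<Rightarrow> nat \<Rightarrow> ('o, 'm) cpx set \<Rightarrow> bool" where
  "E2_op K n \<X> \<longleftrightarrow>
     (\<forall>Y\<in>\<X>. \<forall>D\<in>Ob K. \<forall>c\<in>Mor K D (ob Y (n+1)).
        \<exists>X f. ob X (n+1) = D \<and> f (n+1) = c \<and> n_pullback K n X Y f \<and> adm_epi n \<X> (df X n))"

definition n_exact_category :: "('o, 'm) addcat \<Rightarrow> nat \<Rightarrow> ('o, 'm) cpx set \<Rightarrow> bool" where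
  "n_exact_category K n \<X> \<longleftrightarrow>
     additive_category K \<and> (\<forall>X\<in>\<X>. n_exact_seq K n X) \<and>
     E0 K \<X> \<and> E1 K \<X> \<and> E1_op K n \<X> \<and> EC K n \<X> \<and> E2 K n \<X> \<and> E2_op K n \<X>"

end

theory Submission
  imports Defs
begin

text \<open>
  Every chain map between conflations is a morphism of extensions: \<open>f\<^sup>0\<^sub>* \<delta>\<close> dies in \<open>E(C, Y\<^sup>1)\<close>, hence
  equals \<open>x\<^sup>* \<rho>\<close> for some \<open>x\<close>; a lift of \<open>(f\<^sup>0, x)\<close> agrees with \<open>f\<close> in degree \<open>0\<close>, so it is homotopic to
  \<open>f\<close> above degree \<open>0\<close>, and because \<open>d\<^sup>n\<close> is epic \<open>x\<close> and \<open>f\<^sup>n\<^sup>+\<^sup>1\<close> pull \<open>\<rho>\<close> back to the same extension.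
  Consequently a chain map that is the identity at one end is homotopic to a lift provided by (EA2) or
  its dual, the two cones are isomorphic, and (E2'), (E2'op) follow.

  An \<open>n\<close>-exact sequence that is isomorphic to a conflation in two consecutive degrees is homotopy
  equivalent to it and is itself a conflation.  So it suffices that its first morphism be an
  inflation, or its last one a deflation, and this is what the two extra hypotheses of the second part
  provide for a chain map that is invertible at both ends.
\<close>

section \<open>Additive categories\<close>

text \<open>An n-exangle is exact only as far as E(-, X^0) and E(X^(n+1), -): its definition does
  not say which classes in E(C, Y^0) die in E(C, Y^1). This missing exactness is the obstacle, and a
  single cone over a coproduct inclusion supplies it. Monicity of inflations and epicity of
  deflations act only by making conflations n-exact. Chain maps with a common end component then
  differ by a homotopy that vanishes at that end. The cone omits X^0 and Y^0, and the cocone omits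
  X^(n+1) and Y^(n+1), so such a homotopy yields an isomorphism of cones that fixes their ends.
  Transport is delicate because \<open>s\<close> sees only homotopy classes with fixed end terms,
  while an isomorphism in two consecutive degrees makes the end components invertible merely up to
  terms that factor through d^0 or d^n. Such terms do not change an extension, which can therefore
  be carried to the new ends. By (R2) isomorphisms are inflations and deflations; composing them
  with the outer differentials is what brings the cancellation hypotheses into play.\<close>

definition opc :: "('o, 'm) addcat \<Rightarrow> ('o, 'm) addcat" where
  "opc K = \<lparr> Ob = Ob K, Hom = (\<lambda>A B. Hom K B A), Idt = Idt K, cmp = (\<lambda>g f. cmp K f g),
    Zob = Zob K, Sum = Sum K, In1 = Pr1 K, In2 = Pr2 K, Pr1 = In1 K, Pr2 = In2 K \<rparr>"

definition revc :: "nat \<Rightarrow> ('o, 'm) cpx \<Rightarrow> ('o, 'm) cpx" where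
  "revc n X = \<lparr> ob = (\<lambda>i. ob X (Suc n - i)), df = (\<lambda>i. df X (n - i)) \<rparr>"

lemma opc_simps [simp]:
  "Ob (opc K) = Ob K" "Hom (opc K) A B = Hom K B A" "Idt (opc K) = Idt K"
  "cmp (opc K) g f = cmp K f g" "Zob (opc K) = Zob K"
  by (simp_all add: opc_def)

lemma revc_simps [simp]: "ob (revc n X) i = ob X (Suc n - i)" "df (revc n X) i = df X (n - i)"
  by (simp_all add: revc_def)

context additive_category
begin

text \<open>A morphism determines its domain and codomain, so sums need not be indexed by hom sets and
  typing conditions become equations between objects, which the simplifier can discharge.\<close>

definition arr :: "'m \<Rightarrow> bool" where
  "arr f \<longleftrightarrow> (\<exists>A\<in>Ob K. \<exists>B\<in>Ob K. f \<in> Mor K A B)"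

definition dm :: "'m \<Rightarrow> 'o" where
  "dm f = (THE A. A \<in> Ob K \<and> (\<exists>B\<in>Ob K. f \<in> Mor K A B))"

definition cd :: "'m \<Rightarrow> 'o" where
  "cd f = (THE B. B \<in> Ob K \<and> (\<exists>A\<in>Ob K. f \<in> Mor K A B))"

text \<open>The hom group is read off the left summand alone, which is why the laws below require
  the other summands to have the same ends.\<close>

definition padd :: "'m \<Rightarrow> 'm \<Rightarrow> 'm" (infixl "[+]" 65) where
  "f [+] g = f \<oplus>\<^bsub>Hom K (dm f) (cd f)\<^esub> g"

definition pneg :: "'m \<Rightarrow> 'm" ("[-] _" [80] 80) where
  "[-] f = \<ominus>\<^bsub>Hom K (dm f) (cd f)\<^esub> f"

lemma hom_dm: "\<lbrakk>A \<in> Ob K; B \<in> Ob K; f \<in> Mor K A B\<rbrakk> \<Longrightarrow> dm f = A"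
  unfolding dm_def by (rule the_equality) (use hom_disjoint in blast)+

lemma hom_cd: "\<lbrakk>A \<in> Ob K; B \<in> Ob K; f \<in> Mor K A B\<rbrakk> \<Longrightarrow> cd f = B"
  unfolding cd_def by (rule the_equality) (use hom_disjoint in blast)+

lemma hom_iff: "\<lbrakk>A \<in> Ob K; B \<in> Ob K\<rbrakk> \<Longrightarrow> f \<in> Mor K A B \<longleftrightarrow> arr f \<and> dm f = A \<and> cd f = B"
  using hom_dm hom_cd arr_def by metis

lemma arr_homD: "arr f \<Longrightarrow> dm f \<in> Ob K \<and> cd f \<in> Ob K \<and> f \<in> Mor K (dm f) (cd f)"
  using hom_dm hom_cd arr_def by metis

lemma dm_ob [simp]: "arr f \<Longrightarrow> dm f \<in> Ob K"
  and cd_ob [simp]: "arr f \<Longrightarrow> cd f \<in> Ob K"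
  and arr_hom: "arr f \<Longrightarrow> f \<in> Mor K (dm f) (cd f)"
  using arr_homD by auto

lemma
  assumes "arr f" "arr g" "dm g = cd f"
  shows arr_cmp [simp]: "arr (g \<cdot> f)"
    and dm_cmp [simp]: "dm (g \<cdot> f) = dm f"
    and cd_cmp [simp]: "cd (g \<cdot> f) = cd g"
  using comp_mor[of "dm f" "cd f" "cd g" f g] assms hom_iff arr_hom dm_ob cd_ob by metis+

lemma cmp_assoc [simp]:
  "\<lbrakk>arr f; arr g; arr h; dm g = cd f; dm h = cd g\<rbrakk> \<Longrightarrow> (h \<cdot> g) \<cdot> f = h \<cdot> (g \<cdot> f)"
  using comp_assoc[of "dm f" "cd f" "cd g" "cd h" f g h] arr_hom dm_ob cd_ob by metis

lemma
  assumes "A \<in> Ob K"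
  shows arr_idt [simp]: "arr (Idt K A)"
    and dm_idt [simp]: "dm (Idt K A) = A"
    and cd_idt [simp]: "cd (Idt K A) = A"
  using id_mor[OF assms] hom_iff[OF assms assms] by auto

lemma cmp_idt_right [simp]: "\<lbrakk>arr f; dm f = A\<rbrakk> \<Longrightarrow> f \<cdot> Idt K A = f"
  using comp_id_right arr_homD by blast

lemma cmp_idt_left [simp]: "\<lbrakk>arr f; cd f = A\<rbrakk> \<Longrightarrow> Idt K A \<cdot> f = f"
  using comp_id_left arr_homD by blast

lemma
  assumes "A \<in> Ob K" "B \<in> Ob K"
  shows arr_zero [simp]: "arr \<zero>\<^bsub>Hom K A B\<^esub>"
    and dm_zero [simp]: "dm \<zero>\<^bsub>Hom K A B\<^esub> = A"
    and cd_zero [simp]: "cd \<zero>\<^bsub>Hom K A B\<^esub> = B"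
proof -
  interpret abelian_group "Hom K A B" using hom_abelian assms .
  have "\<zero>\<^bsub>Hom K A B\<^esub> \<in> Mor K A B" by simp
  then show "arr \<zero>\<^bsub>Hom K A B\<^esub>" "dm \<zero>\<^bsub>Hom K A B\<^esub> = A" "cd \<zero>\<^bsub>Hom K A B\<^esub> = B"
    using hom_iff assms by auto
qed

text \<open>The definitions of complexes, homotopies and cones use indexed operations; these rules
  remove the index as soon as the ends of the left summand are known.\<close>

lemma add_eq_padd [simp]: "\<lbrakk>arr f; dm f = A; cd f = B\<rbrakk> \<Longrightarrow> f \<oplus>\<^bsub>Hom K A B\<^esub> g = f [+] g"
  by (auto simp: padd_def)

lemma neg_eq_pneg [simp]: "\<lbrakk>arr f; dm f = A; cd f = B\<rbrakk> \<Longrightarrow> \<ominus>\<^bsub>Hom K A B\<^esub> f = [-] f"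
  by (auto simp: pneg_def)

lemma minus_eq_padd [simp]:
  "\<lbrakk>arr f; arr g; dm f = A; cd f = B; dm g = A; cd g = B\<rbrakk> \<Longrightarrow> f \<ominus>\<^bsub>Hom K A B\<^esub> g = f [+] [-] g"
  by (simp add: a_minus_def)

lemma
  assumes "arr f" "arr g" "dm g = dm f" "cd g = cd f"
  shows arr_padd [simp]: "arr (f [+] g)"
    and dm_padd [simp]: "dm (f [+] g) = dm f"
    and cd_padd [simp]: "cd (f [+] g) = cd f"
    and padd_comm: "f [+] g = g [+] f"
proof -
  interpret abelian_group "Hom K (dm f) (cd f)" using hom_abelian assms by simp
  have fg: "f \<in> Mor K (dm f) (cd f)" "g \<in> Mor K (dm f) (cd f)"
    using arr_hom assms by metis+
  have "f [+] g \<in> Mor K (dm f) (cd f)"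
    unfolding padd_def using fg by (simp del: add_eq_padd)
  then show "arr (f [+] g)" "dm (f [+] g) = dm f" "cd (f [+] g) = cd f"
    using hom_iff assms dm_ob cd_ob by metis+
  show "f [+] g = g [+] f"
    using a_comm[OF fg] assms by simp
qed

lemma
  assumes "arr f"
  shows arr_pneg [simp]: "arr ([-] f)"
    and dm_pneg [simp]: "dm ([-] f) = dm f"
    and cd_pneg [simp]: "cd ([-] f) = cd f"
    and pneg_pneg [simp]: "[-] [-] f = f"
    and padd_pneg [simp]: "f [+] [-] f = \<zero>\<^bsub>Hom K (dm f) (cd f)\<^esub>"
    and pneg_padd [simp]: "[-] f [+] f = \<zero>\<^bsub>Hom K (dm f) (cd f)\<^esub>"
proof -
  interpret abelian_group "Hom K (dm f) (cd f)" using hom_abelian assms by simp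
  have f: "f \<in> Mor K (dm f) (cd f)" using arr_hom assms by metis
  have "[-] f \<in> Mor K (dm f) (cd f)"
    unfolding pneg_def using f by (simp del: neg_eq_pneg)
  then show *: "arr ([-] f)" "dm ([-] f) = dm f" "cd ([-] f) = cd f"
    using hom_iff assms dm_ob cd_ob by metis+
  show "[-] [-] f = f"
    using minus_minus[OF f] * assms by simp
  show "f [+] [-] f = \<zero>\<^bsub>Hom K (dm f) (cd f)\<^esub>"
    using r_neg[OF f] * assms by simp
  show "[-] f [+] f = \<zero>\<^bsub>Hom K (dm f) (cd f)\<^esub>"
    using l_neg[OF f] * assms by simp
qed

lemma padd_assoc:
  assumes "arr f" "arr g" "arr h" "dm g = dm f" "cd g = cd f" "dm h = dm f" "cd h = cd f"
  shows "(f [+] g) [+] h = f [+] (g [+] h)"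
proof -
  interpret abelian_group "Hom K (dm f) (cd f)" using hom_abelian assms by simp
  have fgh: "f \<in> Mor K (dm f) (cd f)" "g \<in> Mor K (dm f) (cd f)" "h \<in> Mor K (dm f) (cd f)"
    using arr_hom assms by metis+
  show ?thesis
    using a_assoc[OF fgh] assms by simp
qed

lemma padd_left_comm:
  assumes "arr f" "arr g" "arr h" "dm g = dm f" "cd g = cd f" "dm h = dm f" "cd h = cd f"
  shows "f [+] (g [+] h) = g [+] (f [+] h)"
  using assms padd_assoc[of f g h] padd_assoc[of g f h] padd_comm[of f g] by metis

lemma padd_zero_right [simp]: "\<lbrakk>arr f; dm f = A; cd f = B\<rbrakk> \<Longrightarrow> f [+] \<zero>\<^bsub>Hom K A B\<^esub> = f"
proof -
  assume *: "arr f" "dm f = A" "cd f = B"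
  then interpret abelian_group "Hom K A B" using hom_abelian by auto
  show ?thesis using r_zero[of f] * arr_hom[of f] by simp
qed

lemma padd_zero_left [simp]: "\<lbrakk>arr f; dm f = A; cd f = B\<rbrakk> \<Longrightarrow> \<zero>\<^bsub>Hom K A B\<^esub> [+] f = f"
  using padd_zero_right[of f A B] padd_comm[of f "\<zero>\<^bsub>Hom K A B\<^esub>"] by auto

lemma pneg_cancel_left [simp]:
  "\<lbrakk>arr f; arr g; dm g = dm f; cd g = cd f\<rbrakk> \<Longrightarrow> [-] f [+] (f [+] g) = g"
  "\<lbrakk>arr f; arr g; dm g = dm f; cd g = cd f\<rbrakk> \<Longrightarrow> f [+] ([-] f [+] g) = g"
  by (simp_all flip: padd_assoc)

lemma padd_cancel_left:
  "\<lbrakk>arr f; arr g; arr h; dm g = dm f; cd g = cd f; dm h = dm f; cd h = cd f\<rbrakk>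
    \<Longrightarrow> f [+] g = f [+] h \<longleftrightarrow> g = h"
  using pneg_cancel_left(1) by metis

lemma pneg_zero [simp]: "\<lbrakk>A \<in> Ob K; B \<in> Ob K\<rbrakk> \<Longrightarrow> [-] \<zero>\<^bsub>Hom K A B\<^esub> = \<zero>\<^bsub>Hom K A B\<^esub>"
  by (metis padd_pneg padd_zero_left arr_zero arr_pneg dm_pneg cd_pneg dm_zero cd_zero)

lemma pneg_distrib [simp]:
  assumes "arr f" "arr g" "dm g = dm f" "cd g = cd f"
  shows "[-] (f [+] g) = [-] f [+] [-] g"
proof -
  have "(f [+] g) [+] ([-] f [+] [-] g) = \<zero>\<^bsub>Hom K (dm f) (cd f)\<^esub>"
    using assms by (simp add: padd_assoc padd_left_comm[of g "[-] f"])
  also have "\<dots> = (f [+] g) [+] [-] (f [+] g)" using assms by simp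
  finally show ?thesis using assms by (subst (asm) padd_cancel_left) auto
qed

lemma padd_eq_zero_iff:
  "\<lbrakk>arr f; arr g; dm f = A; cd f = B; dm g = A; cd g = B\<rbrakk>
    \<Longrightarrow> f [+] [-] g = \<zero>\<^bsub>Hom K A B\<^esub> \<longleftrightarrow> f = g"
  using padd_cancel_left[of "[-] g" f g] padd_comm[of f "[-] g"] by auto

lemma cmp_padd_right [simp]:
  "\<lbrakk>arr f; arr f'; arr g; dm f' = dm f; cd f' = cd f; dm g = cd f\<rbrakk>
    \<Longrightarrow> g \<cdot> (f [+] f') = g \<cdot> f [+] g \<cdot> f'"
  using comp_add_right[of "dm f" "cd f" "cd g" f f' g] arr_hom[of f] arr_hom[of f'] arr_hom[of g]
  by simp

lemma cmp_padd_left [simp]: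
  "\<lbrakk>arr f; arr g; arr g'; dm g' = dm g; cd g' = cd g; dm g = cd f\<rbrakk>
    \<Longrightarrow> (g [+] g') \<cdot> f = g \<cdot> f [+] g' \<cdot> f"
  using comp_add_left[of "dm f" "cd f" "cd g" f g g'] arr_hom[of f] arr_hom[of g] arr_hom[of g']
  by simp

text \<open>An additive map sends zero to an idempotent, and zero is the only idempotent of a group;
  this is how composition is seen to preserve zero morphisms.\<close>

lemma padd_idem_zero: "\<lbrakk>arr f; f [+] f = f\<rbrakk> \<Longrightarrow> f = \<zero>\<^bsub>Hom K (dm f) (cd f)\<^esub>"
  using pneg_cancel_left(1)[of f f] by simp

lemma cmp_zero_right [simp]:
  assumes "arr g" "dm g = B" "A \<in> Ob K"
  shows "g \<cdot> \<zero>\<^bsub>Hom K A B\<^esub> = \<zero>\<^bsub>Hom K A (cd g)\<^esub>"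
proof -
  have B: "B \<in> Ob K" using assms by auto
  have "g \<cdot> (\<zero>\<^bsub>Hom K A B\<^esub> [+] \<zero>\<^bsub>Hom K A B\<^esub>) = g \<cdot> \<zero>\<^bsub>Hom K A B\<^esub>"
    using assms B by (simp del: cmp_padd_right)
  then show ?thesis
    using padd_idem_zero[of "g \<cdot> \<zero>\<^bsub>Hom K A B\<^esub>"] assms B by (simp del: padd_zero_left padd_zero_right)
qed

lemma cmp_zero_left [simp]:
  assumes "arr f" "cd f = B" "C \<in> Ob K"
  shows "\<zero>\<^bsub>Hom K B C\<^esub> \<cdot> f = \<zero>\<^bsub>Hom K (dm f) C\<^esub>"
proof -
  have B: "B \<in> Ob K" using assms by auto
  have "(\<zero>\<^bsub>Hom K B C\<^esub> [+] \<zero>\<^bsub>Hom K B C\<^esub>) \<cdot> f = \<zero>\<^bsub>Hom K B C\<^esub> \<cdot> f"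
    using assms B by (simp del: cmp_padd_left)
  then show ?thesis
    using padd_idem_zero[of "\<zero>\<^bsub>Hom K B C\<^esub> \<cdot> f"] assms B by (simp del: padd_zero_left padd_zero_right)
qed

lemma cmp_pneg_right [simp]:
  assumes "arr f" "arr g" "dm g = cd f"
  shows "g \<cdot> [-] f = [-] (g \<cdot> f)"
proof -
  have "g \<cdot> f [+] g \<cdot> [-] f = g \<cdot> f [+] [-] (g \<cdot> f)"
    using assms by (simp flip: cmp_padd_right)
  then show ?thesis using assms by (subst (asm) padd_cancel_left) auto
qed

lemma cmp_pneg_left [simp]:
  assumes "arr f" "arr g" "dm g = cd f"
  shows "[-] g \<cdot> f = [-] (g \<cdot> f)"
proof -
  have "g \<cdot> f [+] [-] g \<cdot> f = g \<cdot> f [+] [-] (g \<cdot> f)"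
    using assms by (simp flip: cmp_padd_left)
  then show ?thesis using assms by (subst (asm) padd_cancel_left) auto
qed

section \<open>Zero object and biproducts\<close>

lemma zob_simps [simp]: "Zob K \<in> Ob K" "Idt K (Zob K) = \<zero>\<^bsub>Hom K (Zob K) (Zob K)\<^esub>"
  using zero_ob zero_terminal id_mor by auto

lemma sum_simps [simp]:
  assumes "A \<in> Ob K" "B \<in> Ob K"
  shows "Sum K A B \<in> Ob K"
    "arr (In1 K A B)" "dm (In1 K A B) = A" "cd (In1 K A B) = Sum K A B"
    "arr (In2 K A B)" "dm (In2 K A B) = B" "cd (In2 K A B) = Sum K A B"
    "arr (Pr1 K A B)" "dm (Pr1 K A B) = Sum K A B" "cd (Pr1 K A B) = A"
    "arr (Pr2 K A B)" "dm (Pr2 K A B) = Sum K A B" "cd (Pr2 K A B) = B"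
    "Pr1 K A B \<cdot> In1 K A B = Idt K A" "Pr2 K A B \<cdot> In2 K A B = Idt K B"
    "Pr1 K A B \<cdot> In2 K A B = \<zero>\<^bsub>Hom K B A\<^esub>" "Pr2 K A B \<cdot> In1 K A B = \<zero>\<^bsub>Hom K A B\<^esub>"
  using assms sum_ob[OF assms] sum_mor[OF assms] sum_biproduct[OF assms] by (auto simp: hom_iff)

text \<open>Composites are kept associated to the right, so a cancellation law is also needed with a
  tail \<open>f\<close>. \<open>df_df_cmp\<close> and \<open>chain_map_nat\<close> do the same for
  differentials and chain maps.\<close>

lemma sum_simps_cmp [simp]:
  assumes "A \<in> Ob K" "B \<in> Ob K" "arr f"
  shows "cd f = A \<Longrightarrow> Pr1 K A B \<cdot> (In1 K A B \<cdot> f) = f"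
    "cd f = B \<Longrightarrow> Pr2 K A B \<cdot> (In2 K A B \<cdot> f) = f"
    "cd f = B \<Longrightarrow> Pr1 K A B \<cdot> (In2 K A B \<cdot> f) = \<zero>\<^bsub>Hom K (dm f) A\<^esub>"
    "cd f = A \<Longrightarrow> Pr2 K A B \<cdot> (In1 K A B \<cdot> f) = \<zero>\<^bsub>Hom K (dm f) B\<^esub>"
  using assms by (simp_all flip: cmp_assoc)

lemma sum_decomp:
  assumes "A \<in> Ob K" "B \<in> Ob K"
  shows "In1 K A B \<cdot> Pr1 K A B [+] In2 K A B \<cdot> Pr2 K A B = Idt K (Sum K A B)"
  using sum_biproduct[OF assms] assms by simp

lemma padd_swap:
  assumes "arr a" "arr b" "arr c" "arr d" "dm b = dm a" "cd b = cd a" "dm c = dm a" "cd c = cd a"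
    "dm d = dm a" "cd d = cd a"
  shows "(a [+] b) [+] (c [+] d) = (a [+] c) [+] (b [+] d)"
  using assms by (simp add: padd_assoc padd_left_comm[of b c])

section \<open>The opposite category\<close>

text \<open>The hom groups are reused as they are, and injections trade places with projections; the
  biproduct equations are symmetric under this exchange.\<close>

lemma additive_category_opc: "additive_category (opc K)"
proof (rule additive_category.intro)
  show "Sum (opc K) A B \<in> Ob (opc K)" if "A \<in> Ob (opc K)" "B \<in> Ob (opc K)" for A B
    using that by (simp add: opc_def)
  show "In1 (opc K) A B \<in> Mor (opc K) A (Sum (opc K) A B) \<and>
        In2 (opc K) A B \<in> Mor (opc K) B (Sum (opc K) A B) \<and>
        Pr1 (opc K) A B \<in> Mor (opc K) (Sum (opc K) A B) A \<and>
        Pr2 (opc K) A B \<in> Mor (opc K) (Sum (opc K) A B) B"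
    if "A \<in> Ob (opc K)" "B \<in> Ob (opc K)" for A B
    using that by (simp add: opc_def hom_iff)
  show "cmp (opc K) (Pr1 (opc K) A B) (In1 (opc K) A B) = Idt (opc K) A \<and>
        cmp (opc K) (Pr2 (opc K) A B) (In2 (opc K) A B) = Idt (opc K) B \<and>
        cmp (opc K) (Pr1 (opc K) A B) (In2 (opc K) A B) = \<zero>\<^bsub>Hom (opc K) B A\<^esub> \<and>
        cmp (opc K) (Pr2 (opc K) A B) (In1 (opc K) A B) = \<zero>\<^bsub>Hom (opc K) A B\<^esub> \<and>
        cmp (opc K) (In1 (opc K) A B) (Pr1 (opc K) A B) \<oplus>\<^bsub>Hom (opc K) (Sum (opc K) A B) (Sum (opc K) A B)\<^esub>
        cmp (opc K) (In2 (opc K) A B) (Pr2 (opc K) A B) = Idt (opc K) (Sum (opc K) A B)"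
    if "A \<in> Ob (opc K)" "B \<in> Ob (opc K)" for A B
    using that sum_decomp by (simp add: opc_def)
  show "A = A' \<and> B = B'"
    if "A \<in> Ob (opc K)" "B \<in> Ob (opc K)" "A' \<in> Ob (opc K)" "B' \<in> Ob (opc K)"
      "f \<in> Mor (opc K) A B" "f \<in> Mor (opc K) A' B'" for A B A' B' f
    using that hom_iff by auto
  show "abelian_group (Hom (opc K) A B)" if "A \<in> Ob (opc K)" "B \<in> Ob (opc K)" for A B
    using that hom_abelian by simp
qed (simp_all add: hom_iff zero_terminal zero_initial)

lemma opc_arr [simp]: "additive_category.arr (opc K) = arr"
  using additive_category.arr_def[OF additive_category_opc] arr_def by fastforce

lemma opc_dm [simp]: "additive_category.dm (opc K) = cd"
  and opc_cd [simp]: "additive_category.cd (opc K) = dm"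
  using additive_category.dm_def[OF additive_category_opc] cd_def
    additive_category.cd_def[OF additive_category_opc] dm_def by (simp_all add: fun_eq_iff)

lemma opc_padd [simp]: "additive_category.padd (opc K) = padd"
  using additive_category.padd_def[OF additive_category_opc] padd_def by (simp add: fun_eq_iff)

section \<open>Monomorphisms, epimorphisms and isomorphisms\<close>

lemma monicD:
  assumes "monic K f" "arr g" "arr h" "cd g = dm f" "cd h = dm f" "dm g = dm h" "f \<cdot> g = f \<cdot> h"
  shows "g = h"
proof -
  obtain A B where AB: "A \<in> Ob K" "B \<in> Ob K" "f \<in> Mor K A B"
    and m: "\<forall>W\<in>Ob K. \<forall>g\<in>Mor K W A. \<forall>h\<in>Mor K W A. f \<cdot> g = f \<cdot> h \<longrightarrow> g = h"
    using assms(1) unfolding monic_def by (elim bexE conjE, intro that)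
  show ?thesis
    using m[rule_format, of "dm g" g h] assms AB by (simp add: hom_iff)
qed

lemma epicD:
  assumes "epic K f" "arr g" "arr h" "dm g = cd f" "dm h = cd f" "cd g = cd h" "g \<cdot> f = h \<cdot> f"
  shows "g = h"
proof -
  obtain A B where AB: "A \<in> Ob K" "B \<in> Ob K" "f \<in> Mor K A B"
    and m: "\<forall>W\<in>Ob K. \<forall>g\<in>Mor K B W. \<forall>h\<in>Mor K B W. g \<cdot> f = h \<cdot> f \<longrightarrow> g = h"
    using assms(1) unfolding epic_def by (elim bexE conjE, intro that)
  show ?thesis
    using m[rule_format, of "cd g" g h] assms AB by (simp add: hom_iff)
qed

lemma isomorE:
  assumes "isomor K f"
  obtains g where "arr f" "arr g" "dm g = cd f" "cd g = dm f" "g \<cdot> f = Idt K (dm f)" "f \<cdot> g = Idt K (cd f)"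
proof -
  obtain A B g where "A \<in> Ob K" "B \<in> Ob K" "f \<in> Mor K A B" "g \<in> Mor K B A"
      "g \<cdot> f = Idt K A" "f \<cdot> g = Idt K B"
    using assms unfolding isomor_def by (elim bexE conjE, intro that)
  then show ?thesis using that[of g] by (simp add: hom_iff)
qed

text \<open>Insert \<open>a \<cdot> a'\<close> on the right of \<open>b' \<cdot> d'\<close>, move
  the square across, and cancel \<open>b' \<cdot> b\<close> on the left.\<close>

lemma inverse_square:
  assumes "arr a" "arr b" "arr d" "arr d'" "dm a = dm d" "dm b = cd d" "dm d' = cd a" "cd d' = cd b"
    and "arr a'" "arr b'" "dm a' = cd a" "cd a' = dm a" "dm b' = cd b" "cd b' = dm b"
    and "a \<cdot> a' = Idt K (cd a)" "b' \<cdot> b = Idt K (dm b)" and ab: "b \<cdot> d = d' \<cdot> a"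
  shows "b' \<cdot> d' = d \<cdot> a'"
proof -
  have "b' \<cdot> d' = (b' \<cdot> d') \<cdot> (a \<cdot> a')" using assms by simp
  also have "\<dots> = b' \<cdot> ((d' \<cdot> a) \<cdot> a')" using assms(1-14) by simp
  also have "\<dots> = (b' \<cdot> b) \<cdot> (d \<cdot> a')" unfolding ab[symmetric] using assms(1-14) by simp
  finally show ?thesis using assms(1-16) by (simp del: cmp_assoc)
qed

lemma isomor_idt: "A \<in> Ob K \<Longrightarrow> isomor K (Idt K A)"
  unfolding isomor_def using id_mor[of A] by (intro bexI[of _ A] conjI bexI[of _ "Idt K A"]) simp_all

end

section \<open>Complexes and homotopies\<close>

locale complex_category = additive_category K for K :: "('o, 'm) addcat" (structure) +
  fixes n :: nat
begin

abbreviation cx :: "('o, 'm) cpx \<Rightarrow> bool" where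
  "cx X \<equiv> X \<in> complexes K n"

lemma cx_ob: "\<lbrakk>cx X; i \<le> Suc n\<rbrakk> \<Longrightarrow> ob X i \<in> Ob K"
  and cx_df_mor: "\<lbrakk>cx X; i \<le> n\<rbrakk> \<Longrightarrow> df X i \<in> Mor K (ob X i) (ob X (Suc i))"
  and df_df: "\<lbrakk>cx X; i < n\<rbrakk> \<Longrightarrow> df X (Suc i) \<cdot> df X i = \<zero>\<^bsub>Hom K (ob X i) (ob X (Suc (Suc i)))\<^esub>"
  by (auto simp: complexes_def)

declare cx_ob [simp] df_df [simp]

lemma
  assumes "cx X" "i \<le> n"
  shows arr_df [simp]: "arr (df X i)"
    and dm_df [simp]: "dm (df X i) = ob X i"
    and cd_df [simp]: "cd (df X i) = ob X (Suc i)"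
  using cx_df_mor[OF assms] hom_iff[of "ob X i" "ob X (Suc i)"] assms by auto

lemma df_df_cmp [simp]:
  assumes "cx X" "i < n" "arr g" "cd g = ob X i"
  shows "df X (Suc i) \<cdot> (df X i \<cdot> g) = \<zero>\<^bsub>Hom K (dm g) (ob X (Suc (Suc i)))\<^esub>"
proof -
  have "df X (Suc i) \<cdot> (df X i \<cdot> g) = (df X (Suc i) \<cdot> df X i) \<cdot> g"
    using assms by (simp del: df_df)
  then show ?thesis using assms by (simp del: cmp_assoc)
qed

section \<open>Chain maps\<close>

text \<open>Commutation with the differentials is left out because the relation
  \<open>homotopic\<close> does not ask for it.\<close>

definition fam :: "('o, 'm) cpx \<Rightarrow> ('o, 'm) cpx \<Rightarrow> (nat \<Rightarrow> 'm) \<Rightarrow> bool" where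
  "fam X Y f \<longleftrightarrow> (\<forall>i\<le>Suc n. f i \<in> Mor K (ob X i) (ob Y i))"

lemma chain_map_iff:
  "chain_map K n X Y f \<longleftrightarrow> fam X Y f \<and> (\<forall>i\<le>n. f (Suc i) \<cdot> df X i = df Y i \<cdot> f i)"
  by (simp add: chain_map_def fam_def)

lemma famD:
  assumes "fam X Y f" "cx X" "cx Y" "i \<le> Suc n"
  shows "arr (f i)" "dm (f i) = ob X i" "cd (f i) = ob Y i"
  using assms hom_iff[of "ob X i" "ob Y i" "f i"] by (auto simp: fam_def)

lemma famI:
  assumes "cx X" "cx Y" "\<And>i. i \<le> Suc n \<Longrightarrow> arr (f i) \<and> dm (f i) = ob X i \<and> cd (f i) = ob Y i"
  shows "fam X Y f"
  using assms hom_iff[of "ob X i" "ob Y i" "f i" for i] by (auto simp: fam_def)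

lemma chain_mapD:
  assumes "chain_map K n X Y f" "cx X" "cx Y"
  shows "i \<le> Suc n \<Longrightarrow> arr (f i)" "i \<le> Suc n \<Longrightarrow> dm (f i) = ob X i"
    "i \<le> Suc n \<Longrightarrow> cd (f i) = ob Y i" "i \<le> n \<Longrightarrow> f (Suc i) \<cdot> df X i = df Y i \<cdot> f i"
  using assms famD[of X Y f i] by (auto simp: chain_map_iff)

lemma chain_mapI:
  assumes "cx X" "cx Y" "\<And>i. i \<le> Suc n \<Longrightarrow> arr (f i) \<and> dm (f i) = ob X i \<and> cd (f i) = ob Y i"
    and "\<And>i. i \<le> n \<Longrightarrow> f (Suc i) \<cdot> df X i = df Y i \<cdot> f i"
  shows "chain_map K n X Y f"
  using famI[OF assms(1-3)] assms(4) by (simp add: chain_map_iff)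

lemma chain_map_id: "cx X \<Longrightarrow> chain_map K n X X (\<lambda>i. Idt K (ob X i))"
  by (rule chain_mapI) auto

lemma chain_map_comp:
  assumes f: "chain_map K n X Y f" and g: "chain_map K n Y Z g" and [simp]: "cx X" "cx Y" "cx Z"
  shows "chain_map K n X Z (\<lambda>i. g i \<cdot> f i)"
proof (rule chain_mapI)
  note [simp] = chain_mapD[OF f] chain_mapD[OF g]
  fix i assume i: "i \<le> n"
  have "(g (Suc i) \<cdot> f (Suc i)) \<cdot> df X i = g (Suc i) \<cdot> (df Y i \<cdot> f i)"
    using i by simp
  also have "\<dots> = (g (Suc i) \<cdot> df Y i) \<cdot> f i"
    using i by (simp del: chain_mapD(4)[OF g])
  also have "\<dots> = df Z i \<cdot> (g i \<cdot> f i)"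
    using i by simp
  finally show "(g (Suc i) \<cdot> f (Suc i)) \<cdot> df X i = df Z i \<cdot> (g i \<cdot> f i)" .
qed (use chain_mapD[OF f] chain_mapD[OF g] in auto)

lemma chain_map_diff:
  assumes f: "chain_map K n X Y f" and g: "chain_map K n X Y g" and [simp]: "cx X" "cx Y"
  shows "chain_map K n X Y (\<lambda>i. f i [+] [-] g i)"
  by (rule chain_mapI) (use chain_mapD[OF f] chain_mapD[OF g] in auto)

section \<open>Elementwise form of n-kernel and n-cokernel sequences\<close>

text \<open>In a complex the image lies in the kernel anyway, so exactness is just a lifting
  property. Degrees are shifted from \<open>{1..n}\<close> to \<open>i<n\<close> to avoid
  predecessors.\<close>

lemma n_kernel_seq_iff:
  "n_kernel_seq K n X \<longleftrightarrow> cx X \<and>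
    (\<forall>W\<in>Ob K. \<forall>g\<in>Mor K W (ob X 0). df X 0 \<cdot> g = \<zero>\<^bsub>Hom K W (ob X 1)\<^esub> \<longrightarrow>
       g = \<zero>\<^bsub>Hom K W (ob X 0)\<^esub>) \<and>
    (\<forall>i<n. \<forall>W\<in>Ob K. \<forall>g\<in>Mor K W (ob X (Suc i)).
       df X (Suc i) \<cdot> g = \<zero>\<^bsub>Hom K W (ob X (Suc (Suc i)))\<^esub> \<longrightarrow>
       (\<exists>g'\<in>Mor K W (ob X i). df X i \<cdot> g' = g))" (is "_ \<longleftrightarrow> cx X \<and> ?M \<and> ?E")
proof (cases "cx X")
  case True
  have "a_kernel (Hom K W (ob X 0)) (Hom K W (ob X 1)) (\<lambda>g. df X 0 \<cdot> g) = {\<zero>\<^bsub>Hom K W (ob X 0)\<^esub>}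
      \<longleftrightarrow> (\<forall>g\<in>Mor K W (ob X 0). df X 0 \<cdot> g = \<zero>\<^bsub>Hom K W (ob X 1)\<^esub> \<longrightarrow> g = \<zero>\<^bsub>Hom K W (ob X 0)\<^esub>)"
    if W: "W \<in> Ob K" for W
    using True W by (fastforce simp: a_kernel_def' hom_iff)
  moreover have "exact_cov K W X (Suc i) \<longleftrightarrow> (\<forall>g\<in>Mor K W (ob X (Suc i)).
       df X (Suc i) \<cdot> g = \<zero>\<^bsub>Hom K W (ob X (Suc (Suc i)))\<^esub> \<longrightarrow>
       (\<exists>g'\<in>Mor K W (ob X i). df X i \<cdot> g' = g))" if W: "W \<in> Ob K" "i < n" for W i
  proof -
    have "(\<lambda>g. df X i \<cdot> g) ` Mor K W (ob X i) \<subseteq>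
      a_kernel (Hom K W (ob X (Suc i))) (Hom K W (ob X (Suc (Suc i)))) (\<lambda>g. df X (Suc i) \<cdot> g)"
      using True W by (auto simp: a_kernel_def' hom_iff)
    then show ?thesis
      unfolding exact_cov_def set_eq_subset by (simp add: a_kernel_def' subset_iff image_iff) metis
  qed
  ultimately show ?thesis
    using True unfolding n_kernel_seq_def by (auto simp: Suc_le_eq Ball_def gr0_conv_Suc)
qed (simp add: n_kernel_seq_def)

lemma n_cokernel_seq_iff:
  "n_cokernel_seq K n X \<longleftrightarrow> cx X \<and>
    (\<forall>W\<in>Ob K. \<forall>g\<in>Mor K (ob X (Suc n)) W. g \<cdot> df X n = \<zero>\<^bsub>Hom K (ob X n) W\<^esub> \<longrightarrow>
       g = \<zero>\<^bsub>Hom K (ob X (Suc n)) W\<^esub>) \<and>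
    (\<forall>i<n. \<forall>W\<in>Ob K. \<forall>g\<in>Mor K (ob X (Suc i)) W.
       g \<cdot> df X i = \<zero>\<^bsub>Hom K (ob X i) W\<^esub> \<longrightarrow>
       (\<exists>g'\<in>Mor K (ob X (Suc (Suc i))) W. g' \<cdot> df X (Suc i) = g))"
proof (cases "cx X")
  case True
  have "a_kernel (Hom K (ob X (Suc n)) W) (Hom K (ob X n) W) (\<lambda>g. g \<cdot> df X n) =
        {\<zero>\<^bsub>Hom K (ob X (Suc n)) W\<^esub>} \<longleftrightarrow> (\<forall>g\<in>Mor K (ob X (Suc n)) W.
        g \<cdot> df X n = \<zero>\<^bsub>Hom K (ob X n) W\<^esub> \<longrightarrow> g = \<zero>\<^bsub>Hom K (ob X (Suc n)) W\<^esub>)"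
    if W: "W \<in> Ob K" for W
    using True W by (fastforce simp: a_kernel_def' hom_iff)
  moreover have "exact_contra K W X (Suc i) \<longleftrightarrow> (\<forall>g\<in>Mor K (ob X (Suc i)) W.
       g \<cdot> df X i = \<zero>\<^bsub>Hom K (ob X i) W\<^esub> \<longrightarrow>
       (\<exists>g'\<in>Mor K (ob X (Suc (Suc i))) W. g' \<cdot> df X (Suc i) = g))" if W: "W \<in> Ob K" "i < n" for W i
  proof -
    have "(\<lambda>g. g \<cdot> df X (Suc i)) ` Mor K (ob X (Suc (Suc i))) W \<subseteq>
      a_kernel (Hom K (ob X (Suc i)) W) (Hom K (ob X i) W) (\<lambda>g. g \<cdot> df X i)"
      using True W by (auto simp: a_kernel_def' hom_iff)
    then show ?thesis
      unfolding exact_contra_def set_eq_subset by (simp add: a_kernel_def' subset_iff image_iff) metis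
  qed
  ultimately show ?thesis
    using True unfolding n_cokernel_seq_def by (auto simp: Suc_le_eq Ball_def gr0_conv_Suc)
qed (simp add: n_cokernel_seq_def)

lemma n_cokernelE:
  assumes "n_cokernel_seq K n X" "i < n" "arr g" "dm g = ob X (Suc i)"
    "g \<cdot> df X i = \<zero>\<^bsub>Hom K (ob X i) (cd g)\<^esub>"
  obtains g' where "arr g'" "dm g' = ob X (Suc (Suc i))" "cd g' = cd g" "g' \<cdot> df X (Suc i) = g"
proof -
  have X: "cx X" using assms by (simp add: n_cokernel_seq_iff)
  then have "g \<in> Mor K (ob X (Suc i)) (cd g)" using assms by (simp add: hom_iff)
  then obtain g' where "g' \<in> Mor K (ob X (Suc (Suc i))) (cd g)" "g' \<cdot> df X (Suc i) = g"
    using assms unfolding n_cokernel_seq_iff by (meson cd_ob)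
  then show ?thesis using that X assms by (auto simp: hom_iff)
qed

lemma n_cokernel_epi:
  assumes "n_cokernel_seq K n X" "arr g" "arr h" "dm g = ob X (Suc n)" "dm h = ob X (Suc n)"
    "g \<cdot> df X n = h \<cdot> df X n"
  shows "g = h"
proof -
  have [simp]: "cx X" using assms by (simp add: n_cokernel_seq_iff)
  \<comment> \<open>The common codomain is forced by the equality of the two composites, since a
    morphism determines its codomain.\<close>
  have c: "cd h = cd g"
    using assms by (metis cd_cmp cd_df arr_df \<open>cx X\<close> order_refl)
  have "(g [+] [-] h) \<cdot> df X n = \<zero>\<^bsub>Hom K (ob X n) (cd g)\<^esub>"
    using assms c by simp
  moreover have "g [+] [-] h \<in> Mor K (ob X (Suc n)) (cd g)"
    using assms c by (simp add: hom_iff)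
  ultimately have "g [+] [-] h = \<zero>\<^bsub>Hom K (ob X (Suc n)) (cd g)\<^esub>"
    using assms unfolding n_cokernel_seq_iff by (meson cd_ob)
  then show ?thesis using assms c by (simp add: padd_eq_zero_iff)
qed

section \<open>Extending squares and homotopies upwards in degree\<close>

text \<open>Since d_Y f^(m+1) d_X = d_Y d_Y f^m = 0, the morphism d_Y f^(m+1) factors through the
  next differential of X, and the factor is f^(m+2). Exactness is used in the source; the target may
  be any complex.\<close>

lemma extend_right:
  assumes X: "n_cokernel_seq K n X" and Y: "cx Y" and k: "k \<le> n"
    and a: "a \<in> Mor K (ob X k) (ob Y k)" and b: "b \<in> Mor K (ob X (Suc k)) (ob Y (Suc k))"
    and ab: "b \<cdot> df X k = df Y k \<cdot> a"
  shows "\<exists>f. f k = a \<and> f (Suc k) = b \<and> (\<forall>i. k \<le> i \<longrightarrow> i \<le> Suc n \<longrightarrow> f i \<in> Mor K (ob X i) (ob Y i)) \<and>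
    (\<forall>i. k \<le> i \<longrightarrow> i \<le> n \<longrightarrow> f (Suc i) \<cdot> df X i = df Y i \<cdot> f i)"
proof -
  have [simp]: "cx X" "cx Y" using X Y by (simp_all add: n_cokernel_seq_iff)
  have "\<exists>f. f k = a \<and> f (Suc k) = b \<and> (\<forall>i. k \<le> i \<longrightarrow> i \<le> Suc m \<longrightarrow> f i \<in> Mor K (ob X i) (ob Y i)) \<and>
    (\<forall>i. k \<le> i \<longrightarrow> i \<le> m \<longrightarrow> f (Suc i) \<cdot> df X i = df Y i \<cdot> f i)" if "k \<le> m" "m \<le> n" for m
    using that
  proof (induction m rule: dec_induct)
    case base
    show ?case
      by (rule exI[of _ "\<lambda>i. if i = k then a else b"]) (use a b ab in \<open>auto simp: le_Suc_eq\<close>)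
  next
    case (step m)
    then obtain f where f: "f k = a" "f (Suc k) = b"
        "\<And>i. k \<le> i \<Longrightarrow> i \<le> Suc m \<Longrightarrow> f i \<in> Mor K (ob X i) (ob Y i)"
        "\<And>i. k \<le> i \<Longrightarrow> i \<le> m \<Longrightarrow> f (Suc i) \<cdot> df X i = df Y i \<cdot> f i" by auto
    have fm: "arr (f i) \<and> dm (f i) = ob X i \<and> cd (f i) = ob Y i" if "k \<le> i" "i \<le> Suc m" for i
      using f(3)[OF that] that step.prems by (auto simp: hom_iff)
    have "(df Y (Suc m) \<cdot> f (Suc m)) \<cdot> df X m = df Y (Suc m) \<cdot> (df Y m \<cdot> f m)"
      using step fm[of m] fm[of "Suc m"] f(4)[of m] by simp
    then obtain g where g: "arr g" "dm g = ob X (Suc (Suc m))" "cd g = ob Y (Suc (Suc m))"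
        "g \<cdot> df X (Suc m) = df Y (Suc m) \<cdot> f (Suc m)"
      using n_cokernelE[OF X, of m "df Y (Suc m) \<cdot> f (Suc m)"] step fm[of m] fm[of "Suc m"] by auto
    then have "g \<in> Mor K (ob X (Suc (Suc m))) (ob Y (Suc (Suc m)))"
      using step.prems by (simp add: hom_iff)
    then show ?case
      using f g step.hyps by (intro exI[of _ "f(Suc (Suc m) := g)"]) (auto simp: le_Suc_eq)
  qed
  from this[OF k order_refl] show ?thesis .
qed

text \<open>The recursion carries the invariant that \<open>f (Suc m)\<close> and
  \<open>df Y m \<cdot> h m\<close> agree after composition with \<open>df X m\<close>. Their
  difference then factors through \<open>df X (Suc m)\<close>, and the factor is the next component
  of \<open>h\<close>. In top degree no differential is left, and epicity of \<open>df X n\<close>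
  turns the invariant into an equation.\<close>

lemma homotopy_right:
  assumes X: "n_cokernel_seq K n X" and Y: "cx Y" and k: "k \<le> n"
    and f: "chain_map K n X Y f" and fk: "f k = \<zero>\<^bsub>Hom K (ob X k) (ob Y k)\<^esub>"
  shows "\<exists>h. (\<forall>i. k \<le> i \<longrightarrow> i \<le> n \<longrightarrow> h i \<in> Mor K (ob X (Suc i)) (ob Y i)) \<and>
    h k = \<zero>\<^bsub>Hom K (ob X (Suc k)) (ob Y k)\<^esub> \<and>
    (\<forall>i. k \<le> i \<longrightarrow> i < n \<longrightarrow> f (Suc i) = df Y i \<cdot> h i [+] h (Suc i) \<cdot> df X (Suc i)) \<and>
    f (Suc n) = df Y n \<cdot> h n"
proof -
  have [simp]: "cx X" "cx Y" using X Y by (simp_all add: n_cokernel_seq_iff)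
  note [simp] = chain_mapD[OF f \<open>cx X\<close> \<open>cx Y\<close>]
  have "\<exists>h. (\<forall>i. k \<le> i \<longrightarrow> i \<le> m \<longrightarrow> h i \<in> Mor K (ob X (Suc i)) (ob Y i)) \<and>
    h k = \<zero>\<^bsub>Hom K (ob X (Suc k)) (ob Y k)\<^esub> \<and>
    (\<forall>i. k \<le> i \<longrightarrow> i < m \<longrightarrow> f (Suc i) = df Y i \<cdot> h i [+] h (Suc i) \<cdot> df X (Suc i)) \<and>
    f (Suc m) \<cdot> df X m = (df Y m \<cdot> h m) \<cdot> df X m" if "k \<le> m" "m \<le> n" for m
    using that
  proof (induction m rule: dec_induct)
    case base
    then show ?case
      by (intro exI[of _ "\<lambda>i. \<zero>\<^bsub>Hom K (ob X (Suc i)) (ob Y i)\<^esub>"]) (auto simp: fk hom_iff)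
  next
    case (step m)
    then obtain h where h: "\<And>i. k \<le> i \<Longrightarrow> i \<le> m \<Longrightarrow> h i \<in> Mor K (ob X (Suc i)) (ob Y i)"
        "h k = \<zero>\<^bsub>Hom K (ob X (Suc k)) (ob Y k)\<^esub>"
        "\<And>i. k \<le> i \<Longrightarrow> i < m \<Longrightarrow> f (Suc i) = df Y i \<cdot> h i [+] h (Suc i) \<cdot> df X (Suc i)"
        "f (Suc m) \<cdot> df X m = (df Y m \<cdot> h m) \<cdot> df X m" by auto
    have hm [simp]: "arr (h m)" "dm (h m) = ob X (Suc m)" "cd (h m) = ob Y m"
      using h(1)[of m] step by (auto simp: hom_iff)
    have "(f (Suc m) [+] [-] (df Y m \<cdot> h m)) \<cdot> df X m = \<zero>\<^bsub>Hom K (ob X m) (ob Y (Suc m))\<^esub>"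
      using step h(4) by simp
    then obtain g where g: "arr g" "dm g = ob X (Suc (Suc m))" "cd g = ob Y (Suc m)"
        "g \<cdot> df X (Suc m) = f (Suc m) [+] [-] (df Y m \<cdot> h m)"
      using n_cokernelE[OF X, of m "f (Suc m) [+] [-] (df Y m \<cdot> h m)"] step by auto
    have fm: "f (Suc m) = df Y m \<cdot> h m [+] g \<cdot> df X (Suc m)"
      using step g by (simp add: padd_left_comm padd_assoc padd_comm)
    have "f (Suc (Suc m)) \<cdot> df X (Suc m) = df Y (Suc m) \<cdot> f (Suc m)"
      using step by simp
    also have "\<dots> = (df Y (Suc m) \<cdot> g) \<cdot> df X (Suc m)"
      using step g(1-3) by (subst fm) simp
    finally have "f (Suc (Suc m)) \<cdot> df X (Suc m) = (df Y (Suc m) \<cdot> g) \<cdot> df X (Suc m)" .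
    moreover have "g \<in> Mor K (ob X (Suc (Suc m))) (ob Y (Suc m))"
      using g step.prems by (simp add: hom_iff)
    ultimately show ?case
      using h step.hyps fm by (intro exI[of _ "h(Suc m := g)"]) (auto simp: less_Suc_eq le_Suc_eq)
  qed
  from this[OF k order_refl] obtain h where h: "(\<forall>i. k \<le> i \<longrightarrow> i \<le> n \<longrightarrow> h i \<in> Mor K (ob X (Suc i)) (ob Y i))"
    "h k = \<zero>\<^bsub>Hom K (ob X (Suc k)) (ob Y k)\<^esub>"
    "(\<forall>i. k \<le> i \<longrightarrow> i < n \<longrightarrow> f (Suc i) = df Y i \<cdot> h i [+] h (Suc i) \<cdot> df X (Suc i))"
    "f (Suc n) \<cdot> df X n = (df Y n \<cdot> h n) \<cdot> df X n" by blast
  have "arr (h n)" "dm (h n) = ob X (Suc n)" "cd (h n) = ob Y n"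
    using h(1) k by (auto simp: hom_iff)
  then have "f (Suc n) = df Y n \<cdot> h n"
    using n_cokernel_epi[OF X _ _ _ _ h(4)] by auto
  then show ?thesis using h by blast
qed

section \<open>Dual statements by reversal of degrees\<close>

lemma complex_category_opc: "complex_category (opc K)"
  by (simp add: complex_category_def additive_category_opc)

lemma revc_complex: "cx X \<Longrightarrow> revc n X \<in> complexes (opc K) n"
proof -
  assume X [simp]: "cx X"
  have "df X (n - i) \<in> Mor K (ob X (n - i)) (ob X (Suc n - i))" if "i \<le> n" for i
    using that cx_df_mor[OF X, of "n - i"] by (simp add: Suc_diff_le)
  moreover have "df X (n - i) \<cdot> df X (n - Suc i) = \<zero>\<^bsub>Hom K (ob X (n - Suc i)) (ob X (Suc n - i))\<^esub>"
    if "i < n" for i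
    using that df_df[OF X, of "n - Suc i"] by (simp add: Suc_diff_Suc Suc_diff_le)
  ultimately show ?thesis
    unfolding complexes_def by (auto simp: Suc_diff_le)
qed

text \<open>Lifting against differentials becomes factoring through them once arrows and degrees are
  reversed; the leftward statements below are obtained through this bridge.\<close>

lemma n_kernel_seq_opc:
  assumes X: "n_kernel_seq K n X"
  shows "n_cokernel_seq (opc K) n (revc n X)"
proof -
  interpret op: complex_category "opc K" n by (rule complex_category_opc)
  have [simp]: "cx X" using X by (simp add: n_kernel_seq_iff)
  show ?thesis
    unfolding op.n_cokernel_seq_iff
  proof (intro conjI ballI allI impI)
    fix i W g
    assume i: "i < n" and W: "W \<in> Ob (opc K)"
      and "g \<in> Mor (opc K) (ob (revc n X) (Suc i)) W"
      and "cmp (opc K) g (df (revc n X) i) = \<zero>\<^bsub>Hom (opc K) (ob (revc n X) i) W\<^esub>"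
    \<comment> \<open>As \<open>i < n\<close>, the reversed differential \<open>n - i\<close> can be
      written \<open>Suc (n - Suc i)\<close>, the form in which the kernel condition of
      \<open>X\<close> applies.\<close>
    then have g: "g \<in> Mor K W (ob X (Suc (n - Suc i)))"
        "df X (Suc (n - Suc i)) \<cdot> g = \<zero>\<^bsub>Hom K W (ob X (Suc (Suc (n - Suc i))))\<^esub>"
      by (simp_all add: Suc_diff_Suc Suc_diff_le)
    then obtain g' where "g' \<in> Mor K W (ob X (n - Suc i))" "df X (n - Suc i) \<cdot> g' = g"
      using X i W unfolding n_kernel_seq_iff by (metis diff_Suc_less gr_implies_not0 not_gr_zero opc_simps(1))
    then show "\<exists>g'\<in>Mor (opc K) (ob (revc n X) (Suc (Suc i))) W. cmp (opc K) g' (df (revc n X) (Suc i)) = g"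
      using i by auto
  qed (use X in \<open>auto simp: n_kernel_seq_iff revc_complex\<close>)
qed

lemma chain_map_opc:
  assumes f: "chain_map K n X Y f" and [simp]: "cx X" "cx Y"
  shows "chain_map (opc K) n (revc n Y) (revc n X) (\<lambda>i. f (Suc n - i))"
proof -
  interpret op: complex_category "opc K" n by (rule complex_category_opc)
  show ?thesis
    by (rule op.chain_mapI) (use chain_mapD[OF f] in \<open>auto simp: revc_complex Suc_diff_le\<close>)
qed

text \<open>This is \<open>extend_right\<close> for the reversed complexes, with source and target
  exchanged: the square in degrees \<open>k\<close> and \<open>Suc k\<close> becomes one in degree
  \<open>n - k\<close> whose sides are \<open>b\<close> and then \<open>a\<close>.\<close>

lemma extend_left:
  assumes Y: "n_kernel_seq K n Y" and X: "cx X" and k: "k \<le> n"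
    and a: "a \<in> Mor K (ob X k) (ob Y k)" and b: "b \<in> Mor K (ob X (Suc k)) (ob Y (Suc k))"
    and ab: "b \<cdot> df X k = df Y k \<cdot> a"
  shows "\<exists>f. f k = a \<and> f (Suc k) = b \<and> (\<forall>i\<le>Suc k. f i \<in> Mor K (ob X i) (ob Y i)) \<and>
    (\<forall>i\<le>k. f (Suc i) \<cdot> df X i = df Y i \<cdot> f i)"
proof -
  interpret op: complex_category "opc K" n by (rule complex_category_opc)
  obtain f where f: "f (n - k) = b" "f (Suc (n - k)) = a"
    "\<And>i. n - k \<le> i \<Longrightarrow> i \<le> Suc n \<Longrightarrow> f i \<in> Mor K (ob X (Suc n - i)) (ob Y (Suc n - i))"
    "\<And>i. n - k \<le> i \<Longrightarrow> i \<le> n \<Longrightarrow> df Y (n - i) \<cdot> f (Suc i) = f i \<cdot> df X (n - i)"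
    using op.extend_right[OF n_kernel_seq_opc[OF Y] revc_complex[OF X], of "n - k" b a] k a b ab
    by (auto simp: Suc_diff_le)
  show ?thesis
  proof (intro exI[of _ "\<lambda>i. f (Suc n - i)"] conjI allI impI)
    show "f (Suc n - i) \<in> Mor K (ob X i) (ob Y i)" if "i \<le> Suc k" for i
      using f(3)[of "Suc n - i"] that k by auto
    show "f (Suc n - Suc i) \<cdot> df X i = df Y i \<cdot> f (Suc n - i)" if "i \<le> k" for i
      using f(4)[of "n - i"] that k by (auto simp: Suc_diff_le)
  qed (use f k in \<open>auto simp: Suc_diff_le\<close>)
qed

text \<open>A homotopy component spans two consecutive degrees, so reversal sends its index
  \<open>i\<close> to \<open>n - i\<close>, whereas the index of a chain map goes to
  \<open>Suc n - i\<close>.\<close>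

lemma homotopy_left:
  assumes Y: "n_kernel_seq K n Y" and X: "cx X" and k: "k \<le> n"
    and f: "chain_map K n X Y f" and fk: "f (Suc k) = \<zero>\<^bsub>Hom K (ob X (Suc k)) (ob Y (Suc k))\<^esub>"
  shows "\<exists>h. (\<forall>i\<le>k. h i \<in> Mor K (ob X (Suc i)) (ob Y i)) \<and>
    h k = \<zero>\<^bsub>Hom K (ob X (Suc k)) (ob Y k)\<^esub> \<and>
    (\<forall>i<k. f (Suc i) = df Y i \<cdot> h i [+] h (Suc i) \<cdot> df X (Suc i)) \<and>
    f 0 = h 0 \<cdot> df X 0"
proof -
  interpret op: complex_category "opc K" n by (rule complex_category_opc)
  have [simp]: "cx X" "cx Y" using X Y by (simp_all add: n_kernel_seq_iff)
  obtain h where h: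
    "\<And>i. n - k \<le> i \<Longrightarrow> i \<le> n \<Longrightarrow> h i \<in> Mor K (ob X (Suc n - i)) (ob Y (n - i))"
    "h (n - k) = \<zero>\<^bsub>Hom K (ob X (Suc k)) (ob Y k)\<^esub>"
    "\<And>i. n - k \<le> i \<Longrightarrow> i < n \<Longrightarrow>
      f (n - i) = h i \<cdot> df X (n - i) [+] df Y (n - Suc i) \<cdot> h (Suc i)"
    "f 0 = h n \<cdot> df X 0"
    using op.homotopy_right[OF n_kernel_seq_opc[OF Y] revc_complex[OF X] _ chain_map_opc[OF f], of "n - k"] fk k
    by (auto simp: Suc_diff_le)
  show ?thesis
  proof (intro exI[of _ "\<lambda>i. h (n - i)"] conjI allI impI)
    show m: "h (n - i) \<in> Mor K (ob X (Suc i)) (ob Y i)" if "i \<le> k" for i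
      using h(1)[of "n - i"] that k by (auto simp: Suc_diff_le)
    show "f (Suc i) = df Y i \<cdot> h (n - i) [+] h (n - Suc i) \<cdot> df X (Suc i)" if "i < k" for i
      using h(3)[of "n - Suc i"] that k m[of i] m[of "Suc i"]
      by (simp add: Suc_diff_Suc hom_iff padd_comm)
  qed (use h k in auto)
qed

text \<open>The component \<open>h i\<close> maps \<open>X\<^sup>i\<^sup>+\<^sup>1\<close> to \<open>Y\<^sup>i\<close>: the index is one lower than in the definition of
  homotopy.\<close>

definition nullhtpy :: "('o, 'm) cpx \<Rightarrow> ('o, 'm) cpx \<Rightarrow> (nat \<Rightarrow> 'm) \<Rightarrow> (nat \<Rightarrow> 'm) \<Rightarrow> bool" where
  "nullhtpy X Y f h \<longleftrightarrow>
    (\<forall>i\<le>n. h i \<in> Mor K (ob X (Suc i)) (ob Y i)) \<and> f 0 = h 0 \<cdot> df X 0 \<and>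
    (\<forall>i<n. f (Suc i) = df Y i \<cdot> h i [+] h (Suc i) \<cdot> df X (Suc i)) \<and> f (Suc n) = df Y n \<cdot> h n"

lemma nullhtpyD:
  assumes "nullhtpy X Y f h" "cx X" "cx Y"
  shows "i \<le> n \<Longrightarrow> arr (h i)" "i \<le> n \<Longrightarrow> dm (h i) = ob X (Suc i)" "i \<le> n \<Longrightarrow> cd (h i) = ob Y i"
    "f 0 = h 0 \<cdot> df X 0"
    "i < n \<Longrightarrow> f (Suc i) = df Y i \<cdot> h i [+] h (Suc i) \<cdot> df X (Suc i)"
    "f (Suc n) = df Y n \<cdot> h n"
  using assms by (auto simp: nullhtpy_def hom_iff)

section \<open>The homotopy relation\<close>

lemma homotopic_iff:
  assumes [simp]: "cx X" "cx Y" and "fam X Y f" "fam X Y g"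
  shows "homotopic K n X Y f g \<longleftrightarrow> (\<exists>h. nullhtpy X Y (\<lambda>i. f i [+] [-] g i) h)"
proof
  note [simp] = famD[OF \<open>fam X Y f\<close> \<open>cx X\<close> \<open>cx Y\<close>] famD[OF \<open>fam X Y g\<close> \<open>cx X\<close> \<open>cx Y\<close>]
  assume "homotopic K n X Y f g"
  then obtain h where h: "\<And>i. i \<in> {1..n+1} \<Longrightarrow> h i \<in> Mor K (ob X i) (ob Y (i - 1))"
     "f 0 \<ominus>\<^bsub>Hom K (ob X 0) (ob Y 0)\<^esub> g 0 = h 1 \<cdot> df X 0"
     "\<And>i. i \<in> {1..n} \<Longrightarrow> f i \<ominus>\<^bsub>Hom K (ob X i) (ob Y i)\<^esub> g i =
        (df Y (i-1) \<cdot> h i) \<oplus>\<^bsub>Hom K (ob X i) (ob Y i)\<^esub> (h (i+1) \<cdot> df X i)"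
     "f (n+1) \<ominus>\<^bsub>Hom K (ob X (n+1)) (ob Y (n+1))\<^esub> g (n+1) = df Y n \<cdot> h (n+1)"
    unfolding homotopic_def by blast
  have hm: "h (Suc i) \<in> Mor K (ob X (Suc i)) (ob Y i)" if "i \<le> n" for i
    using h(1)[of "Suc i"] that by simp
  have "nullhtpy X Y (\<lambda>i. f i [+] [-] g i) (\<lambda>i. h (Suc i))"
    using h(2) h(3)[of "Suc i" for i] h(4) hm by (auto simp: nullhtpy_def hom_iff)
  then show "\<exists>h. nullhtpy X Y (\<lambda>i. f i [+] [-] g i) h" by blast
next
  note [simp] = famD[OF \<open>fam X Y f\<close> \<open>cx X\<close> \<open>cx Y\<close>] famD[OF \<open>fam X Y g\<close> \<open>cx X\<close> \<open>cx Y\<close>]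
  assume "\<exists>h. nullhtpy X Y (\<lambda>i. f i [+] [-] g i) h"
  then obtain h where h: "nullhtpy X Y (\<lambda>i. f i [+] [-] g i) h" ..
  note [simp] = nullhtpyD(1-3)[OF h \<open>cx X\<close> \<open>cx Y\<close>]
  show "homotopic K n X Y f g"
    unfolding homotopic_def
    by (intro exI[of _ "\<lambda>i. h (i - 1)"])
      (use nullhtpyD(4-6)[OF h \<open>cx X\<close> \<open>cx Y\<close>] in \<open>auto simp: hom_iff gr0_conv_Suc Suc_le_eq\<close>)
qed

text \<open>Families are functions on all natural numbers, but only their values up to degree n+1
  are meaningful; hence agreement there must suffice.\<close>

lemma homotopic_refl:
  assumes [simp]: "cx X" "cx Y" and f: "fam X Y f" and "\<And>i. i \<le> Suc n \<Longrightarrow> g i = f i"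
  shows "homotopic K n X Y f g"
proof -
  have g: "fam X Y g" using f assms(4) by (simp add: fam_def)
  have "nullhtpy X Y (\<lambda>i. f i [+] [-] g i) (\<lambda>i. \<zero>\<^bsub>Hom K (ob X (Suc i)) (ob Y i)\<^esub>)"
    using assms(4) famD[OF f] by (simp add: nullhtpy_def hom_iff)
  then show ?thesis using homotopic_iff f g by auto
qed

lemma homotopic_trans:
  assumes [simp]: "cx X" "cx Y" and f: "fam X Y f" and g: "fam X Y g" and l: "fam X Y l"
    and "homotopic K n X Y f g" "homotopic K n X Y g l"
  shows "homotopic K n X Y f l"
proof -
  note [simp] = famD[OF f \<open>cx X\<close> \<open>cx Y\<close>] famD[OF g \<open>cx X\<close> \<open>cx Y\<close>] famD[OF l \<open>cx X\<close> \<open>cx Y\<close>]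
  obtain h k where h: "nullhtpy X Y (\<lambda>i. f i [+] [-] g i) h" and k: "nullhtpy X Y (\<lambda>i. g i [+] [-] l i) k"
    using assms homotopic_iff by blast
  note H = nullhtpyD[OF h \<open>cx X\<close> \<open>cx Y\<close>] and N = nullhtpyD[OF k \<open>cx X\<close> \<open>cx Y\<close>]
  have *: "f i [+] [-] l i = (f i [+] [-] g i) [+] (g i [+] [-] l i)" if "i \<le> Suc n" for i
    using that by (simp add: padd_assoc)
  have "nullhtpy X Y (\<lambda>i. f i [+] [-] l i) (\<lambda>i. h i [+] k i)"
    unfolding nullhtpy_def
  proof (intro conjI allI impI)
    show "f (Suc i) [+] [-] l (Suc i) = df Y i \<cdot> (h i [+] k i) [+] (h (Suc i) [+] k (Suc i)) \<cdot> df X (Suc i)"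
      if i: "i < n" for i
    proof -
      have "f (Suc i) [+] [-] l (Suc i) = (df Y i \<cdot> h i [+] h (Suc i) \<cdot> df X (Suc i)) [+]
          (df Y i \<cdot> k i [+] k (Suc i) \<cdot> df X (Suc i))"
        using *[of "Suc i"] H(5)[OF i] N(5)[OF i] i by simp
      also have "\<dots> = (df Y i \<cdot> h i [+] df Y i \<cdot> k i) [+]
          (h (Suc i) \<cdot> df X (Suc i) [+] k (Suc i) \<cdot> df X (Suc i))"
        using i by (intro padd_swap) (simp_all add: H(1-3) N(1-3))
      finally show ?thesis using i by (simp add: H(1-3) N(1-3))
    qed
    show "f 0 [+] [-] l 0 = (h 0 [+] k 0) \<cdot> df X 0"
      using *[of 0] H(4) N(4) by (simp add: H(1-3) N(1-3))
    show "f (Suc n) [+] [-] l (Suc n) = df Y n \<cdot> (h n [+] k n)"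
      using *[of "Suc n"] H(6) N(6) by (simp add: H(1-3) N(1-3))
  qed (simp_all add: H(1-3) N(1-3) hom_iff)
  then show ?thesis using homotopic_iff f l by auto
qed

lemma chain_map_nat:
  assumes "chain_map K n X Y f" "cx X" "cx Y" "i \<le> n" "arr g" "cd g = ob X i"
  shows "f (Suc i) \<cdot> (df X i \<cdot> g) = df Y i \<cdot> (f i \<cdot> g)"
proof -
  note [simp] = chain_mapD(1-3)[OF assms(1-3)] assms(2-)
  have "(f (Suc i) \<cdot> df X i) \<cdot> g = (df Y i \<cdot> f i) \<cdot> g"
    using chain_mapD(4)[OF assms(1-4)] by (simp del: cmp_assoc)
  then show ?thesis using assms(4) by simp
qed

text \<open>Because \<open>u\<close> and \<open>v\<close> commute with the differentials, f - g = d
  h + h d gives v (f - g) u = d (v h u) + (v h u) d.\<close>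

lemma homotopic_comp:
  assumes [simp]: "cx X" "cx Y" "cx X'" "cx Y'" and f: "fam X Y f" and g: "fam X Y g"
    and fg: "homotopic K n X Y f g" and u: "chain_map K n X' X u" and v: "chain_map K n Y Y' v"
  shows "homotopic K n X' Y' (\<lambda>i. v i \<cdot> (f i \<cdot> u i)) (\<lambda>i. v i \<cdot> (g i \<cdot> u i))"
proof -
  note [simp] = famD[OF f \<open>cx X\<close> \<open>cx Y\<close>] famD[OF g \<open>cx X\<close> \<open>cx Y\<close>]
    chain_mapD[OF u \<open>cx X'\<close> \<open>cx X\<close>] chain_mapD[OF v \<open>cx Y\<close> \<open>cx Y'\<close>]
    chain_map_nat[OF u \<open>cx X'\<close> \<open>cx X\<close>] chain_map_nat[OF v \<open>cx Y\<close> \<open>cx Y'\<close>]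
  obtain h where h: "nullhtpy X Y (\<lambda>i. f i [+] [-] g i) h"
    using fg homotopic_iff[OF _ _ f g] by auto
  note H = nullhtpyD[OF h \<open>cx X\<close> \<open>cx Y\<close>]
  have *: "v i \<cdot> (f i \<cdot> u i) [+] [-] (v i \<cdot> (g i \<cdot> u i)) = v i \<cdot> ((f i [+] [-] g i) \<cdot> u i)"
    if "i \<le> Suc n" for i
    using that by simp
  have "nullhtpy X' Y' (\<lambda>i. v i \<cdot> (f i \<cdot> u i) [+] [-] (v i \<cdot> (g i \<cdot> u i))) (\<lambda>i. v i \<cdot> (h i \<cdot> u (Suc i)))"
    unfolding nullhtpy_def
  proof (intro conjI allI impI)
    show "v (Suc i) \<cdot> (f (Suc i) \<cdot> u (Suc i)) [+] [-] (v (Suc i) \<cdot> (g (Suc i) \<cdot> u (Suc i))) =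
        df Y' i \<cdot> (v i \<cdot> (h i \<cdot> u (Suc i))) [+] (v (Suc i) \<cdot> (h (Suc i) \<cdot> u (Suc (Suc i)))) \<cdot> df X' (Suc i)"
      if i: "i < n" for i
      unfolding *[OF Suc_leI[OF less_SucI[OF i]]] H(5)[OF i] using i by (simp add: H(1-3))
    show "v 0 \<cdot> (f 0 \<cdot> u 0) [+] [-] (v 0 \<cdot> (g 0 \<cdot> u 0)) = (v 0 \<cdot> (h 0 \<cdot> u (Suc 0))) \<cdot> df X' 0"
      unfolding *[OF le0] H(4) by (simp add: H(1-3))
    show "v (Suc n) \<cdot> (f (Suc n) \<cdot> u (Suc n)) [+] [-] (v (Suc n) \<cdot> (g (Suc n) \<cdot> u (Suc n))) =
        df Y' n \<cdot> (v n \<cdot> (h n \<cdot> u (Suc n)))"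
      unfolding *[OF order_refl] H(6) by (simp add: H(1-3))
  qed (simp_all add: H(1-3) hom_iff)
  moreover have "fam X' Y' (\<lambda>i. v i \<cdot> (f i \<cdot> u i))" "fam X' Y' (\<lambda>i. v i \<cdot> (g i \<cdot> u i))"
    by (rule famI; simp)+
  ultimately show ?thesis using homotopic_iff by auto
qed


lemma homotopic_cong:
  assumes "\<And>i. i \<le> Suc n \<Longrightarrow> f i = f' i" "\<And>i. i \<le> Suc n \<Longrightarrow> g i = g' i"
  shows "homotopic K n X Y f g \<longleftrightarrow> homotopic K n X Y f' g'"
  unfolding homotopic_def using assms by simp

lemma chain_map_fam: "chain_map K n X Y f \<Longrightarrow> fam X Y f"
  by (simp add: chain_map_iff)

text \<open>More than \<open>homotopic\<close>: the component from X^1 to Y^0 is zero. The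
  comparison of cones depends on this, since Y^0 does not occur in a cone.\<close>

lemma chain_map_htpy_right:
  assumes X: "n_cokernel_seq K n X" and Y: "cx Y" and f: "chain_map K n X Y f"
    and g: "chain_map K n X Y g" and "f 0 = g 0"
  shows "\<exists>h. nullhtpy X Y (\<lambda>i. f i [+] [-] g i) h \<and> h 0 = \<zero>\<^bsub>Hom K (ob X 1) (ob Y 0)\<^esub>"
proof -
  have [simp]: "cx X" using X by (simp add: n_cokernel_seq_iff)
  note [simp] = Y chain_mapD(1-3)[OF f _ Y] chain_mapD(1-3)[OF g _ Y]
  have 0: "f 0 [+] [-] g 0 = \<zero>\<^bsub>Hom K (ob X 0) (ob Y 0)\<^esub>"
    using assms(5) by simp
  obtain h where "\<forall>i. 0 \<le> i \<longrightarrow> i \<le> n \<longrightarrow> h i \<in> Mor K (ob X (Suc i)) (ob Y i)"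
    and h0: "h 0 = \<zero>\<^bsub>Hom K (ob X (Suc 0)) (ob Y 0)\<^esub>"
    and "\<forall>i. 0 \<le> i \<longrightarrow> i < n \<longrightarrow>
      f (Suc i) [+] [-] g (Suc i) = df Y i \<cdot> h i [+] h (Suc i) \<cdot> df X (Suc i)"
    and "f (Suc n) [+] [-] g (Suc n) = df Y n \<cdot> h n"
    using homotopy_right[OF X Y le0 chain_map_diff[OF f g \<open>cx X\<close> Y] 0]
    by (elim exE conjE, intro that)
  moreover have "f 0 [+] [-] g 0 = h 0 \<cdot> df X 0"
    unfolding 0 h0 by simp
  ultimately show ?thesis
    unfolding nullhtpy_def by (intro exI[of _ h]) simp
qed

lemma chain_map_htpy_left:
  assumes Y: "n_kernel_seq K n Y" and X: "cx X" and f: "chain_map K n X Y f"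
    and g: "chain_map K n X Y g" and "f (Suc n) = g (Suc n)"
  shows "\<exists>h. nullhtpy X Y (\<lambda>i. f i [+] [-] g i) h \<and> h n = \<zero>\<^bsub>Hom K (ob X (Suc n)) (ob Y n)\<^esub>"
proof -
  have [simp]: "cx Y" using Y by (simp add: n_kernel_seq_iff)
  note [simp] = X chain_mapD(1-3)[OF f X] chain_mapD(1-3)[OF g X]
  have 0: "f (Suc n) [+] [-] g (Suc n) = \<zero>\<^bsub>Hom K (ob X (Suc n)) (ob Y (Suc n))\<^esub>"
    using assms(5) by simp
  obtain h where "\<forall>i\<le>n. h i \<in> Mor K (ob X (Suc i)) (ob Y i)"
    and hn: "h n = \<zero>\<^bsub>Hom K (ob X (Suc n)) (ob Y n)\<^esub>"
    and "\<forall>i<n. f (Suc i) [+] [-] g (Suc i) = df Y i \<cdot> h i [+] h (Suc i) \<cdot> df X (Suc i)"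
    and "f 0 [+] [-] g 0 = h 0 \<cdot> df X 0"
    using homotopy_left[OF Y X order_refl chain_map_diff[OF f g X \<open>cx Y\<close>] 0]
    by (elim exE conjE, intro that)
  moreover have "f (Suc n) [+] [-] g (Suc n) = df Y n \<cdot> h n"
    unfolding 0 hn by simp
  ultimately show ?thesis
    unfolding nullhtpy_def by (intro exI[of _ h]) simp
qed

lemma homotopic_if_eq0:
  assumes X: "n_cokernel_seq K n X" and Y: "cx Y" and f: "chain_map K n X Y f"
    and g: "chain_map K n X Y g" and "f 0 = g 0"
  shows "homotopic K n X Y f g"
  using chain_map_htpy_right[OF assms] homotopic_iff[of X Y f g] f g X Y
  by (auto simp: chain_map_fam n_cokernel_seq_iff)

section \<open>Homotopy equivalences with fixed ends\<close>

lemma homotopy_equivI_iso: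
  assumes f: "chain_map_ends K n A C X Y f" and g: "chain_map_ends K n A C Y X g"
    and [simp]: "cx X" "cx Y"
    and gf: "\<And>i. i \<le> Suc n \<Longrightarrow> g i \<cdot> f i = Idt K (ob X i)"
    and fg: "\<And>i. i \<le> Suc n \<Longrightarrow> f i \<cdot> g i = Idt K (ob Y i)"
  shows "homotopy_equiv K n A C X Y"
proof -
  note [simp] = chain_mapD(1-3)[of X Y f] chain_mapD(1-3)[of Y X g]
  have "homotopic K n X X (\<lambda>i. g i \<cdot> f i) (\<lambda>i. Idt K (ob X i))"
    using gf by (intro homotopic_refl chain_map_fam[OF chain_map_comp[of X Y f X g]])
      (use f g in \<open>auto simp: chain_map_ends_def\<close>)
  moreover have "homotopic K n Y Y (\<lambda>i. f i \<cdot> g i) (\<lambda>i. Idt K (ob Y i))"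
    using fg by (intro homotopic_refl chain_map_fam[OF chain_map_comp[of Y X g Y f]])
      (use f g in \<open>auto simp: chain_map_ends_def\<close>)
  ultimately show ?thesis using f g unfolding homotopy_equiv_def by blast
qed

lemma chain_map_ends_id:
  "X \<in> complexes_ends K n A C \<Longrightarrow> chain_map_ends K n A C X X (\<lambda>i. Idt K (ob X i))"
  using chain_map_id by (simp add: complexes_ends_def chain_map_ends_def)

lemma homotopy_equiv_refl: "X \<in> complexes_ends K n A C \<Longrightarrow> homotopy_equiv K n A C X X"
  by (rule homotopy_equivI_iso[OF chain_map_ends_id chain_map_ends_id]) (auto simp: complexes_ends_def)

lemma homotopy_equiv_sym: "homotopy_equiv K n A C X Y \<Longrightarrow> homotopy_equiv K n A C Y X"
  unfolding homotopy_equiv_def by blast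

lemma chain_map_ends_comp:
  assumes "chain_map_ends K n A C X Y f" "chain_map_ends K n A C Y Z g" "cx X" "cx Y" "cx Z"
    and "A \<in> Ob K" "C \<in> Ob K"
  shows "chain_map_ends K n A C X Z (\<lambda>i. g i \<cdot> f i)"
  using assms chain_map_comp[of X Y f Z g] by (auto simp: chain_map_ends_def)

text \<open>Replace the inner round trip through \<open>Z\<close> by the identity of
  \<open>Y\<close>, conjugated by \<open>g\<close> and \<open>f\<close>, then contract the outer
  one.\<close>

lemma homotopic_comp_id:
  assumes f: "chain_map K n X Y f" and g: "chain_map K n Y X g" and f': "chain_map K n Y Z f'"
    and g': "chain_map K n Z Y g'" and [simp]: "cx X" "cx Y" "cx Z"
    and 1: "homotopic K n X X (\<lambda>i. g i \<cdot> f i) (\<lambda>i. Idt K (ob X i))"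
    and 2: "homotopic K n Y Y (\<lambda>i. g' i \<cdot> f' i) (\<lambda>i. Idt K (ob Y i))"
  shows "homotopic K n X X (\<lambda>i. (g i \<cdot> g' i) \<cdot> (f' i \<cdot> f i)) (\<lambda>i. Idt K (ob X i))"
proof -
  note [simp] = chain_mapD(1-3)[OF f] chain_mapD(1-3)[OF g] chain_mapD(1-3)[OF f'] chain_mapD(1-3)[OF g']
  have "homotopic K n X X (\<lambda>i. g i \<cdot> ((g' i \<cdot> f' i) \<cdot> f i)) (\<lambda>i. g i \<cdot> (Idt K (ob Y i) \<cdot> f i))"
    using homotopic_comp[OF _ _ _ _ _ _ 2 f g] chain_map_fam[OF chain_map_comp[OF f' g']]
      chain_map_fam[OF chain_map_id] by simp
  then have *: "homotopic K n X X (\<lambda>i. (g i \<cdot> g' i) \<cdot> (f' i \<cdot> f i)) (\<lambda>i. g i \<cdot> f i)"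
    by (rule homotopic_cong[THEN iffD1, rotated 2]) auto
  show ?thesis
    by (rule homotopic_trans[OF _ _ _ _ _ * 1]) (auto intro!: famI)
qed

lemma homotopy_equiv_trans:
  assumes XY: "homotopy_equiv K n A C X Y" and YZ: "homotopy_equiv K n A C Y Z"
    and [simp]: "cx X" "cx Y" "cx Z" "A \<in> Ob K" "C \<in> Ob K"
  shows "homotopy_equiv K n A C X Z"
proof -
  obtain f g where f: "chain_map_ends K n A C X Y f" and g: "chain_map_ends K n A C Y X g"
    and gf: "homotopic K n X X (\<lambda>i. g i \<cdot> f i) (\<lambda>i. Idt K (ob X i))"
    and fg: "homotopic K n Y Y (\<lambda>i. f i \<cdot> g i) (\<lambda>i. Idt K (ob Y i))"
    using XY unfolding homotopy_equiv_def by blast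
  obtain f' g' where f': "chain_map_ends K n A C Y Z f'" and g': "chain_map_ends K n A C Z Y g'"
    and gf': "homotopic K n Y Y (\<lambda>i. g' i \<cdot> f' i) (\<lambda>i. Idt K (ob Y i))"
    and fg': "homotopic K n Z Z (\<lambda>i. f' i \<cdot> g' i) (\<lambda>i. Idt K (ob Z i))"
    using YZ unfolding homotopy_equiv_def by blast
  have c: "chain_map K n X Y f" "chain_map K n Y X g" "chain_map K n Y Z f'" "chain_map K n Z Y g'"
    using f g f' g' by (simp_all add: chain_map_ends_def)
  have "homotopic K n X X (\<lambda>i. (g i \<cdot> g' i) \<cdot> (f' i \<cdot> f i)) (\<lambda>i. Idt K (ob X i))"
    by (rule homotopic_comp_id[OF c _ _ _ gf gf']) simp_all
  moreover have "homotopic K n Z Z (\<lambda>i. (f' i \<cdot> f i) \<cdot> (g i \<cdot> g' i)) (\<lambda>i. Idt K (ob Z i))"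
    by (rule homotopic_comp_id[OF c(4,3,2,1) _ _ _ fg' fg]) simp_all
  ultimately show ?thesis
    unfolding homotopy_equiv_def
    using chain_map_ends_comp[OF f f'] chain_map_ends_comp[OF g' g]
    by (intro exI[of _ "\<lambda>i. f' i \<cdot> f i"] exI[of _ "\<lambda>i. g i \<cdot> g' i"]) simp
qed

text \<open>Both round trips agree with the identity in degree 0, so \<open>homotopic_if_eq0\<close>
  provides the homotopies: morphisms in both directions are enough.\<close>

lemma homotopy_equiv_n_exact:
  assumes X: "n_cokernel_seq K n X" and Y: "n_cokernel_seq K n Y"
    and XA: "X \<in> complexes_ends K n A C" and YA: "Y \<in> complexes_ends K n A C"
    and f: "chain_map_ends K n A C X Y f" and g: "chain_map_ends K n A C Y X g"
  shows "homotopy_equiv K n A C X Y"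
proof -
  have [simp]: "cx X" "cx Y" "ob X 0 = A" "ob Y 0 = A" using XA YA by (simp_all add: complexes_ends_def)
  have [simp]: "A \<in> Ob K" using cx_ob[OF \<open>cx X\<close>, of 0] by simp
  have f': "chain_map K n X Y f" "f 0 = Idt K A" and g': "chain_map K n Y X g" "g 0 = Idt K A"
    using f g by (simp_all add: chain_map_ends_def)
  show ?thesis
    unfolding homotopy_equiv_def
    using homotopic_if_eq0[OF X _ chain_map_comp[OF f'(1) g'(1)] chain_map_id]
      homotopic_if_eq0[OF Y _ chain_map_comp[OF g'(1) f'(1)] chain_map_id] f g f'(2) g'(2)
    by (intro exI[of _ f] exI[of _ g]) simp
qed

lemma hclass_eq:
  assumes "X \<in> complexes_ends K n A C" "Y \<in> complexes_ends K n A C" "homotopy_equiv K n A C X Y"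
    and "A \<in> Ob K" "C \<in> Ob K"
  shows "hclass K n A C X = hclass K n A C Y"
  using assms homotopy_equiv_trans homotopy_equiv_sym
  unfolding hclass_def complexes_ends_def by blast


section \<open>Cones of homotopic chain maps\<close>

lemma col_simps [simp]:
  assumes "arr f" "arr g" "dm f = A" "dm g = A" "cd f = B" "cd g = C"
  shows "arr (col_mor K A B C f g)" "dm (col_mor K A B C f g) = A"
    "cd (col_mor K A B C f g) = Sum K B C"
    "Pr1 K B C \<cdot> col_mor K A B C f g = f" "Pr2 K B C \<cdot> col_mor K A B C f g = g"
  using assms cd_ob[of f] cd_ob[of g] dm_ob[of f] by (simp_all add: col_mor_def)

lemma row_simps [simp]:
  assumes "arr f" "arr g" "dm f = A" "dm g = B" "cd f = C" "cd g = C"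
  shows "arr (row_mor K A B C f g)" "dm (row_mor K A B C f g) = Sum K A B"
    "cd (row_mor K A B C f g) = C"
    "row_mor K A B C f g \<cdot> In1 K A B = f" "row_mor K A B C f g \<cdot> In2 K A B = g"
  using assms cd_ob[of f] dm_ob[of f] dm_ob[of g] by (simp_all add: row_mor_def)

lemma col_cmp:
  assumes "arr f" "arr g" "dm f = A" "dm g = A" "cd f = B" "cd g = C" "arr h" "cd h = A"
  shows "col_mor K A B C f g \<cdot> h = col_mor K (dm h) B C (f \<cdot> h) (g \<cdot> h)"
  using assms cd_ob[of f] cd_ob[of g] by (simp add: col_mor_def)

lemma cmp_row:
  assumes "arr f" "arr g" "dm f = A" "dm g = B" "cd f = C" "cd g = C" "arr h" "dm h = C"
  shows "h \<cdot> row_mor K A B C f g = row_mor K A B (cd h) (h \<cdot> f) (h \<cdot> g)"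
  using assms dm_ob[of f] dm_ob[of g] by (simp add: row_mor_def)

lemma row_col:
  assumes "arr p" "arr q" "dm p = B" "dm q = C" "cd p = D" "cd q = D"
    and "arr f" "arr g" "dm f = A" "dm g = A" "cd f = B" "cd g = C"
  shows "row_mor K B C D p q \<cdot> col_mor K A B C f g = p \<cdot> f [+] q \<cdot> g"
proof -
  have "row_mor K B C D p q \<cdot> col_mor K A B C f g =
      p \<cdot> (Pr1 K B C \<cdot> col_mor K A B C f g) [+] q \<cdot> (Pr2 K B C \<cdot> col_mor K A B C f g)"
    unfolding row_mor_def[of K B C D] using assms dm_ob[of p] dm_ob[of q] dm_ob[of f]
    by (simp del: col_simps(4,5))
  then show ?thesis using assms by simp
qed

lemma row_padd_row:
  assumes "arr f" "arr g" "dm f = A" "dm g = B" "cd f = C" "cd g = C"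
    and "arr f'" "arr g'" "dm f' = A" "dm g' = B" "cd f' = C" "cd g' = C"
  shows "row_mor K A B C f g [+] row_mor K A B C f' g' = row_mor K A B C (f [+] f') (g [+] g')"
  using assms dm_ob[of f] dm_ob[of g] cd_ob[of g]
  by (simp add: row_mor_def padd_swap)

lemma mat_simps [simp]:
  assumes "arr p" "arr q" "arr r" "arr t" "dm p = A" "dm r = A" "dm q = B" "dm t = B"
    "cd p = C" "cd q = C" "cd r = D" "cd t = D"
  shows "arr (mat_mor K A B C D p q r t)" "dm (mat_mor K A B C D p q r t) = Sum K A B"
    "cd (mat_mor K A B C D p q r t) = Sum K C D"
  using assms by (simp_all add: mat_mor_def)

lemma mat_col:
  assumes "arr p" "arr q" "arr r" "arr t" "dm p = A" "dm r = A" "dm q = B" "dm t = B"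
    "cd p = C" "cd q = C" "cd r = D" "cd t = D"
    and "arr f" "arr g" "dm f = W" "dm g = W" "cd f = A" "cd g = B"
  shows "mat_mor K A B C D p q r t \<cdot> col_mor K W A B f g =
    col_mor K W C D (p \<cdot> f [+] q \<cdot> g) (r \<cdot> f [+] t \<cdot> g)"
  using assms by (simp add: mat_mor_def col_cmp row_col)

lemma row_mat:
  assumes "arr p" "arr q" "arr r" "arr t" "dm p = A" "dm r = A" "dm q = B" "dm t = B"
    "cd p = C" "cd q = C" "cd r = D" "cd t = D"
    and "arr u" "arr v" "dm u = C" "dm v = D" "cd u = W" "cd v = W"
  shows "row_mor K C D W u v \<cdot> mat_mor K A B C D p q r t =
    row_mor K A B W (u \<cdot> p [+] v \<cdot> r) (u \<cdot> q [+] v \<cdot> t)"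
  using assms by (simp add: mat_mor_def row_col cmp_row row_padd_row)

lemma mat_mat:
  assumes "arr p" "arr q" "arr r" "arr t" "dm p = A" "dm r = A" "dm q = B" "dm t = B"
    "cd p = C" "cd q = C" "cd r = D" "cd t = D"
    and "arr p'" "arr q'" "arr r'" "arr t'" "dm p' = C" "dm r' = C" "dm q' = D" "dm t' = D"
    "cd p' = C'" "cd q' = C'" "cd r' = D'" "cd t' = D'"
  shows "mat_mor K C D C' D' p' q' r' t' \<cdot> mat_mor K A B C D p q r t =
    mat_mor K A B C' D' (p' \<cdot> p [+] q' \<cdot> r) (p' \<cdot> q [+] q' \<cdot> t) (r' \<cdot> p [+] t' \<cdot> r) (r' \<cdot> q [+] t' \<cdot> t)"
  using assms by (simp add: mat_mor_def[of K C D] col_cmp row_mat) (simp add: mat_mor_def)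

lemma
  assumes "A \<in> Ob K" "B \<in> Ob K" "C \<in> Ob K"
  shows col_zero [simp]: "col_mor K A B C \<zero>\<^bsub>Hom K A B\<^esub> \<zero>\<^bsub>Hom K A C\<^esub> = \<zero>\<^bsub>Hom K A (Sum K B C)\<^esub>"
    and row_zero [simp]: "row_mor K A B C \<zero>\<^bsub>Hom K A C\<^esub> \<zero>\<^bsub>Hom K B C\<^esub> = \<zero>\<^bsub>Hom K (Sum K A B) C\<^esub>"
  using assms by (simp_all add: col_mor_def row_mor_def)

lemma mat_zero [simp]:
  assumes "A \<in> Ob K" "B \<in> Ob K" "C \<in> Ob K" "D \<in> Ob K"
  shows "mat_mor K A B C D \<zero>\<^bsub>Hom K A C\<^esub> \<zero>\<^bsub>Hom K B C\<^esub> \<zero>\<^bsub>Hom K A D\<^esub> \<zero>\<^bsub>Hom K B D\<^esub> =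
    \<zero>\<^bsub>Hom K (Sum K A B) (Sum K C D)\<^esub>"
  using assms by (simp add: mat_mor_def)

lemma mat_idt [simp]:
  assumes "A \<in> Ob K" "B \<in> Ob K"
  shows "mat_mor K A B A B (Idt K A) \<zero>\<^bsub>Hom K B A\<^esub> \<zero>\<^bsub>Hom K A B\<^esub> (Idt K B) = Idt K (Sum K A B)"
  using assms sum_decomp[OF assms] by (simp add: mat_mor_def col_mor_def row_mor_def)


lemma cxI:
  assumes "\<And>i. i \<le> Suc n \<Longrightarrow> ob X i \<in> Ob K"
    and "\<And>i. i \<le> n \<Longrightarrow> arr (df X i) \<and> dm (df X i) = ob X i \<and> cd (df X i) = ob X (Suc i)"
    and "\<And>i. i < n \<Longrightarrow> df X (Suc i) \<cdot> df X i = \<zero>\<^bsub>Hom K (ob X i) (ob X (Suc (Suc i)))\<^esub>"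
  shows "cx X"
  unfolding complexes_def using assms by (simp add: hom_iff)

section \<open>Mapping cones\<close>

lemma cone_ob:
  "ob (cone K n X Y f) 0 = ob X 1"
  "\<lbrakk>0 < i; i \<le> n\<rbrakk> \<Longrightarrow> ob (cone K n X Y f) i = Sum K (ob X (Suc i)) (ob Y i)"
  "ob (cone K n X Y f) (Suc n) = ob Y (Suc n)"
  by (simp_all add: cone_def)

lemma cone_df:
  assumes "cx X" "0 < n"
  shows "df (cone K n X Y f) 0 = col_mor K (ob X 1) (ob X 2) (ob Y 1) ([-] df X 1) (f 1)"
    "\<lbrakk>0 < i; i < n\<rbrakk> \<Longrightarrow> df (cone K n X Y f) i =
      mat_mor K (ob X (Suc i)) (ob Y i) (ob X (Suc (Suc i))) (ob Y (Suc i))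
        ([-] df X (Suc i)) \<zero>\<^bsub>Hom K (ob Y i) (ob X (Suc (Suc i)))\<^esub> (f (Suc i)) (df Y i)"
    "df (cone K n X Y f) n = row_mor K (ob X (Suc n)) (ob Y n) (ob Y (Suc n)) (f (Suc n)) (df Y n)"
  using assms by (simp_all add: cone_def numeral_2_eq_2)

lemma cone_complex:
  assumes f: "chain_map K n X Y f" and X: "cx X" and Y: "cx Y" and n: "0 < n"
  shows "cx (cone K n X Y f)"
proof (rule cxI)
  note [simp] = X Y chain_mapD[OF f X Y] numeral_2_eq_2
  let ?M = "cone K n X Y f"
  show "ob ?M i \<in> Ob K" if "i \<le> Suc n" for i
    using that n by (auto simp: cone_def)
  show "arr (df ?M i) \<and> dm (df ?M i) = ob ?M i \<and> cd (df ?M i) = ob ?M (Suc i)" if i: "i \<le> n" for i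
  proof -
    consider "i = 0" | "0 < i" "i < n" | "i = n" using i by linarith
    then show ?thesis
      using n by cases (simp_all add: cone_ob cone_df)
  qed
  show "df ?M (Suc i) \<cdot> df ?M i = \<zero>\<^bsub>Hom K (ob ?M i) (ob ?M (Suc (Suc i)))\<^esub>" if i: "i < n" for i
  proof -
    \<comment> \<open>For n = 1 the column is followed at once by the row; for larger n there are
      matrices between them.\<close>
    consider "i = 0" "Suc 0 = n" | "i = 0" "1 < n" | "0 < i" "Suc i < n" | "0 < i" "Suc i = n"
      using i by linarith
    then show ?thesis
    proof cases
      case 1
      then show ?thesis
        using cone_df(3)[OF X n, of Y f] by (simp add: cone_ob cone_df row_col)
    next
      case 2
      then show ?thesis by (simp add: cone_ob cone_df mat_col)
    next
      case 3
      then show ?thesis by (simp add: cone_ob cone_df mat_mat)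
    next
      case 4
      then show ?thesis
        using cone_df(3)[OF X n, of Y f] cone_ob(3)[of X Y f] df_df[OF Y, of i]
        by (simp add: cone_ob cone_df row_mat)
    qed
  qed
qed

text \<open>If \<open>f - g = d h + h d\<close> with \<open>h\<close> vanishing in the lowest degree, then the matrices
  \<open>[[1, 0], [h, 1]]\<close> form an isomorphism from the cone of \<open>f\<close> to that of \<open>g\<close>.\<close>

definition cone_htpy :: "('o, 'm) cpx \<Rightarrow> ('o, 'm) cpx \<Rightarrow> (nat \<Rightarrow> 'm) \<Rightarrow> nat \<Rightarrow> 'm" where
  "cone_htpy X Y h i =
    (if i = 0 then Idt K (ob X 1)
     else if i \<le> n then mat_mor K (ob X (Suc i)) (ob Y i) (ob X (Suc i)) (ob Y i)
       (Idt K (ob X (Suc i))) \<zero>\<^bsub>Hom K (ob Y i) (ob X (Suc i))\<^esub> (h i) (Idt K (ob Y i))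
     else Idt K (ob Y (Suc n)))"

lemma chain_map_cone_htpy:
  assumes f: "chain_map K n X Y f" and g: "chain_map K n X Y g" and X: "cx X" and Y: "cx Y"
    and n: "0 < n" and h: "nullhtpy X Y (\<lambda>i. f i [+] [-] g i) h"
    and h0: "h 0 = \<zero>\<^bsub>Hom K (ob X 1) (ob Y 0)\<^esub>"
  shows "chain_map_ends K n (ob X 1) (ob Y (Suc n)) (cone K n X Y f) (cone K n X Y g) (cone_htpy X Y h)"
proof -
  note [simp] = X Y chain_mapD[OF f X Y] chain_mapD[OF g X Y] nullhtpyD(1-3)[OF h X Y] numeral_2_eq_2
  let ?M = "cone K n X Y f" and ?N = "cone K n X Y g" and ?F = "cone_htpy X Y h"
  note [simp] = cone_complex[OF f X Y n] cone_complex[OF g X Y n]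
  have f_eq: "f (Suc i) = g (Suc i) [+] (df Y i \<cdot> h i [+] h (Suc i) \<cdot> df X (Suc i))" if "i < n" for i
    using nullhtpyD(5)[OF h X Y that] that by (simp flip: nullhtpyD(5)[OF h X Y that] add: padd_left_comm)
  have f_eq_n: "f (Suc n) = g (Suc n) [+] df Y n \<cdot> h n"
    by (simp flip: nullhtpyD(6)[OF h X Y] add: padd_left_comm)
  have "chain_map K n ?M ?N ?F"
  proof (rule chain_mapI)
    fix i assume i: "i \<le> Suc n"
    then consider "i = 0" | "0 < i" "i \<le> n" | "i = Suc n" by linarith
    then show "arr (?F i) \<and> dm (?F i) = ob ?M i \<and> cd (?F i) = ob ?N i"
      using n by cases (simp_all add: cone_htpy_def cone_ob)
  next
    fix i assume i: "i \<le> n"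
    then consider "i = 0" | "0 < i" "i < n" | "i = n" by linarith
    then show "?F (Suc i) \<cdot> df ?M i = df ?N i \<cdot> ?F i"
    proof cases
      \<comment> \<open>In degree 1 the difference of \<open>f\<close> and \<open>g\<close> contains
        \<open>df Y 0 \<cdot> h 0\<close>, which no entry of the matrices can absorb; it disappears
        because \<open>h 0\<close> is zero.\<close>
      case 1
      then show ?thesis
        using n f_eq[of 0] h0
        by (simp add: cone_htpy_def cone_ob cone_df mat_col padd_left_comm padd_comm)
    next
      case 2
      then show ?thesis
        using f_eq[of i]
        by (simp add: cone_htpy_def cone_ob cone_df mat_mat padd_left_comm padd_comm)
    next
      case 3
      then show ?thesis
        using n f_eq_n by (simp add: cone_htpy_def cone_ob cone_df row_mat)
    qed
  qed auto
  then show ?thesis by (simp add: chain_map_ends_def cone_htpy_def)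
qed

lemma nullhtpy_neg:
  assumes h: "nullhtpy X Y (\<lambda>i. f i [+] [-] g i) h"
    and f: "fam X Y f" and g: "fam X Y g" and X: "cx X" and Y: "cx Y"
  shows "nullhtpy X Y (\<lambda>i. g i [+] [-] f i) (\<lambda>i. [-] h i)"
proof -
  note [simp] = X Y famD[OF f X Y] famD[OF g X Y] nullhtpyD(1-3)[OF h X Y]
  have *: "g i [+] [-] f i = [-] (f i [+] [-] g i)" if "i \<le> Suc n" for i
    using that by (simp add: padd_comm)
  show ?thesis
    unfolding nullhtpy_def
  proof (intro conjI allI impI)
    show "g (Suc i) [+] [-] f (Suc i) = df Y i \<cdot> [-] h i [+] [-] h (Suc i) \<cdot> df X (Suc i)" if "i < n" for i
      unfolding *[OF Suc_leI[OF less_SucI[OF that]]] nullhtpyD(5)[OF h X Y that] using that by simp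
    show "g 0 [+] [-] f 0 = [-] h 0 \<cdot> df X 0"
      unfolding *[OF le0] nullhtpyD(4)[OF h X Y] by simp
    show "g (Suc n) [+] [-] f (Suc n) = df Y n \<cdot> [-] h n"
      unfolding *[OF order_refl] nullhtpyD(6)[OF h X Y] by simp
  qed (simp add: hom_iff)
qed

text \<open>The unipotent matrices belonging to h and -h are inverse to each other, and the
  isomorphism is the identity on both end terms.\<close>

lemma homotopy_equiv_cone:
  assumes f: "chain_map K n X Y f" and g: "chain_map K n X Y g" and X: "cx X" and Y: "cx Y"
    and n: "0 < n" and h: "nullhtpy X Y (\<lambda>i. f i [+] [-] g i) h"
    and h0: "h 0 = \<zero>\<^bsub>Hom K (ob X 1) (ob Y 0)\<^esub>"
  shows "homotopy_equiv K n (ob X 1) (ob Y (Suc n)) (cone K n X Y f) (cone K n X Y g)"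
proof (rule homotopy_equivI_iso)
  note [simp] = X Y nullhtpyD(1-3)[OF h X Y]
  show "chain_map_ends K n (ob X 1) (ob Y (Suc n)) (cone K n X Y f) (cone K n X Y g) (cone_htpy X Y h)"
    using chain_map_cone_htpy[OF assms] .
  show "chain_map_ends K n (ob X 1) (ob Y (Suc n)) (cone K n X Y g) (cone K n X Y f)
      (cone_htpy X Y (\<lambda>i. [-] h i))"
    using chain_map_cone_htpy[OF g f X Y n nullhtpy_neg[OF h _ _ X Y]] f g h0
    by (simp add: chain_map_fam)
  fix i assume i: "i \<le> Suc n"
  then consider "i = 0" | "0 < i" "i \<le> n" | "i = Suc n" by linarith
  then show "cone_htpy X Y (\<lambda>i. [-] h i) i \<cdot> cone_htpy X Y h i = Idt K (ob (cone K n X Y f) i)"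
    "cone_htpy X Y h i \<cdot> cone_htpy X Y (\<lambda>i. [-] h i) i = Idt K (ob (cone K n X Y g) i)"
    by (cases; simp add: cone_htpy_def mat_mat cone_ob)+
qed (use cone_complex assms in auto)

section \<open>Mapping cocones\<close>

lemma cocone_ob:
  "ob (cocone K n X Y f) 0 = ob X 0"
  "\<lbrakk>0 < i; i \<le> n\<rbrakk> \<Longrightarrow> ob (cocone K n X Y f) i = Sum K (ob X i) (ob Y (i - 1))"
  "ob (cocone K n X Y f) (Suc n) = ob Y n"
  by (simp_all add: cocone_def)

lemma cocone_df:
  assumes "cx Y" "0 < n"
  shows "df (cocone K n X Y f) 0 = col_mor K (ob X 0) (ob X 1) (ob Y 0) (df X 0) (f 0)"
    "Suc i < n \<Longrightarrow> df (cocone K n X Y f) (Suc i) =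
      mat_mor K (ob X (Suc i)) (ob Y i) (ob X (Suc (Suc i))) (ob Y (Suc i))
        (df X (Suc i)) \<zero>\<^bsub>Hom K (ob Y i) (ob X (Suc (Suc i)))\<^esub> (f (Suc i)) ([-] df Y i)"
    "df (cocone K n X Y f) n = row_mor K (ob X n) (ob Y (n-1)) (ob Y n) (f n) ([-] df Y (n-1))"
  using assms by (simp_all add: cocone_def)

lemma cocone_complex:
  assumes f: "chain_map K n X Y f" and X: "cx X" and Y: "cx Y" and n: "0 < n"
  shows "cx (cocone K n X Y f)"
proof (rule cxI)
  note [simp] = X Y chain_mapD[OF f X Y] numeral_2_eq_2
  let ?M = "cocone K n X Y f"
  show "ob ?M i \<in> Ob K" if "i \<le> Suc n" for i
    using that n by (auto simp: cocone_def)
  show "arr (df ?M i) \<and> dm (df ?M i) = ob ?M i \<and> cd (df ?M i) = ob ?M (Suc i)" if i: "i \<le> n" for i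
  proof -
    consider "i = 0" | j where "i = Suc j" "i < n" | j where "i = n" "Suc j = n" "n - 1 = j"
      using i n by (cases i; cases n) (auto simp: le_less)
    then show ?thesis
      using n cocone_df(3)[OF Y n, of X f] by cases (simp_all add: cocone_ob cocone_df)
  qed
  show "df ?M (Suc i) \<cdot> df ?M i = \<zero>\<^bsub>Hom K (ob ?M i) (ob ?M (Suc (Suc i)))\<^esub>" if i: "i < n" for i
  proof -
    consider "i = 0" "Suc 0 = n" "n - 1 = 0" | "i = 0" "1 < n" | j where "i = Suc j" "Suc i < n"
      | j where "i = Suc j" "Suc i = n" "n - 1 = i"
      using i by (cases i) fastforce+
    then show ?thesis
    proof cases
      case 1
      then show ?thesis
        using cocone_df(3)[OF Y n, of X f] chain_mapD(4)[OF f X Y, of 0]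
        by (simp add: cocone_ob cocone_df row_col)
    next
      case 2
      then show ?thesis by (simp add: cocone_ob cocone_df mat_col)
    next
      case 3
      then show ?thesis by (simp add: cocone_ob cocone_df mat_mat)
    next
      case 4
      then show ?thesis
        using cocone_df(3)[OF Y n, of X f] cocone_ob(3)[of X Y f] chain_mapD(4)[OF f X Y, of i]
        by (simp add: cocone_ob cocone_df row_mat)
    qed
  qed
qed

text \<open>The sign differs from \<open>cone_htpy\<close> because in a cocone it is the
  differential of \<open>Y\<close>, rather than that of \<open>X\<close>, that is negated.\<close>

definition cocone_htpy :: "('o, 'm) cpx \<Rightarrow> ('o, 'm) cpx \<Rightarrow> (nat \<Rightarrow> 'm) \<Rightarrow> nat \<Rightarrow> 'm" where
  "cocone_htpy X Y h i =
    (if i = 0 then Idt K (ob X 0)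
     else if i \<le> n then mat_mor K (ob X i) (ob Y (i-1)) (ob X i) (ob Y (i-1))
       (Idt K (ob X i)) \<zero>\<^bsub>Hom K (ob Y (i-1)) (ob X i)\<^esub> ([-] h (i-1)) (Idt K (ob Y (i-1)))
     else Idt K (ob Y n))"

lemma chain_map_cocone_htpy:
  assumes f: "chain_map K n X Y f" and g: "chain_map K n X Y g" and X: "cx X" and Y: "cx Y"
    and n: "0 < n" and h: "nullhtpy X Y (\<lambda>i. f i [+] [-] g i) h"
    and hn: "h n = \<zero>\<^bsub>Hom K (ob X (Suc n)) (ob Y n)\<^esub>"
  shows "chain_map_ends K n (ob X 0) (ob Y n) (cocone K n X Y f) (cocone K n X Y g) (cocone_htpy X Y h)"
proof -
  note [simp] = X Y chain_mapD[OF f X Y] chain_mapD[OF g X Y] nullhtpyD(1-3)[OF h X Y] numeral_2_eq_2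
  let ?M = "cocone K n X Y f" and ?N = "cocone K n X Y g" and ?F = "cocone_htpy X Y h"
  note [simp] = cocone_complex[OF f X Y n] cocone_complex[OF g X Y n]
  have f_eq: "f (Suc i) = g (Suc i) [+] (df Y i \<cdot> h i [+] h (Suc i) \<cdot> df X (Suc i))" if "i < n" for i
    using nullhtpyD(5)[OF h X Y that] that by (simp flip: nullhtpyD(5)[OF h X Y that] add: padd_left_comm)
  have f_eq_0: "f 0 = g 0 [+] h 0 \<cdot> df X 0"
    by (simp flip: nullhtpyD(4)[OF h X Y] add: padd_left_comm)
  have "chain_map K n ?M ?N ?F"
  proof (rule chain_mapI)
    fix i assume i: "i \<le> Suc n"
    then consider "i = 0" | j where "i = Suc j" "j < n" | "i = Suc n" by (cases i) (auto simp: le_less)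
    then show "arr (?F i) \<and> dm (?F i) = ob ?M i \<and> cd (?F i) = ob ?N i"
      using n by cases (simp_all add: cocone_htpy_def cocone_ob)
  next
    fix i assume i: "i \<le> n"
    then consider "i = 0" | j where "i = Suc j" "i < n" | j where "i = n" "Suc j = n" "n - 1 = j"
      using i n by (cases i; cases n) (auto simp: le_less)
    then show "?F (Suc i) \<cdot> df ?M i = df ?N i \<cdot> ?F i"
    proof cases
      case 1
      then show ?thesis
        using n f_eq_0
        by (simp add: cocone_htpy_def cocone_ob cocone_df mat_col padd_left_comm padd_comm)
    next
      case 2
      then show ?thesis
        using f_eq[of j]
        by (simp add: cocone_htpy_def cocone_ob cocone_df mat_mat padd_left_comm padd_comm)
    next
      \<comment> \<open>Here the summand \<open>h n \<cdot> df X n\<close> has no place in the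
        cocone, which stops before X^(n+1); it disappears because \<open>h n\<close> is
        zero.\<close>
      case 3
      then show ?thesis
        using n f_eq[of j] hn cocone_df(3)[OF Y n, of X] by (simp add: cocone_htpy_def cocone_ob cocone_df row_mat)
    qed
  qed auto
  then show ?thesis using n by (simp add: chain_map_ends_def cocone_htpy_def)
qed

lemma homotopy_equiv_cocone:
  assumes f: "chain_map K n X Y f" and g: "chain_map K n X Y g" and X: "cx X" and Y: "cx Y"
    and n: "0 < n" and h: "nullhtpy X Y (\<lambda>i. f i [+] [-] g i) h"
    and hn: "h n = \<zero>\<^bsub>Hom K (ob X (Suc n)) (ob Y n)\<^esub>"
  shows "homotopy_equiv K n (ob X 0) (ob Y n) (cocone K n X Y f) (cocone K n X Y g)"
proof (rule homotopy_equivI_iso)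
  note [simp] = X Y nullhtpyD(1-3)[OF h X Y]
  show "chain_map_ends K n (ob X 0) (ob Y n) (cocone K n X Y f) (cocone K n X Y g) (cocone_htpy X Y h)"
    using chain_map_cocone_htpy[OF assms] .
  show "chain_map_ends K n (ob X 0) (ob Y n) (cocone K n X Y g) (cocone K n X Y f)
      (cocone_htpy X Y (\<lambda>i. [-] h i))"
    using chain_map_cocone_htpy[OF g f X Y n nullhtpy_neg[OF h _ _ X Y]] f g hn
    by (simp add: chain_map_fam)
  fix i assume i: "i \<le> Suc n"
  then consider "i = 0" | j where "i = Suc j" "j < n" | "i = Suc n" by (cases i) (auto simp: le_less)
  then show "cocone_htpy X Y (\<lambda>i. [-] h i) i \<cdot> cocone_htpy X Y h i = Idt K (ob (cocone K n X Y f) i)"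
    "cocone_htpy X Y h i \<cdot> cocone_htpy X Y (\<lambda>i. [-] h i) i = Idt K (ob (cocone K n X Y g) i)"
    by (cases; simp add: cocone_htpy_def mat_mat cocone_ob)+
qed (use cocone_complex assms in auto)

section \<open>Chain maps through a given square, and correction of their ends\<close>

text \<open>The cokernel property of the source extends the square upwards, the kernel property of
  the target extends it downwards, and the two halves agree on the square itself.\<close>

lemma extend_square:
  assumes X: "n_cokernel_seq K n X" and Y: "n_kernel_seq K n Y" and k: "k \<le> n"
    and a: "arr a" "dm a = ob X k" "cd a = ob Y k"
    and b: "arr b" "dm b = ob X (Suc k)" "cd b = ob Y (Suc k)"
    and ab: "b \<cdot> df X k = df Y k \<cdot> a"
  obtains f where "chain_map K n X Y f" "f k = a" "f (Suc k) = b"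
proof -
  have cx [simp]: "cx X" "cx Y" using X Y by (simp_all add: n_cokernel_seq_iff n_kernel_seq_iff)
  have ab': "a \<in> Mor K (ob X k) (ob Y k)" "b \<in> Mor K (ob X (Suc k)) (ob Y (Suc k))"
    using a b k by (simp_all add: hom_iff)
  obtain r where r: "r k = a" "r (Suc k) = b"
      "\<forall>i. k \<le> i \<longrightarrow> i \<le> Suc n \<longrightarrow> r i \<in> Mor K (ob X i) (ob Y i)"
      "\<forall>i. k \<le> i \<longrightarrow> i \<le> n \<longrightarrow> r (Suc i) \<cdot> df X i = df Y i \<cdot> r i"
    using extend_right[OF X cx(2) k ab' ab] by (elim exE conjE, intro that)
  obtain l where l: "l k = a" "l (Suc k) = b"
      "\<forall>i\<le>Suc k. l i \<in> Mor K (ob X i) (ob Y i)"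
      "\<forall>i\<le>k. l (Suc i) \<cdot> df X i = df Y i \<cdot> l i"
    using extend_left[OF Y cx(1) k ab' ab] by (elim exE conjE, intro that)
  define f where "f i = (if i \<le> k then l i else r i)" for i
  have "fam X Y f" unfolding fam_def
    using l(3) r(3) by (auto simp: f_def)
  moreover have "f (Suc i) \<cdot> df X i = df Y i \<cdot> f i" if "i \<le> n" for i
  proof -
    consider "i < k" | "i = k" | "k < i" by linarith
    then show ?thesis
      using l r ab that by cases (simp_all add: f_def)
  qed
  ultimately have "chain_map K n X Y f" by (simp add: chain_map_iff)
  then show ?thesis using that[of f] l(1) r(2) by (simp add: f_def)
qed

text \<open>The map u - 1 vanishes in two consecutive degrees. It is therefore contracted to the
  right from degree \<open>k\<close> and to the left from degree \<open>Suc k\<close>; only the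
  outermost formulas of the two homotopies are kept.\<close>

lemma htpy_ends:
  assumes X: "n_cokernel_seq K n X" and X': "n_kernel_seq K n X" and k: "k \<le> n"
    and u: "chain_map K n X X u" "u k = Idt K (ob X k)" "u (Suc k) = Idt K (ob X (Suc k))"
  obtains a b where "arr a" "dm a = ob X 1" "cd a = ob X 0" "u 0 = Idt K (ob X 0) [+] a \<cdot> df X 0"
    "arr b" "dm b = ob X (Suc n)" "cd b = ob X n" "u (Suc n) = Idt K (ob X (Suc n)) [+] df X n \<cdot> b"
proof -
  have cx [simp]: "cx X" using X by (simp add: n_cokernel_seq_iff)
  note [simp] = chain_mapD(1-3)[OF u(1) cx cx]
  have d: "chain_map K n X X (\<lambda>i. u i [+] [-] Idt K (ob X i))"
    using chain_map_diff[OF u(1) chain_map_id[OF cx] cx cx] .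
  have k0: "u k [+] [-] Idt K (ob X k) = \<zero>\<^bsub>Hom K (ob X k) (ob X k)\<^esub>"
      "u (Suc k) [+] [-] Idt K (ob X (Suc k)) = \<zero>\<^bsub>Hom K (ob X (Suc k)) (ob X (Suc k))\<^esub>"
    using u(2,3) k by simp_all
  obtain h where h: "\<forall>i. k \<le> i \<longrightarrow> i \<le> n \<longrightarrow> h i \<in> Mor K (ob X (Suc i)) (ob X i)"
    "u (Suc n) [+] [-] Idt K (ob X (Suc n)) = df X n \<cdot> h n"
    using homotopy_right[OF X cx k d k0(1)] by (elim exE conjE, intro that)
  obtain l where l: "\<forall>i\<le>k. l i \<in> Mor K (ob X (Suc i)) (ob X i)"
    "u 0 [+] [-] Idt K (ob X 0) = l 0 \<cdot> df X 0"
    using homotopy_left[OF X' cx k d k0(2)] by (elim exE conjE, intro that)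
  have b: "arr (h n)" "dm (h n) = ob X (Suc n)" "cd (h n) = ob X n"
    using h(1) k hom_iff[of "ob X (Suc n)" "ob X n" "h n"] by simp_all
  have a: "arr (l 0)" "dm (l 0) = ob X 1" "cd (l 0) = ob X 0"
    using l(1) hom_iff[of "ob X 1" "ob X 0" "l 0"] by simp_all
  show ?thesis
    by (rule that[OF a _ b]) (simp_all flip: h(2) l(2) add: padd_left_comm)
qed

text \<open>Both d (d h + h d) and (d h + h d) d equal d h d. The cases arise because at either end
  one of the two summands is missing.\<close>

lemma nullhtpy_chain_map:
  assumes X: "cx X" and Y: "cx Y" and h: "nullhtpy X Y f h"
  shows "chain_map K n X Y f"
proof (rule chain_mapI[OF X Y])
  note [simp] = X Y nullhtpyD(1-3)[OF h X Y]
  note f = nullhtpyD(4-6)[OF h X Y]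
  show "arr (f i) \<and> dm (f i) = ob X i \<and> cd (f i) = ob Y i" if i: "i \<le> Suc n" for i
  proof -
    consider "i = 0" | j where "i = Suc j" "j < n" | "i = Suc n" using i by (cases i) (auto simp: le_less)
    then show ?thesis by cases (simp_all add: f)
  qed
  show "f (Suc i) \<cdot> df X i = df Y i \<cdot> f i" if i: "i \<le> n" for i
  proof -
    consider "i = 0" "i = n" | "i = 0" "i < n" | j where "i = Suc j" "i < n" | j where "i = Suc j" "i = n" "j < n"
      using i by (cases i; cases "i = n") auto
    then show ?thesis
    proof cases
      \<comment> \<open>This is n = 0, where the lowest and the highest formula describe the two
        sides of a single square.\<close>
      case 1
      have "(df Y n \<cdot> h n) \<cdot> df X n = df Y n \<cdot> (h n \<cdot> df X n)" by simp
      then show ?thesis using 1 f(1,3) by metis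
    next
      case 4
      then have j: "Suc j = n" by simp
      have "df Y (Suc j) \<cdot> (df Y j \<cdot> h j) = \<zero>\<^bsub>Hom K (ob X (Suc j)) (ob Y (Suc (Suc j)))\<^esub>"
        using 4(3) by simp
      then have z: "df Y n \<cdot> (df Y j \<cdot> h j) = \<zero>\<^bsub>Hom K (ob X n) (ob Y (Suc n))\<^esub>"
        unfolding j .
      have dmcd: "cd (df Y j) = ob Y n" "dm (h j) = ob X n"
        using 4(3) nullhtpyD(2)[OF h X Y, of j] cd_df[OF Y, of j] unfolding j by simp_all
      have "f n = df Y j \<cdot> h j [+] h n \<cdot> df X n"
        using f(2)[OF 4(3)] unfolding j .
      then have "df Y n \<cdot> f n = df Y n \<cdot> (h n \<cdot> df X n)"
        using 4(3) z dmcd by simp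
      moreover have "f (Suc n) \<cdot> df X n = df Y n \<cdot> (h n \<cdot> df X n)"
        using f(3) by simp
      ultimately show ?thesis unfolding 4(2) by simp
    qed (simp_all add: f)
  qed
qed

text \<open>Subtract the null-homotopic map whose homotopy is \<open>a\<close> in the lowest place,
  \<open>b\<close> in the highest and zero elsewhere. The two places are distinct because
  \<open>0 < n\<close>, so both ends can be corrected at once.\<close>

lemma chain_map_adjust_ends:
  assumes n: "0 < n" and X: "cx X" and Y: "cx Y" and u: "chain_map K n X Y u"
    and a: "arr a" "dm a = ob X 1" "cd a = ob Y 0" and b: "arr b" "dm b = ob X (Suc n)" "cd b = ob Y n"
    and p: "arr p" "dm p = ob X 0" "cd p = ob Y 0" "u 0 = p [+] a \<cdot> df X 0"
    and q: "arr q" "dm q = ob X (Suc n)" "cd q = ob Y (Suc n)" "u (Suc n) = q [+] df Y n \<cdot> b"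
  obtains v where "chain_map K n X Y v" "v 0 = p" "v (Suc n) = q"
proof -
  note [simp] = X Y a b p q
  define h where "h i = (if i = 0 then a else if i = n then b else \<zero>\<^bsub>Hom K (ob X (Suc i)) (ob Y i)\<^esub>)" for i
  define f where "f i = (case i of 0 \<Rightarrow> h 0 \<cdot> df X 0
     | Suc j \<Rightarrow> if j < n then df Y j \<cdot> h j [+] h (Suc j) \<cdot> df X (Suc j) else df Y n \<cdot> h n)" for i
  have "nullhtpy X Y f h"
    using n by (auto simp: nullhtpy_def f_def h_def hom_iff)
  then have f: "chain_map K n X Y f" by (rule nullhtpy_chain_map[OF X Y])
  show ?thesis
  proof (rule that[OF chain_map_diff[OF u f X Y]])
    show "u 0 [+] [-] f 0 = p" by (simp add: f_def h_def padd_assoc)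
    show "u (Suc n) [+] [-] f (Suc n) = q" using n by (simp add: f_def h_def padd_assoc)
  qed
qed

end

section \<open>Extensions and conflations\<close>

locale exangulated = complex_category K n + biadditive_functor K E
  for K :: "('o, 'm) addcat" (structure) and n :: nat and E :: "('o, 'm, 'e) bifun" +
  fixes s :: "('o, 'm, 'e) realiz"
  assumes n_pos: "0 < n"
    and realization: "exact_realization K E s n"
    and EA1: "EA1 K E s n" and EA2: "EA2 K E s n" and EA2_op: "EA2_op K E s n"
    and inflation_monic: "\<And>f. inflation K E s f \<Longrightarrow> monic K f"
    and deflation_epic: "\<And>f. deflation K E s n f \<Longrightarrow> epic K f"
begin

section \<open>The groups of extensions and their functoriality\<close>

abbreviation eadd :: "'o \<Rightarrow> 'o \<Rightarrow> 'e \<Rightarrow> 'e \<Rightarrow> 'e" where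
  "eadd C A \<delta> \<rho> \<equiv> \<delta> \<oplus>\<^bsub>EOb E C A\<^esub> \<rho>"

lemma ezero_in [simp]: "\<lbrakk>C \<in> Ob K; A \<in> Ob K\<rbrakk> \<Longrightarrow> \<zero>\<^bsub>EOb E C A\<^esub> \<in> Ex E C A"
  using E_abelian abelian_group.axioms(1) abelian_monoid.zero_closed by blast

lemma eadd_zero [simp]:
  assumes "C \<in> Ob K" "A \<in> Ob K" "\<delta> \<in> Ex E C A"
  shows "eadd C A \<delta> \<zero>\<^bsub>EOb E C A\<^esub> = \<delta>" "eadd C A \<zero>\<^bsub>EOb E C A\<^esub> \<delta> = \<delta>"
proof -
  interpret abelian_group "EOb E C A" using E_abelian assms by blast
  show "eadd C A \<delta> \<zero>\<^bsub>EOb E C A\<^esub> = \<delta>" "eadd C A \<zero>\<^bsub>EOb E C A\<^esub> \<delta> = \<delta>"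
    using assms by simp_all
qed

lemma eadd_in [simp]:
  assumes "C \<in> Ob K" "A \<in> Ob K" "\<delta> \<in> Ex E C A" "\<rho> \<in> Ex E C A"
  shows "eadd C A \<delta> \<rho> \<in> Ex E C A"
proof -
  interpret abelian_group "EOb E C A" using E_abelian assms by blast
  show ?thesis using assms by simp
qed

lemma eadd_idem:
  assumes "C \<in> Ob K" "A \<in> Ob K" "\<delta> \<in> Ex E C A" "eadd C A \<delta> \<delta> = \<delta>"
  shows "\<delta> = \<zero>\<^bsub>EOb E C A\<^esub>"
proof -
  interpret abelian_group "EOb E C A" using E_abelian assms by blast
  show ?thesis using assms add.l_cancel_one by fastforce
qed

lemma EMor_hom:
  assumes "arr c" "arr a"
  shows "abelian_group_hom (EOb E (cd c) (dm a)) (EOb E (dm c) (cd a)) (EMor E c a)"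
  using E_hom arr_hom[OF assms(1)] arr_hom[OF assms(2)] assms by simp

lemma pull_in [simp]:
  assumes "arr c" "A \<in> Ob K" "cd c = C" "dm c = C'" "\<delta> \<in> Ex E C A"
  shows "pull K E A c \<delta> \<in> Ex E C' A"
  using abelian_group_hom.hom_closed[OF EMor_hom[of c "Idt K A"]] assms by (simp add: pull_def)

lemma push_in [simp]:
  assumes "arr a" "C \<in> Ob K" "dm a = A" "cd a = B" "\<delta> \<in> Ex E C A"
  shows "push K E C a \<delta> \<in> Ex E C B"
  using abelian_group_hom.hom_closed[OF EMor_hom[of "Idt K C" a]] assms by (simp add: push_def)

lemma pull_pull:
  assumes "arr c" "arr c'" "cd c' = dm c" "A \<in> Ob K" "\<delta> \<in> Ex E (cd c) A"
  shows "pull K E A c' (pull K E A c \<delta>) = pull K E A (c \<cdot> c') \<delta>"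
  using E_comp[of "cd c" "dm c" "dm c'" A A A c c' "Idt K A" "Idt K A" \<delta>] assms
    arr_hom[of c] arr_hom[of c'] id_mor by (simp add: pull_def)

lemma push_push:
  assumes "arr a" "arr a'" "dm a' = cd a" "C \<in> Ob K" "\<delta> \<in> Ex E C (dm a)"
  shows "push K E C a' (push K E C a \<delta>) = push K E C (a' \<cdot> a) \<delta>"
  using E_comp[of C C C "dm a" "cd a" "cd a'" "Idt K C" "Idt K C" a a' \<delta>] assms
    arr_hom[of a] arr_hom[of a'] id_mor by (simp add: push_def)

text \<open>Both sides are the value of the bifunctor at the pair (c, a), factored through
  identities in the two possible orders.\<close>

lemma push_pull:
  assumes "arr a" "arr c" "dm a = A" "cd a = B" "cd c = C" "dm c = C'" "\<delta> \<in> Ex E C A"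
  shows "push K E C' a (pull K E A c \<delta>) = pull K E B c (push K E C a \<delta>)"
proof -
  have "push K E C' a (pull K E A c \<delta>) = EMor E (c \<cdot> Idt K C') (a \<cdot> Idt K A) \<delta>"
    using E_comp[of C C' C' A A B c "Idt K C'" "Idt K A" a \<delta>] assms arr_homD[of c] arr_homD[of a] id_mor
    by (auto simp: push_def pull_def)
  also have "\<dots> = EMor E (Idt K C \<cdot> c) (Idt K B \<cdot> a) \<delta>"
    using assms by simp
  also have "\<dots> = pull K E B c (push K E C a \<delta>)"
    using E_comp[of C C C' A B B "Idt K C" c a "Idt K B" \<delta>] assms arr_homD[of c] arr_homD[of a] id_mor
    by (auto simp: push_def pull_def)
  finally show ?thesis .
qed

lemma pull_idt [simp]: "\<lbrakk>C \<in> Ob K; A \<in> Ob K; \<delta> \<in> Ex E C A\<rbrakk> \<Longrightarrow> pull K E A (Idt K C) \<delta> = \<delta>"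
  and push_idt [simp]: "\<lbrakk>C \<in> Ob K; A \<in> Ob K; \<delta> \<in> Ex E C A\<rbrakk> \<Longrightarrow> push K E C (Idt K A) \<delta> = \<delta>"
  using E_id by (simp_all add: pull_def push_def)

lemma pull_padd:
  assumes "arr c" "arr c'" "dm c' = dm c" "cd c' = cd c" "A \<in> Ob K" "\<delta> \<in> Ex E (cd c) A"
  shows "pull K E A (c [+] c') \<delta> = eadd (dm c) A (pull K E A c \<delta>) (pull K E A c' \<delta>)"
  using E_add_left[of "cd c" "dm c" A A c c' "Idt K A" \<delta>] assms arr_hom[of c] arr_hom[of c'] id_mor
  by (simp add: pull_def)

lemma push_padd:
  assumes "arr a" "arr a'" "dm a' = dm a" "cd a' = cd a" "C \<in> Ob K" "\<delta> \<in> Ex E C (dm a)"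
  shows "push K E C (a [+] a') \<delta> = eadd C (cd a) (push K E C a \<delta>) (push K E C a' \<delta>)"
  using E_add_right[of C C "dm a" "cd a" "Idt K C" a a' \<delta>] assms arr_hom[of a] arr_hom[of a'] id_mor
  by (simp add: push_def)

lemma pull_zero [simp]:
  assumes "C \<in> Ob K" "C' \<in> Ob K" "A \<in> Ob K" "\<delta> \<in> Ex E C A"
  shows "pull K E A \<zero>\<^bsub>Hom K C' C\<^esub> \<delta> = \<zero>\<^bsub>EOb E C' A\<^esub>"
  using eadd_idem[of C' A "pull K E A \<zero>\<^bsub>Hom K C' C\<^esub> \<delta>"]
    pull_padd[of "\<zero>\<^bsub>Hom K C' C\<^esub>" "\<zero>\<^bsub>Hom K C' C\<^esub>" A \<delta>] assms by simp

lemma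
  assumes "arr c" "A \<in> Ob K" "cd c = C" "dm c = C'"
  shows pull_ezero [simp]: "pull K E A c \<zero>\<^bsub>EOb E C A\<^esub> = \<zero>\<^bsub>EOb E C' A\<^esub>"
    and pull_eadd: "\<lbrakk>\<delta> \<in> Ex E C A; \<rho> \<in> Ex E C A\<rbrakk> \<Longrightarrow>
      pull K E A c (eadd C A \<delta> \<rho>) = eadd C' A (pull K E A c \<delta>) (pull K E A c \<rho>)"
proof -
  interpret abelian_group_hom "EOb E C A" "EOb E C' A" "EMor E c (Idt K A)"
    using EMor_hom[of c "Idt K A"] assms by simp
  show "pull K E A c \<zero>\<^bsub>EOb E C A\<^esub> = \<zero>\<^bsub>EOb E C' A\<^esub>"
    "\<lbrakk>\<delta> \<in> Ex E C A; \<rho> \<in> Ex E C A\<rbrakk> \<Longrightarrow>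
      pull K E A c (eadd C A \<delta> \<rho>) = eadd C' A (pull K E A c \<delta>) (pull K E A c \<rho>)"
    by (simp_all add: pull_def)
qed

lemma
  assumes "arr a" "C \<in> Ob K" "dm a = A" "cd a = B"
  shows push_ezero [simp]: "push K E C a \<zero>\<^bsub>EOb E C A\<^esub> = \<zero>\<^bsub>EOb E C B\<^esub>"
    and push_eadd: "\<lbrakk>\<delta> \<in> Ex E C A; \<rho> \<in> Ex E C A\<rbrakk> \<Longrightarrow>
      push K E C a (eadd C A \<delta> \<rho>) = eadd C B (push K E C a \<delta>) (push K E C a \<rho>)"
proof -
  interpret abelian_group_hom "EOb E C A" "EOb E C B" "EMor E (Idt K C) a"
    using EMor_hom[of "Idt K C" a] assms by simp
  show "push K E C a \<zero>\<^bsub>EOb E C A\<^esub> = \<zero>\<^bsub>EOb E C B\<^esub>"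
    "\<lbrakk>\<delta> \<in> Ex E C A; \<rho> \<in> Ex E C A\<rbrakk> \<Longrightarrow>
      push K E C a (eadd C A \<delta> \<rho>) = eadd C B (push K E C a \<delta>) (push K E C a \<rho>)"
    by (simp_all add: push_def)
qed

section \<open>Realizations and their long exact sequences\<close>

abbreviation conf :: "('o, 'm) cpx set" where
  "conf \<equiv> conflations K E s"

text \<open>Different groups E(C, A) may share elements, so \<delta> alone does not determine its
  ends; here they are those of \<open>X\<close>.\<close>

definition realizes :: "('o, 'm) cpx \<Rightarrow> 'e \<Rightarrow> bool" where
  "realizes X \<delta> \<longleftrightarrow> ob X 0 \<in> Ob K \<and> ob X (Suc n) \<in> Ob K \<and>
     \<delta> \<in> Ex E (ob X (Suc n)) (ob X 0) \<and> X \<in> s (ob X (Suc n)) (ob X 0) \<delta>"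

lemma realization_ex:
  assumes "C \<in> Ob K" "A \<in> Ob K" "\<delta> \<in> Ex E C A"
  obtains X where "X \<in> complexes_ends K n A C" "s C A \<delta> = hclass K n A C X"
  using realization assms unfolding exact_realization_def by blast

lemma s_ends:
  assumes "C \<in> Ob K" "A \<in> Ob K" "\<delta> \<in> Ex E C A" "X \<in> s C A \<delta>"
  shows "ob X 0 = A" "ob X (Suc n) = C" "realizes X \<delta>"
proof -
  have "X \<in> complexes_ends K n A C"
    using realization_ex[OF assms(1-3)] assms(4) unfolding hclass_def by blast
  then show "ob X 0 = A" "ob X (Suc n) = C" "realizes X \<delta>"
    using assms by (auto simp: complexes_ends_def realizes_def)
qed

lemma conf_iff: "X \<in> conf \<longleftrightarrow> (\<exists>\<delta>. realizes X \<delta>)"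
proof
  assume "X \<in> conf"
  then show "\<exists>\<delta>. realizes X \<delta>" using s_ends unfolding conflations_def by blast
qed (auto simp: conflations_def realizes_def)

lemma realizes_exists:
  assumes "C \<in> Ob K" "A \<in> Ob K" "\<delta> \<in> Ex E C A"
  obtains X where "realizes X \<delta>" "ob X 0 = A" "ob X (Suc n) = C"
proof -
  obtain X where "X \<in> complexes_ends K n A C" "s C A \<delta> = hclass K n A C X"
    using realization_ex[OF assms] .
  then have "X \<in> s C A \<delta>" using homotopy_equiv_refl by (simp add: hclass_def)
  then show ?thesis using that s_ends[OF assms] by blast
qed

text \<open>The value of \<open>s\<close> is given as the class of some representative
  \<open>Z\<close>, not as that of \<open>X\<close>; closure therefore passes from \<open>Z\<close>
  to \<open>X\<close> and on to \<open>Y\<close>.\<close>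

lemma realizes_closed:
  assumes X: "realizes X \<delta>" and Y: "Y \<in> complexes_ends K n (ob X 0) (ob X (Suc n))"
    and XY: "homotopy_equiv K n (ob X 0) (ob X (Suc n)) X Y"
  shows "realizes Y \<delta>"
proof -
  have *: "ob X (Suc n) \<in> Ob K" "ob X 0 \<in> Ob K" "\<delta> \<in> Ex E (ob X (Suc n)) (ob X 0)"
    using X by (simp_all add: realizes_def)
  obtain Z where Z: "Z \<in> complexes_ends K n (ob X 0) (ob X (Suc n))"
      "s (ob X (Suc n)) (ob X 0) \<delta> = hclass K n (ob X 0) (ob X (Suc n)) Z"
    using realization_ex[OF *] .
  have "X \<in> hclass K n (ob X 0) (ob X (Suc n)) Z" using X Z(2) by (simp add: realizes_def)
  then have ZX: "homotopy_equiv K n (ob X 0) (ob X (Suc n)) Z X" and "cx X"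
    by (simp_all add: hclass_def complexes_ends_def)
  then have "homotopy_equiv K n (ob X 0) (ob X (Suc n)) Z Y"
    using homotopy_equiv_trans[OF ZX XY] Y Z(1) * by (simp add: complexes_ends_def)
  then show ?thesis using s_ends(3)[OF *, of Y] Y Z(2) by (simp add: hclass_def)
qed

lemma R0: "R0 K E s n" and R1: "R1 K E s n" and R2: "R2 K E s n"
  using realization unfolding exact_realization_def by simp_all

lemma realizes_exangle: "realizes X \<delta> \<Longrightarrow> n_exangle K E n X \<delta>"
  using R1[unfolded R1_def, rule_format, of "ob X 0" "ob X (Suc n)" \<delta> X]
  unfolding realizes_def by simp

lemma realizes_cx: "realizes X \<delta> \<Longrightarrow> cx X"
  using realizes_exangle[of X \<delta>, unfolded n_exangle_def, THEN conjunct1] .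

lemma realizes_ext: "realizes X \<delta> \<Longrightarrow> \<delta> \<in> Ex E (ob X (Suc n)) (ob X 0)"
  by (simp add: realizes_def)

lemma realizes_conf: "realizes X \<delta> \<Longrightarrow> X \<in> conf"
  using conf_iff[of X] by auto

lemma realizes_inflation: "realizes X \<delta> \<Longrightarrow> inflation K E s (df X 0)"
  and realizes_deflation: "realizes X \<delta> \<Longrightarrow> deflation K E s n (df X n)"
  unfolding adm_mono_def adm_epi_def by (blast intro: realizes_conf)+

text \<open>Exactness at the inner terms is part of (R1). What is new is injectivity at the left
  end, and this is monicity of the inflation.\<close>

lemma realizes_n_kernel:
  assumes X: "realizes X \<delta>"
  shows "n_kernel_seq K n X"
proof -
  have [simp]: "cx X" using X by (rule realizes_cx)
  have m: "monic K (df X 0)"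
    by (rule inflation_monic[OF realizes_inflation[OF X]])
  have "a_kernel (Hom K W (ob X 0)) (Hom K W (ob X 1)) (\<lambda>g. df X 0 \<cdot> g) = {\<zero>\<^bsub>Hom K W (ob X 0)\<^esub>}"
    (is "?ker W = ?zero W") if W: "W \<in> Ob K" for W
  proof (intro equalityI subsetI)
    fix g assume "g \<in> ?ker W"
    then have "g = \<zero>\<^bsub>Hom K W (ob X 0)\<^esub>"
      using W by - (rule monicD[OF m]; auto simp: a_kernel_def' hom_iff)
    then show "g \<in> ?zero W" by simp
  qed (use W in \<open>auto simp: a_kernel_def' hom_iff\<close>)
  then show ?thesis
    using realizes_exangle[OF X] by (simp add: n_kernel_seq_def n_exangle_def)
qed

lemma realizes_n_cokernel:
  assumes X: "realizes X \<delta>"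
  shows "n_cokernel_seq K n X"
proof -
  have [simp]: "cx X" using X by (rule realizes_cx)
  have m: "epic K (df X n)"
    by (rule deflation_epic[OF realizes_deflation[OF X]])
  have "a_kernel (Hom K (ob X (n+1)) W) (Hom K (ob X n) W) (\<lambda>g. g \<cdot> df X n) = {\<zero>\<^bsub>Hom K (ob X (n+1)) W\<^esub>}"
    (is "?ker W = ?zero W") if W: "W \<in> Ob K" for W
  proof (intro equalityI subsetI)
    fix g assume "g \<in> ?ker W"
    then have "g = \<zero>\<^bsub>Hom K (ob X (Suc n)) W\<^esub>"
      using W by - (rule epicD[OF m]; auto simp: a_kernel_def' hom_iff)
    then show "g \<in> ?zero W" by simp
  qed (use W in \<open>auto simp: a_kernel_def' hom_iff\<close>)
  then show ?thesis
    using realizes_exangle[OF X] by (simp add: n_cokernel_seq_def n_exangle_def)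
qed

lemma realizes_pull_kernel:
  assumes X: "realizes X \<delta>" and W: "W \<in> Ob K"
  shows "(\<lambda>g. df X n \<cdot> g) ` Mor K W (ob X n) =
    {g \<in> Mor K W (ob X (Suc n)). pull K E (ob X 0) g \<delta> = \<zero>\<^bsub>EOb E W (ob X 0)\<^esub>}"
  using realizes_exangle[OF X] W unfolding n_exangle_def by (simp add: a_kernel_def')

lemma realizes_push_kernel:
  assumes X: "realizes X \<delta>" and W: "W \<in> Ob K"
  shows "(\<lambda>g. g \<cdot> df X 0) ` Mor K (ob X 1) W =
    {g \<in> Mor K (ob X 0) W. push K E (ob X (Suc n)) g \<delta> = \<zero>\<^bsub>EOb E (ob X (Suc n)) W\<^esub>}"
  using realizes_exangle[OF X] W unfolding n_exangle_def by (simp add: a_kernel_def')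

text \<open>Exactness evaluated at the identity of X^n: the last differential lies in the image,
  hence in the kernel of pulling back \<delta>.\<close>

lemma realizes_pull_df:
  assumes X: "realizes X \<delta>"
  shows "pull K E (ob X 0) (df X n) \<delta> = \<zero>\<^bsub>EOb E (ob X n) (ob X 0)\<^esub>"
proof -
  have [simp]: "cx X" using X by (rule realizes_cx)
  have "df X n \<cdot> Idt K (ob X n) \<in> (\<lambda>g. df X n \<cdot> g) ` Mor K (ob X n) (ob X n)"
    using id_mor[of "ob X n"] by (intro imageI) simp
  then show ?thesis using realizes_pull_kernel[OF X, of "ob X n"] by simp
qed

lemma realizes_push_df:
  assumes X: "realizes X \<delta>"
  shows "push K E (ob X (Suc n)) (df X 0) \<delta> = \<zero>\<^bsub>EOb E (ob X (Suc n)) (ob X 1)\<^esub>"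
proof -
  have [simp]: "cx X" using X by (rule realizes_cx)
  have "Idt K (ob X 1) \<cdot> df X 0 \<in> (\<lambda>g. g \<cdot> df X 0) ` Mor K (ob X 1) (ob X 1)"
    using id_mor[of "ob X 1"] by (intro imageI) simp
  then show ?thesis using realizes_push_kernel[OF X, of "ob X 1"] by simp
qed

lemma realizes_lift:
  assumes X: "realizes X \<delta>" and "arr g" "cd g = ob X (Suc n)"
    "pull K E (ob X 0) g \<delta> = \<zero>\<^bsub>EOb E (dm g) (ob X 0)\<^esub>"
  obtains y where "arr y" "dm y = dm g" "cd y = ob X n" "df X n \<cdot> y = g"
proof -
  have [simp]: "cx X" using X by (rule realizes_cx)
  have "g \<in> (\<lambda>g. df X n \<cdot> g) ` Mor K (dm g) (ob X n)"
    unfolding realizes_pull_kernel[OF X dm_ob[OF assms(2)]] using assms(2-) by (simp add: hom_iff)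
  then obtain y where y: "y \<in> Mor K (dm g) (ob X n)" and g: "g = df X n \<cdot> y" by (rule imageE)
  have "arr y \<and> dm y = dm g \<and> cd y = ob X n" using y assms(2) by (simp add: hom_iff)
  then show ?thesis using that g[symmetric] by blast
qed

lemma realizes_extend:
  assumes X: "realizes X \<delta>" and "arr g" "dm g = ob X 0"
    "push K E (ob X (Suc n)) g \<delta> = \<zero>\<^bsub>EOb E (ob X (Suc n)) (cd g)\<^esub>"
  obtains y where "arr y" "dm y = ob X 1" "cd y = cd g" "y \<cdot> df X 0 = g"
proof -
  have [simp]: "cx X" using X by (rule realizes_cx)
  have "g \<in> (\<lambda>g. g \<cdot> df X 0) ` Mor K (ob X 1) (cd g)"
    unfolding realizes_push_kernel[OF X cd_ob[OF assms(2)]] using assms(2-) by (simp add: hom_iff)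
  then obtain y where y: "y \<in> Mor K (ob X 1) (cd g)" and g: "g = y \<cdot> df X 0" by (rule imageE)
  have "arr y \<and> dm y = ob X 1 \<and> cd y = cd g" using y assms(2) by (simp add: hom_iff)
  then show ?thesis using that g[symmetric] by blast
qed

lemma realizes_R0:
  assumes X: "realizes X \<delta>" and Y: "realizes Y \<rho>" and "arr a" "dm a = ob X 0" "cd a = ob Y 0"
    "arr c" "dm c = ob X (Suc n)" "cd c = ob Y (Suc n)"
    and "push K E (ob X (Suc n)) a \<delta> = pull K E (ob Y 0) c \<rho>"
  obtains f where "chain_map K n X Y f" "f 0 = a" "f (Suc n) = c"
proof -
  have "\<exists>f. chain_map K n X Y f \<and> f 0 = a \<and> f (n+1) = c"
    using R0[unfolded R0_def, rule_format, of "ob X 0" "ob Y 0" "ob X (Suc n)" "ob Y (Suc n)" \<delta> \<rho> X Y a c]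
      X Y assms by (simp add: realizes_def hom_iff)
  then show ?thesis using that by auto
qed

lemma EA2_realizes:
  assumes Y: "realizes Y \<rho>" and c: "arr c" "cd c = ob Y (Suc n)" "dm c = ob X (Suc n)"
    and X: "realizes X (pull K E (ob Y 0) c \<rho>)" "ob X 0 = ob Y 0"
  obtains f where "chain_map K n X Y f" "f 0 = Idt K (ob Y 0)" "f (Suc n) = c"
    "realizes (cone K n X Y f) (push K E (ob Y (Suc n)) (df X 0) \<rho>)"
proof -
  have [simp]: "cx X" "cx Y" using X Y by (blast intro: realizes_cx)+
  have XY: "X \<in> s (ob X (Suc n)) (ob Y 0) (pull K E (ob Y 0) c \<rho>)" "Y \<in> s (ob Y (Suc n)) (ob Y 0) \<rho>"
    using X(1) Y unfolding realizes_def X(2) by simp_all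
  have c': "c \<in> Mor K (ob X (Suc n)) (ob Y (Suc n))" using c by (simp add: hom_iff)
  obtain f where f: "chain_map K n X Y f" "f 0 = Idt K (ob Y 0)" "f (n+1) = c"
      "cone K n X Y f \<in> s (ob Y (Suc n)) (ob X 1) (push K E (ob Y (Suc n)) (df X 0) \<rho>)"
    using EA2[unfolded EA2_def, rule_format, OF _ _ _ realizes_ext[OF Y] c' XY] by auto
  have "realizes (cone K n X Y f) (push K E (ob Y (Suc n)) (df X 0) \<rho>)"
    using realizes_ext[OF Y] X(2) by (intro s_ends(3)[OF _ _ _ f(4)]) simp_all
  then show ?thesis using that f(1-3) by simp
qed

text \<open>Exactness of \<open>K(C, D) \<rightarrow> E(C, B) \<rightarrow> E(C, Y\<^sup>1)\<close>: realize the extension of \<open>C \<oplus> D\<close> by \<open>B\<close> with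
  components \<open>\<theta>\<close> and \<open>\<rho>\<close>; by (EA2) for \<open>D \<rightarrow> C \<oplus> D\<close> the cone carries the zero extension, so the
  inclusion of \<open>C\<close> factors through its last differential.\<close>

lemma push_df_kernel:
  assumes Y: "realizes Y \<rho>" and C: "C \<in> Ob K" and \<theta>: "\<theta> \<in> Ex E C (ob Y 0)"
    and \<theta>0: "push K E C (df Y 0) \<theta> = \<zero>\<^bsub>EOb E C (ob Y 1)\<^esub>"
  obtains x where "arr x" "dm x = C" "cd x = ob Y (Suc n)" "pull K E (ob Y 0) x \<rho> = \<theta>"
proof -
  let ?B = "ob Y 0" and ?D = "ob Y (Suc n)" and ?S = "Sum K C (ob Y (Suc n))"
  have [simp]: "cx Y" using Y by (rule realizes_cx)
  note [simp] = C \<theta> realizes_ext[OF Y]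
  define \<tau>1 \<tau>2 where "\<tau>1 = pull K E ?B (Pr1 K C ?D) \<theta>" and "\<tau>2 = pull K E ?B (Pr2 K C ?D) \<rho>"
  define \<tau> where "\<tau> = eadd ?S ?B \<tau>1 \<tau>2"
  have \<tau>12 [simp]: "\<tau>1 \<in> Ex E ?S ?B" "\<tau>2 \<in> Ex E ?S ?B"
    by (simp_all add: \<tau>1_def \<tau>2_def)
  have \<tau> [simp]: "\<tau> \<in> Ex E ?S ?B" by (simp add: \<tau>_def)
  have in2: "pull K E ?B (In2 K C ?D) \<tau> = \<rho>"
    by (simp add: \<tau>_def pull_eadd) (simp add: \<tau>1_def \<tau>2_def pull_pull)
  have in1: "pull K E ?B (In1 K C ?D) \<tau> = \<theta>"
    by (simp add: \<tau>_def pull_eadd) (simp add: \<tau>1_def \<tau>2_def pull_pull)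
  have \<tau>0: "push K E ?S (df Y 0) \<tau> = \<zero>\<^bsub>EOb E ?S (ob Y 1)\<^esub>"
    using \<theta>0 realizes_push_df[OF Y]
    by (simp add: \<tau>_def push_eadd) (simp add: \<tau>1_def \<tau>2_def push_pull)
  obtain Z where Z: "realizes Z \<tau>" "ob Z 0 = ?B" "ob Z (Suc n) = ?S"
    using realizes_exists[of ?S ?B \<tau>] by auto
  have [simp]: "cx Z" using Z(1) by (rule realizes_cx)
  \<comment> \<open>Restricting \<tau> along the second injection gives back \<rho>, so
    \<open>Y\<close> itself can serve as the source in (EA2).\<close>
  have Y': "realizes Y (pull K E (ob Z 0) (In2 K C ?D) \<tau>)" using Y in2 Z(2) by simp
  obtain f where f: "chain_map K n Y Z f" "f (Suc n) = In2 K C ?D"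
      "realizes (cone K n Y Z f) (push K E (ob Z (Suc n)) (df Y 0) \<tau>)"
    by (rule EA2_realizes[OF Z(1) _ _ _ Y']) (simp_all add: Z)
  then have M: "realizes (cone K n Y Z f) \<zero>\<^bsub>EOb E ?S (ob Y 1)\<^esub>"
    using \<tau>0 Z(3) by simp
  have M_ob: "ob (cone K n Y Z f) 0 = ob Y 1" "ob (cone K n Y Z f) n = Sum K ?D (ob Z n)"
      "ob (cone K n Y Z f) (Suc n) = ?S"
    using cone_ob[where X=Y and Y=Z and f=f] n_pos Z by simp_all
  obtain w where w: "arr w" "dm w = C" "cd w = Sum K ?D (ob Z n)"
      "df (cone K n Y Z f) n \<cdot> w = In1 K C ?D"
    using realizes_lift[OF M, of "In1 K C ?D"] M_ob by auto
  define x where "x = Pr1 K ?D (ob Z n) \<cdot> w"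
  define y where "y = Pr2 K ?D (ob Z n) \<cdot> w"
  have x [simp]: "arr x" "dm x = C" "cd x = ?D" and y [simp]: "arr y" "dm y = C" "cd y = ob Z n"
    using w by (simp_all add: x_def y_def)
  \<comment> \<open>Written out, the lift expresses the first injection through the second one and
    the last differential of \<open>Z\<close>. Pulling \<tau> back along both sides gives \<theta>
    on the left; on the right the differential contributes zero and \<open>x\<close> pulls back
    \<rho>.\<close>
  have "In1 K C ?D = In2 K C ?D \<cdot> x [+] df Z n \<cdot> y"
    using w(1-3) Z f(2) n_pos unfolding w(4)[symmetric] x_def y_def
    by (simp add: cone_df row_mor_def)
  then have "\<theta> = pull K E ?B (In2 K C ?D \<cdot> x [+] df Z n \<cdot> y) \<tau>"
    using in1 by simp
  also have "\<dots> = eadd C ?B (pull K E ?B x (pull K E ?B (In2 K C ?D) \<tau>))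
      (pull K E ?B y (pull K E ?B (df Z n) \<tau>))"
    using Z by (simp add: pull_padd pull_pull)
  also have "\<dots> = pull K E ?B x \<rho>"
    using realizes_pull_df[OF Z(1)] Z by (simp add: in2)
  finally have "pull K E ?B x \<rho> = \<theta>" ..
  then show ?thesis using that[OF x] by simp
qed

section \<open>Chain maps as morphisms of extensions\<close>

lemma chain_map_ext:
  assumes X: "realizes X \<delta>" and Y: "realizes Y \<rho>" and f: "chain_map K n X Y f"
  shows "push K E (ob X (Suc n)) (f 0) \<delta> = pull K E (ob Y 0) (f (Suc n)) \<rho>"
proof -
  let ?C = "ob X (Suc n)" and ?A = "ob X 0" and ?B = "ob Y 0"
  have cx [simp]: "cx X" "cx Y" using realizes_cx X Y by blast+
  note [simp] = realizes_ext[OF X] realizes_ext[OF Y] chain_mapD[OF f cx]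
  \<comment> \<open>By the first square d_Y f^0 = f^1 d_X, and pushing \<delta> along the first
    differential of \<open>X\<close> already gives zero.\<close>
  have "push K E ?C (df Y 0) (push K E ?C (f 0) \<delta>) = push K E ?C (f 1 \<cdot> df X 0) \<delta>"
    by (simp add: push_push)
  also have "\<dots> = push K E ?C (f 1) (push K E ?C (df X 0) \<delta>)"
    by (simp add: push_push del: chain_mapD(4)[OF f cx])
  finally have "push K E ?C (df Y 0) (push K E ?C (f 0) \<delta>) = \<zero>\<^bsub>EOb E ?C (ob Y 1)\<^esub>"
    using realizes_push_df[OF X] by simp
  then obtain x where x [simp]: "arr x" "dm x = ?C" "cd x = ob Y (Suc n)"
      and x_eq: "pull K E ?B x \<rho> = push K E ?C (f 0) \<delta>"
    using push_df_kernel[OF Y, of ?C "push K E ?C (f 0) \<delta>"] by auto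
  obtain u where u: "chain_map K n X Y u" "u 0 = f 0" "u (Suc n) = x"
    using realizes_R0[OF X Y, of "f 0" x] x_eq by auto
  obtain h where h: "nullhtpy X Y (\<lambda>i. u i [+] [-] f i) h"
    using chain_map_htpy_right[OF realizes_n_cokernel[OF X] cx(2) u(1) f u(2)] by auto
  note [simp] = nullhtpyD(1-3)[OF h cx]
  \<comment> \<open>The homotopy in top degree: \<open>x\<close> and f^(n+1) differ by a morphism
    through \<open>df Y n\<close>, along which \<rho> pulls back to zero.\<close>
  have "x = f (Suc n) [+] df Y n \<cdot> h n"
    using u(3) by (simp flip: nullhtpyD(6)[OF h cx] add: padd_left_comm)
  then have "pull K E ?B x \<rho> = eadd ?C ?B (pull K E ?B (f (Suc n)) \<rho>) (pull K E ?B (h n) (pull K E ?B (df Y n) \<rho>))"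
    by (simp add: pull_padd pull_pull)
  then show ?thesis using realizes_pull_df[OF Y] x_eq by simp
qed

lemma conf_E:
  assumes "X \<in> conf"
  obtains \<delta> where "realizes X \<delta>"
  using assms conf_iff[of X] by auto

lemma EA2_op_realizes:
  assumes X: "realizes X \<delta>" and a: "arr a" "dm a = ob X 0" "cd a = ob Y 0"
    and Y: "realizes Y (push K E (ob X (Suc n)) a \<delta>)" "ob Y (Suc n) = ob X (Suc n)"
  obtains f where "chain_map K n X Y f" "f 0 = a" "f (Suc n) = Idt K (ob X (Suc n))"
    "realizes (cocone K n X Y f) (pull K E (ob X 0) (df Y n) \<delta>)"
proof -
  have [simp]: "cx X" "cx Y" using X Y by (blast intro: realizes_cx)+
  have XY: "Y \<in> s (ob X (Suc n)) (ob Y 0) (push K E (ob X (Suc n)) a \<delta>)" "X \<in> s (ob X (Suc n)) (ob X 0) \<delta>"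
    using Y(1) X unfolding realizes_def Y(2) by simp_all
  have a': "a \<in> Mor K (ob X 0) (ob Y 0)" using a by (simp add: hom_iff)
  obtain f where f: "chain_map K n X Y f" "f 0 = a" "f (n+1) = Idt K (ob X (Suc n))"
      "cocone K n X Y f \<in> s (ob Y n) (ob X 0) (pull K E (ob X 0) (df Y n) \<delta>)"
    using EA2_op[unfolded EA2_op_def, rule_format, OF _ _ _ realizes_ext[OF X] a' XY(2,1)] by auto
  have "realizes (cocone K n X Y f) (pull K E (ob X 0) (df Y n) \<delta>)"
    using realizes_ext[OF X] Y(2) by (intro s_ends(3)[OF _ _ _ f(4)]) simp_all
  then show ?thesis using that f(1-3) by simp
qed

section \<open>The axioms of an n-exact category\<close>

lemma conf_pullback:
  assumes Y: "Y \<in> conf" and c: "arr c" "cd c = ob Y (Suc n)"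
  obtains X f where "X \<in> conf" "ob X 0 = ob Y 0" "ob X (Suc n) = dm c"
    "chain_map K n X Y f" "f 0 = Idt K (ob Y 0)" "f (Suc n) = c"
proof -
  obtain \<rho> where Y: "realizes Y \<rho>" using Y by (rule conf_E)
  have [simp]: "cx Y" using Y by (rule realizes_cx)
  obtain X where X: "realizes X (pull K E (ob Y 0) c \<rho>)" "ob X 0 = ob Y 0" "ob X (Suc n) = dm c"
    by (rule realizes_exists[of "dm c" "ob Y 0" "pull K E (ob Y 0) c \<rho>"]) (use c realizes_ext[OF Y] in simp_all)
  show ?thesis
    using EA2_realizes[OF Y c X(3)[symmetric] X(1,2)] that[OF realizes_conf[OF X(1)] X(2,3)] by blast
qed

lemma conf_pushout:
  assumes X: "X \<in> conf" and a: "arr a" "dm a = ob X 0"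
  obtains Y f where "Y \<in> conf" "ob Y 0 = cd a" "ob Y (Suc n) = ob X (Suc n)"
    "chain_map K n X Y f" "f 0 = a" "f (Suc n) = Idt K (ob X (Suc n))"
proof -
  obtain \<delta> where X: "realizes X \<delta>" using X by (rule conf_E)
  have [simp]: "cx X" using X by (rule realizes_cx)
  obtain Y where Y: "realizes Y (push K E (ob X (Suc n)) a \<delta>)" "ob Y 0 = cd a" "ob Y (Suc n) = ob X (Suc n)"
    by (rule realizes_exists[of "ob X (Suc n)" "cd a" "push K E (ob X (Suc n)) a \<delta>"])
      (use a realizes_ext[OF X] in simp_all)
  show ?thesis
    using EA2_op_realizes[OF X a Y(2)[symmetric] Y(1,3)] that[OF realizes_conf[OF Y(1)] Y(2,3)] by blast
qed

lemma cone_conf: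
  assumes X: "X \<in> conf" and Y: "Y \<in> conf" and ob0: "ob X 0 = ob Y 0"
    and f: "chain_map K n X Y f" "f 0 = Idt K (ob Y 0)"
  shows "cone K n X Y f \<in> conf"
proof -
  obtain \<delta> where X: "realizes X \<delta>" using X by (rule conf_E)
  obtain \<rho> where Y: "realizes Y \<rho>" using Y by (rule conf_E)
  have cx [simp]: "cx X" "cx Y" using X Y by (blast intro: realizes_cx)+
  note [simp] = chain_mapD(1-3)[OF f(1) cx]
  \<comment> \<open>With the identity in degree 0, the morphism of extensions says that \<delta> is
    the pullback of \<rho>; thus \<open>X\<close> has the form demanded by (EA2).\<close>
  have "\<delta> = pull K E (ob Y 0) (f (Suc n)) \<rho>"
    using chain_map_ext[OF X Y f(1)] realizes_ext[OF X] ob0 by (simp add: f(2))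
  then have X': "realizes X (pull K E (ob Y 0) (f (Suc n)) \<rho>)" using X by simp
  obtain g where g: "chain_map K n X Y g" "g 0 = Idt K (ob Y 0)"
      "realizes (cone K n X Y g) (push K E (ob Y (Suc n)) (df X 0) \<rho>)"
    by (rule EA2_realizes[OF Y _ _ _ X' ob0]) simp_all
  obtain h where h: "nullhtpy X Y (\<lambda>i. g i [+] [-] f i) h" "h 0 = \<zero>\<^bsub>Hom K (ob X 1) (ob Y 0)\<^esub>"
    using chain_map_htpy_right[OF realizes_n_cokernel[OF X] cx(2) g(1) f(1)] f(2) g(2) by auto
  have ends: "ob (cone K n X Y l) 0 = ob X 1" "ob (cone K n X Y l) (Suc n) = ob Y (Suc n)" for l
    by (simp_all add: cone_ob)
  have "realizes (cone K n X Y f) (push K E (ob Y (Suc n)) (df X 0) \<rho>)"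
    using homotopy_equiv_cone[OF g(1) f(1) cx n_pos h] cone_complex[OF f(1) cx n_pos]
    by (intro realizes_closed[OF g(3)]) (simp_all add: ends complexes_ends_def)
  then show ?thesis by (rule realizes_conf)
qed

lemma cocone_conf:
  assumes X: "X \<in> conf" and Y: "Y \<in> conf" and obn: "ob Y (Suc n) = ob X (Suc n)"
    and f: "chain_map K n X Y f" "f (Suc n) = Idt K (ob X (Suc n))"
  shows "cocone K n X Y f \<in> conf"
proof -
  obtain \<delta> where X: "realizes X \<delta>" using X by (rule conf_E)
  obtain \<rho> where Y: "realizes Y \<rho>" using Y by (rule conf_E)
  have cx [simp]: "cx X" "cx Y" using X Y by (blast intro: realizes_cx)+
  note [simp] = chain_mapD(1-3)[OF f(1) cx]
  have "\<rho> = push K E (ob X (Suc n)) (f 0) \<delta>"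
    using chain_map_ext[OF X Y f(1)] realizes_ext[OF Y] obn by (simp add: f(2))
  then have Y': "realizes Y (push K E (ob X (Suc n)) (f 0) \<delta>)" using Y by simp
  obtain g where g: "chain_map K n X Y g" "g (Suc n) = Idt K (ob X (Suc n))"
      "realizes (cocone K n X Y g) (pull K E (ob X 0) (df Y n) \<delta>)"
    by (rule EA2_op_realizes[OF X _ _ _ Y' obn]) simp_all
  \<comment> \<open>The two maps agree in top degree, so the homotopy comes from the kernel property
    of \<open>Y\<close> and vanishes at the top.\<close>
  obtain h where h: "nullhtpy X Y (\<lambda>i. g i [+] [-] f i) h" "h n = \<zero>\<^bsub>Hom K (ob X (Suc n)) (ob Y n)\<^esub>"
    using chain_map_htpy_left[OF realizes_n_kernel[OF Y] cx(1) g(1) f(1)] f(2) g(2) by auto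
  have ends: "ob (cocone K n X Y l) 0 = ob X 0" "ob (cocone K n X Y l) (Suc n) = ob Y n" for l
    by (simp_all add: cocone_ob)
  have "realizes (cocone K n X Y f) (pull K E (ob X 0) (df Y n) \<delta>)"
    using homotopy_equiv_cocone[OF g(1) f(1) cx n_pos h] cocone_complex[OF f(1) cx n_pos]
    by (intro realizes_closed[OF g(3)]) (simp_all add: ends complexes_ends_def)
  then show ?thesis by (rule realizes_conf)
qed

section \<open>Recognising conflations among n-exact sequences\<close>

text \<open>A correction of an end component by a homotopy is invisible to the extension, which dies
  along the last differential; \<open>push_padd_df\<close> is the same at the other end.\<close>

lemma pull_padd_df:
  assumes X: "realizes X \<delta>" and u: "arr u" "dm u = dm b" "cd u = ob X (Suc n)"
    and b: "arr b" "cd b = ob X n"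
  shows "pull K E (ob X 0) (u [+] df X n \<cdot> b) \<delta> = pull K E (ob X 0) u \<delta>"
proof -
  have [simp]: "cx X" using X by (rule realizes_cx)
  note [simp] = u b realizes_ext[OF X]
  have "pull K E (ob X 0) (df X n \<cdot> b) \<delta> = pull K E (ob X 0) b (pull K E (ob X 0) (df X n) \<delta>)"
    by (simp add: pull_pull)
  then show ?thesis by (simp add: pull_padd realizes_pull_df[OF X])
qed

lemma push_padd_df:
  assumes X: "realizes X \<delta>" and u: "arr u" "cd u = cd a" "dm u = ob X 0"
    and a: "arr a" "dm a = ob X 1"
  shows "push K E (ob X (Suc n)) (u [+] a \<cdot> df X 0) \<delta> = push K E (ob X (Suc n)) u \<delta>"
proof -
  have [simp]: "cx X" using X by (rule realizes_cx)
  note [simp] = u a realizes_ext[OF X]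
  have "push K E (ob X (Suc n)) (a \<cdot> df X 0) \<delta> = push K E (ob X (Suc n)) a (push K E (ob X (Suc n)) (df X 0) \<delta>)"
    by (simp add: push_push)
  then show ?thesis by (simp add: push_padd realizes_push_df[OF X])
qed

text \<open>An \<open>n\<close>-exact \<open>Y\<close> homotopy equivalent to a conflation \<open>X\<close> is a conflation, even if the equivalence
  changes the end terms: it is compared with a realization \<open>Z\<close> of the transported extension, and both
  composites between \<open>Y\<close> and \<open>Z\<close> can be corrected by homotopies to be the identity at the ends.\<close>

lemma conf_transport:
  assumes X: "realizes X \<delta>" and Y: "n_cokernel_seq K n Y"
    and f: "chain_map K n X Y f" and g: "chain_map K n Y X g"
    and a: "arr a" "dm a = ob X 1" "cd a = ob X 0" "g 0 \<cdot> f 0 = Idt K (ob X 0) [+] a \<cdot> df X 0"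
    and b: "arr b" "dm b = ob X (Suc n)" "cd b = ob X n"
      "g (Suc n) \<cdot> f (Suc n) = Idt K (ob X (Suc n)) [+] df X n \<cdot> b"
    and a': "arr a'" "dm a' = ob Y 1" "cd a' = ob Y 0" "f 0 \<cdot> g 0 = Idt K (ob Y 0) [+] a' \<cdot> df Y 0"
    and b': "arr b'" "dm b' = ob Y (Suc n)" "cd b' = ob Y n"
      "f (Suc n) \<cdot> g (Suc n) = Idt K (ob Y (Suc n)) [+] df Y n \<cdot> b'"
  shows "Y \<in> conf"
proof -
  let ?A = "ob X 0" and ?B = "ob Y 0" and ?C = "ob X (Suc n)" and ?D = "ob Y (Suc n)"
  have cx: "cx X" "cx Y" using realizes_cx[OF X] Y by (simp_all add: n_cokernel_seq_iff)
  note [simp] = cx a(1-3) b(1-3) a'(1-3) b'(1-3) realizes_ext[OF X]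
    chain_mapD(1-3)[OF f cx] chain_mapD(1-3)[OF g cx(2,1)]
  \<comment> \<open>The extension is moved to the ends of \<open>Y\<close> in two stages: back along
    g^(n+1), then forward along f^0.\<close>
  define \<gamma> where "\<gamma> = pull K E ?A (g (Suc n)) \<delta>"
  define \<rho> where "\<rho> = push K E ?D (f 0) \<gamma>"
  have \<gamma> [simp]: "\<gamma> \<in> Ex E ?D ?A" by (simp add: \<gamma>_def)
  have \<rho> [simp]: "\<rho> \<in> Ex E ?D ?B" by (simp add: \<rho>_def)
  have "pull K E ?A (f (Suc n)) \<gamma> = \<delta>"
    using pull_padd_df[OF X, of "Idt K ?C" b] by (simp add: \<gamma>_def pull_pull b(4))
  then have f_ext: "push K E ?C (f 0) \<delta> = pull K E ?B (f (Suc n)) \<rho>"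
    unfolding \<rho>_def using push_pull[of "f 0" "f (Suc n)" ?A ?B ?D ?C \<gamma>] by simp
  have "push K E ?D (g 0) \<rho> = push K E ?D (g 0 \<cdot> f 0) \<gamma>"
    by (simp add: \<rho>_def push_push)
  also have "\<dots> = pull K E ?A (g (Suc n)) (push K E ?C (Idt K ?A [+] a \<cdot> df X 0) \<delta>)"
    unfolding \<gamma>_def a(4) by (rule push_pull) simp_all
  also have "\<dots> = pull K E ?A (g (Suc n)) \<delta>"
    using push_padd_df[OF X, of "Idt K ?A" a] by simp
  finally have g_ext: "push K E ?D (g 0) \<rho> = pull K E ?A (g (Suc n)) \<delta>" .
  obtain Z where Z: "realizes Z \<rho>" "ob Z 0 = ?B" "ob Z (Suc n) = ?D"
    by (rule realizes_exists[of ?D ?B \<rho>]) simp_all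
  have cxZ [simp]: "cx Z" using Z(1) by (rule realizes_cx)
  \<comment> \<open>The end components of \<open>f\<close> and of \<open>g\<close> are morphisms of
    extensions between \<delta> and \<rho>, so (R0) lifts them to maps between \<open>X\<close> and
    \<open>Z\<close>.\<close>
  obtain p where p: "chain_map K n X Z p" "p 0 = f 0" "p (Suc n) = f (Suc n)"
    by (rule realizes_R0[OF X Z(1), of "f 0" "f (Suc n)"]) (simp_all add: Z f_ext)
  obtain q where q: "chain_map K n Z X q" "q 0 = g 0" "q (Suc n) = g (Suc n)"
    by (rule realizes_R0[OF Z(1) X, of "g 0" "g (Suc n)"]) (simp_all add: Z g_ext)
  \<comment> \<open>Next, \<open>df Y n\<close> is lifted along \<open>df Z n\<close> to
    \<open>y\<close>, and \<open>df Y 0\<close> extended along \<open>df Z 0\<close> to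
    \<open>w\<close>. This turns end corrections written with differentials of \<open>Y\<close> into
    ones written with those of \<open>Z\<close>.\<close>
  have "pull K E ?B (df Y n) \<rho> = push K E (ob Y n) (f 0) (pull K E ?A (df Y n) \<gamma>)"
    unfolding \<rho>_def by (rule push_pull[symmetric]) simp_all
  also have "pull K E ?A (df Y n) \<gamma> = pull K E ?A (df X n \<cdot> g n) \<delta>"
    unfolding \<gamma>_def by (simp add: pull_pull chain_mapD(4)[OF g cx(2,1)])
  also have "\<dots> = pull K E ?A (g n) (pull K E ?A (df X n) \<delta>)"
    by (simp add: pull_pull)
  also have "\<dots> = \<zero>\<^bsub>EOb E (ob Y n) ?A\<^esub>"
    by (simp add: realizes_pull_df[OF X])
  finally have "pull K E ?B (df Y n) \<rho> = \<zero>\<^bsub>EOb E (ob Y n) ?B\<^esub>" by simp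
  then obtain y where y: "arr y" "dm y = ob Y n" "cd y = ob Z n" "df Z n \<cdot> y = df Y n"
    using realizes_lift[OF Z(1), of "df Y n"] Z(2,3) by auto
  have "push K E ?D (df Y 0) \<rho> = push K E ?D (f 1 \<cdot> df X 0) \<gamma>"
    unfolding \<rho>_def by (simp add: push_push chain_mapD(4)[OF f cx])
  also have "\<dots> = push K E ?D (f 1) (pull K E (ob X 1) (g (Suc n)) (push K E ?C (df X 0) \<delta>))"
    unfolding \<gamma>_def by (simp add: push_push flip: push_pull)
  also have "\<dots> = \<zero>\<^bsub>EOb E ?D (ob Y 1)\<^esub>"
    by (simp add: realizes_push_df[OF X])
  finally obtain w where w: "arr w" "dm w = ob Z 1" "cd w = ob Y 1" "w \<cdot> df Z 0 = df Y 0"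
    using realizes_extend[OF Z(1), of "df Y 0"] Z(2,3) by auto
  \<comment> \<open>The composite of \<open>g\<close> and \<open>p\<close> has the end components
    f^0 g^0 and f^(n+1) g^(n+1). The first correction involves the source \<open>Y\<close> already;
    the second is moved to the target \<open>Z\<close> by \<open>y\<close>.\<close>
  obtain v where v: "chain_map K n Y Z v" "v 0 = Idt K ?B" "v (Suc n) = Idt K ?D"
  proof (rule chain_map_adjust_ends[OF n_pos cx(2) cxZ chain_map_comp[OF g p(1) cx(2,1) cxZ],
        of a' "y \<cdot> b'" "Idt K ?B" "Idt K ?D"])
    show "p (Suc n) \<cdot> g (Suc n) = Idt K ?D [+] df Z n \<cdot> (y \<cdot> b')"
      using y Z by (simp add: p(3) b'(4) flip: cmp_assoc)
  qed (use y Z in \<open>simp_all add: p(2) a'(4)\<close>)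
  obtain u where u: "chain_map K n Z Y u" "u 0 = Idt K ?B" "u (Suc n) = Idt K ?D"
  proof (rule chain_map_adjust_ends[OF n_pos cxZ cx(2) chain_map_comp[OF q(1) f cxZ cx],
        of "a' \<cdot> w" b' "Idt K ?B" "Idt K ?D"])
    show "f 0 \<cdot> q 0 = Idt K ?B [+] (a' \<cdot> w) \<cdot> df Z 0"
      using w Z by (simp add: q(2) a'(4))
  qed (use w Z in \<open>simp_all add: q(3) b'(4)\<close>)
  have ends: "Z \<in> complexes_ends K n ?B ?D" "Y \<in> complexes_ends K n ?B ?D"
    using Z(2,3) by (simp_all add: complexes_ends_def)
  have "homotopy_equiv K n ?B ?D Z Y"
    by (rule homotopy_equiv_n_exact[OF realizes_n_cokernel[OF Z(1)] Y ends, of u v])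
      (use u v in \<open>simp_all add: chain_map_ends_def\<close>)
  then have "realizes Y \<rho>"
    using realizes_closed[OF Z(1)] ends(2) Z(2,3) by simp
  then show ?thesis by (rule realizes_conf)
qed


text \<open>The square and its inverse extend to chain maps in both directions, whose composites are
  identities in degrees \<open>k\<close> and \<open>Suc k\<close>. By \<open>htpy_ends\<close> the
  outer components are then identities up to the corrections that \<open>conf_transport\<close>
  accepts.\<close>

lemma conf_square_iso:
  assumes X: "X \<in> conf" and Y: "n_kernel_seq K n Y" "n_cokernel_seq K n Y" and k: "k \<le> n"
    and a: "arr a" "dm a = ob X k" "cd a = ob Y k" and b: "arr b" "dm b = ob X (Suc k)" "cd b = ob Y (Suc k)"
    and a': "arr a'" "dm a' = ob Y k" "cd a' = ob X k" "a' \<cdot> a = Idt K (ob X k)" "a \<cdot> a' = Idt K (ob Y k)"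
    and b': "arr b'" "dm b' = ob Y (Suc k)" "cd b' = ob X (Suc k)"
      "b' \<cdot> b = Idt K (ob X (Suc k))" "b \<cdot> b' = Idt K (ob Y (Suc k))"
    and ab: "b \<cdot> df X k = df Y k \<cdot> a"
  shows "Y \<in> conf"
proof -
  obtain \<delta> where X: "realizes X \<delta>" using X by (rule conf_E)
  note X' = realizes_n_kernel[OF X] realizes_n_cokernel[OF X]
  have cx [simp]: "cx X" "cx Y" using realizes_cx[OF X] Y by (simp_all add: n_cokernel_seq_iff)
  note [simp] = k a(1-3) b(1-3) a'(1-3) b'(1-3)
  have "b' \<cdot> df Y k = (b' \<cdot> df Y k) \<cdot> (a \<cdot> a')" by (simp add: a'(5))
  also have "\<dots> = b' \<cdot> ((df Y k \<cdot> a) \<cdot> a')" by simp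
  also have "\<dots> = (b' \<cdot> b) \<cdot> (df X k \<cdot> a')" unfolding ab[symmetric] by simp
  finally have ab': "b' \<cdot> df Y k = df X k \<cdot> a'" by (simp add: b'(4) del: cmp_assoc)
  obtain f where f: "chain_map K n X Y f" "f k = a" "f (Suc k) = b"
    by (rule extend_square[OF X'(2) Y(1) k a b ab])
  obtain g where g: "chain_map K n Y X g" "g k = a'" "g (Suc k) = b'"
    by (rule extend_square[OF Y(2) X'(1) k a'(1-3) b'(1-3) ab'])
  have gf: "g k \<cdot> f k = Idt K (ob X k)" "g (Suc k) \<cdot> f (Suc k) = Idt K (ob X (Suc k))"
    and fg: "f k \<cdot> g k = Idt K (ob Y k)" "f (Suc k) \<cdot> g (Suc k) = Idt K (ob Y (Suc k))"
    using a' b' f g by simp_all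
  show ?thesis
  proof (rule htpy_ends[OF X'(2,1) k chain_map_comp[OF f(1) g(1) cx cx(1)] gf])
    fix u v
    assume uv: "arr u" "dm u = ob X 1" "cd u = ob X 0" "g 0 \<cdot> f 0 = Idt K (ob X 0) [+] u \<cdot> df X 0"
      "arr v" "dm v = ob X (Suc n)" "cd v = ob X n"
      "g (Suc n) \<cdot> f (Suc n) = Idt K (ob X (Suc n)) [+] df X n \<cdot> v"
    show ?thesis
      by (rule htpy_ends[OF Y(2,1) k chain_map_comp[OF g(1) f(1) cx(2,1) cx(2)] fg])
        (rule conf_transport[OF X Y(2) f(1) g(1) uv])
  qed
qed

text \<open>A conflation with the same first differential has the same first two objects, because a
  morphism determines its ends; the identities on them form the required square.\<close>

lemma conf_of_inflation:
  assumes Y: "n_kernel_seq K n Y" "n_cokernel_seq K n Y" and infl: "inflation K E s (df Y 0)"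
  shows "Y \<in> conf"
proof -
  obtain Z where Z: "Z \<in> conf" "df Y 0 = df Z 0"
    using infl unfolding adm_mono_def by (elim bexE, intro that)
  obtain \<delta> where "realizes Z \<delta>" using Z(1) by (rule conf_E)
  then have cx [simp]: "cx Z" "cx Y" using realizes_cx Y by (auto simp: n_cokernel_seq_iff)
  have ob: "ob Y 0 = ob Z 0" "ob Y (Suc 0) = ob Z (Suc 0)"
    using arg_cong[OF Z(2), of dm] arg_cong[OF Z(2), of cd] by simp_all
  show ?thesis
    by (rule conf_square_iso[OF Z(1) Y, of 0 "Idt K (ob Z 0)" "Idt K (ob Z (Suc 0))" "Idt K (ob Z 0)"
        "Idt K (ob Z (Suc 0))"]) (simp_all add: ob Z(2))
qed

lemma conf_of_deflation:
  assumes Y: "n_kernel_seq K n Y" "n_cokernel_seq K n Y" and defl: "deflation K E s n (df Y n)"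
  shows "Y \<in> conf"
proof -
  obtain Z where Z: "Z \<in> conf" "df Y n = df Z n"
    using defl unfolding adm_epi_def by (elim bexE, intro that)
  obtain \<delta> where "realizes Z \<delta>" using Z(1) by (rule conf_E)
  then have cx [simp]: "cx Z" "cx Y" using realizes_cx Y by (auto simp: n_cokernel_seq_iff)
  have ob: "ob Y n = ob Z n" "ob Y (Suc n) = ob Z (Suc n)"
    using arg_cong[OF Z(2), of dm] arg_cong[OF Z(2), of cd] by simp_all
  show ?thesis
    by (rule conf_square_iso[OF Z(1) Y, of n "Idt K (ob Z n)" "Idt K (ob Z (Suc n))" "Idt K (ob Z n)"
        "Idt K (ob Z (Suc n))"]) (simp_all add: ob Z(2))
qed

section \<open>Trivial conflations and isomorphisms\<close>

lemma triv_left_realizes: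
  assumes A [simp]: "A \<in> Ob K"
  shows "realizes (triv_left K A) \<zero>\<^bsub>EOb E (Zob K) A\<^esub>"
proof -
  have "cx (triv_left K A)"
    by (rule cxI) (auto simp: triv_left_def)
  then have "triv_left K A \<in> complexes_ends K n A (Zob K)"
    using n_pos by (simp add: complexes_ends_def) (simp add: triv_left_def)
  then have "triv_left K A \<in> s (Zob K) A \<zero>\<^bsub>EOb E (Zob K) A\<^esub>"
    using R2 A homotopy_equiv_refl unfolding R2_def by (simp add: hclass_def)
  then show ?thesis by (intro s_ends(3)) simp_all
qed

lemma triv_right_realizes:
  assumes A [simp]: "A \<in> Ob K"
  shows "realizes (triv_right K n A) \<zero>\<^bsub>EOb E A (Zob K)\<^esub>"
proof -
  have "cx (triv_right K n A)"
    by (rule cxI) (auto simp: triv_right_def)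
  then have "triv_right K n A \<in> complexes_ends K n (Zob K) A"
    using n_pos by (simp add: complexes_ends_def) (simp add: triv_right_def)
  then have "triv_right K n A \<in> s A (Zob K) \<zero>\<^bsub>EOb E A (Zob K)\<^esub>"
    using R2 A homotopy_equiv_refl unfolding R2_def by (simp add: hclass_def)
  then show ?thesis by (intro s_ends(3)) simp_all
qed

text \<open>The complex with \<open>a\<close> as first differential and zeros afterwards is
  isomorphic to the trivial one on \<open>dm a\<close>. Only the term in degree 1 is changed, so the
  ends stay fixed and (R2) applies.\<close>

lemma iso_inflation:
  assumes a [simp]: "arr a" and a': "arr a'" "dm a' = cd a" "cd a' = dm a"
    and inv: "a' \<cdot> a = Idt K (dm a)" "a \<cdot> a' = Idt K (cd a)"
  shows "inflation K E s a"
proof -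
  note [simp] = a' inv
  let ?L = "triv_left K (dm a)"
  define t where "t i = (if i = 0 then dm a else if i = 1 then cd a else Zob K)" for i :: nat
  define T where "T = \<lparr> ob = t, df = (\<lambda>i. if i = 0 then a else \<zero>\<^bsub>Hom K (t i) (t (Suc i))\<^esub>) \<rparr>"
  have T: "ob T i = t i" "df T i = (if i = 0 then a else \<zero>\<^bsub>Hom K (t i) (t (Suc i))\<^esub>)" for i
    by (simp_all add: T_def)
  have L: "ob ?L i = (if i \<le> 1 then dm a else Zob K)"
      "df ?L i = (if i = 0 then Idt K (dm a) else \<zero>\<^bsub>Hom K (ob ?L i) (ob ?L (Suc i))\<^esub>)" for i
    by (simp_all add: triv_left_def)
  have t_ob [simp]: "t i \<in> Ob K" "ob ?L i \<in> Ob K" for i by (simp_all add: t_def L(1))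
  have cx: "cx ?L" "cx T"
  proof -
    show "cx ?L" using triv_left_realizes[of "dm a"] by (auto intro: realizes_cx)
    show "cx T" by (rule cxI) (auto simp: T, simp_all add: t_def)
  qed
  let ?f = "\<lambda>i. if i = 0 then Idt K (dm a) else if i = 1 then a else \<zero>\<^bsub>Hom K (Zob K) (Zob K)\<^esub>"
  let ?g = "\<lambda>i. if i = 0 then Idt K (dm a) else if i = 1 then a' else \<zero>\<^bsub>Hom K (Zob K) (Zob K)\<^esub>"
  have "chain_map_ends K n (dm a) (Zob K) ?L T ?f"
    unfolding chain_map_ends_def
    by (intro conjI chain_mapI[OF cx]) (use n_pos in \<open>auto simp: T L t_def\<close>)
  moreover have "chain_map_ends K n (dm a) (Zob K) T ?L ?g"
    unfolding chain_map_ends_def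
    by (intro conjI chain_mapI[OF cx(2,1)]) (use n_pos in \<open>auto simp: T L t_def\<close>)
  ultimately have "homotopy_equiv K n (dm a) (Zob K) ?L T"
    by (rule homotopy_equivI_iso[OF _ _ cx]) (auto simp: T(1) L(1) t_def)
  moreover have "ob ?L 0 = dm a" "ob ?L (Suc n) = Zob K" "T \<in> complexes_ends K n (dm a) (Zob K)"
    using n_pos cx(2) by (simp_all add: L(1) complexes_ends_def T(1)) (simp add: t_def)
  ultimately have "realizes T \<zero>\<^bsub>EOb E (Zob K) (dm a)\<^esub>"
    using realizes_closed[OF triv_left_realizes[of "dm a"]] by simp
  from realizes_inflation[OF this] show ?thesis by (simp add: T)
qed

text \<open>Dually, only the term in degree \<open>n\<close> of the trivial complex on
  \<open>cd a\<close> is replaced, and the comparison into the new complex is \<open>a'\<close>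
  there.\<close>

lemma iso_deflation:
  assumes a [simp]: "arr a" and a': "arr a'" "dm a' = cd a" "cd a' = dm a"
    and inv: "a' \<cdot> a = Idt K (dm a)" "a \<cdot> a' = Idt K (cd a)"
  shows "deflation K E s n a"
proof -
  note [simp] = a' inv
  let ?R = "triv_right K n (cd a)"
  define t where "t i = (if i < n then Zob K else if i = n then dm a else cd a)" for i :: nat
  define T where "T = \<lparr> ob = t, df = (\<lambda>i. if i = n then a else \<zero>\<^bsub>Hom K (t i) (t (Suc i))\<^esub>) \<rparr>"
  have T: "ob T i = t i" "df T i = (if i = n then a else \<zero>\<^bsub>Hom K (t i) (t (Suc i))\<^esub>)" for i
    by (simp_all add: T_def)
  have R: "ob ?R i = (if i < n then Zob K else cd a)"
      "df ?R i = (if i = n then Idt K (cd a) else \<zero>\<^bsub>Hom K (ob ?R i) (ob ?R (Suc i))\<^esub>)" for i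
    by (simp_all add: triv_right_def)
  have t_ob [simp]: "t i \<in> Ob K" "ob ?R i \<in> Ob K" for i by (simp_all add: t_def R(1))
  have cx: "cx ?R" "cx T"
  proof -
    show "cx ?R" using triv_right_realizes[of "cd a"] by (auto intro: realizes_cx)
    show "cx T" by (rule cxI) (auto simp: T, simp_all add: t_def)
  qed
  let ?f = "\<lambda>i. if i < n then \<zero>\<^bsub>Hom K (Zob K) (Zob K)\<^esub> else if i = n then a' else Idt K (cd a)"
  let ?g = "\<lambda>i. if i < n then \<zero>\<^bsub>Hom K (Zob K) (Zob K)\<^esub> else if i = n then a else Idt K (cd a)"
  have "chain_map_ends K n (Zob K) (cd a) ?R T ?f"
    unfolding chain_map_ends_def
    by (intro conjI chain_mapI[OF cx]) (use n_pos in \<open>auto simp: T R t_def\<close>)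
  moreover have "chain_map_ends K n (Zob K) (cd a) T ?R ?g"
    unfolding chain_map_ends_def
    by (intro conjI chain_mapI[OF cx(2,1)]) (use n_pos in \<open>auto simp: T R t_def\<close>)
  ultimately have "homotopy_equiv K n (Zob K) (cd a) ?R T"
    by (rule homotopy_equivI_iso[OF _ _ cx]) (auto simp: T(1) R(1) t_def)
  moreover have "ob ?R 0 = Zob K" "ob ?R (Suc n) = cd a" "T \<in> complexes_ends K n (Zob K) (cd a)"
    using n_pos cx(2) by (simp_all add: R(1) complexes_ends_def T(1)) (simp add: t_def)
  ultimately have "realizes T \<zero>\<^bsub>EOb E (cd a) (Zob K)\<^esub>"
    using realizes_closed[OF triv_right_realizes[of "cd a"]] by simp
  from realizes_deflation[OF this] show ?thesis by (simp add: T)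
qed

section \<open>Verification of the conditions\<close>

lemma conf_n_exact: "X \<in> conf \<Longrightarrow> n_exact_seq K n X"
  using realizes_n_kernel realizes_n_cokernel unfolding conf_iff n_exact_seq_def by blast

lemma conf_cx: "X \<in> conf \<Longrightarrow> cx X"
  using realizes_cx unfolding conf_iff by blast

lemma conf_EC': "EC' K n conf"
  unfolding EC'_def
proof (intro ballI impI)
  fix A C X Y
  assume X: "X \<in> conf \<inter> complexes_ends K n A C" and Y: "Y \<in> complexes_ends K n A C"
    and XY: "homotopy_equiv K n A C X Y"
  have ends: "ob X 0 = A" "ob X (Suc n) = C" using X by (simp_all add: complexes_ends_def)
  obtain \<delta> where "realizes X \<delta>" by (rule conf_E[of X]) (use X in simp_all)
  from realizes_closed[OF this] show "Y \<in> conf" using Y XY ends by (auto intro: realizes_conf)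
qed

text \<open>The zero complex is the trivial conflation on the zero object, whose identity is a zero
  morphism.\<close>

lemma conf_E0: "E0 K conf"
proof -
  have "\<lparr> ob = (\<lambda>_. Zob K), df = (\<lambda>_. \<zero>\<^bsub>Hom K (Zob K) (Zob K)\<^esub>) \<rparr> = triv_left K (Zob K)"
    by (simp add: triv_left_def fun_eq_iff)
  then show ?thesis
    unfolding E0_def using realizes_conf[OF triv_left_realizes[of "Zob K"]] by simp
qed

lemma conf_E2'_op: "E2'_op K n conf"
  unfolding E2'_op_def
proof (intro conjI ballI impI allI)
  fix A C C' c Y
  assume C: "C \<in> Ob K" "C' \<in> Ob K" "c \<in> Mor K C' C" and Y: "Y \<in> conf" "ob Y 0 = A" "ob Y (n+1) = C"
  then have c: "arr c" "cd c = ob Y (Suc n)" "dm c = C'" by (simp_all add: hom_iff)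
  show "\<exists>X\<in>conf. ob X 0 = A \<and> ob X (n+1) = C' \<and>
      (\<exists>f. chain_map K n X Y f \<and> f 0 = Idt K A \<and> f (n+1) = c)"
    by (rule conf_pullback[OF Y(1) c(1,2)]) (use c(3) Y(2) in auto)
qed (simp add: cone_conf)

lemma conf_E2': "E2' K n conf"
  unfolding E2'_def
proof (intro conjI ballI impI allI)
  fix A C A' a X
  assume A: "A \<in> Ob K" "A' \<in> Ob K" "a \<in> Mor K A A'" and X: "X \<in> conf" "ob X 0 = A" "ob X (n+1) = C"
  then have a: "arr a" "dm a = ob X 0" "cd a = A'" by (simp_all add: hom_iff)
  show "\<exists>Y\<in>conf. ob Y 0 = A' \<and> ob Y (n+1) = C \<and>
      (\<exists>f. chain_map K n X Y f \<and> f 0 = a \<and> f (n+1) = Idt K C)"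
    by (rule conf_pushout[OF X(1) a(1,2)]) (use a(3) X(3) in auto)
qed (simp add: cocone_conf)

text \<open>The cocone of the lift is again a conflation, hence n-exact; its n-cokernel half is the
  pushout condition. \<open>conf_E2_op\<close> uses the n-kernel half of a cone.\<close>

lemma conf_E2: "E2 K n conf"
  unfolding E2_def
proof (intro ballI)
  fix X B a assume X: "X \<in> conf" and B: "B \<in> Ob K" "a \<in> Mor K (ob X 0) B"
  have cx [simp]: "cx X" using X by (rule conf_cx)
  have a: "arr a" "dm a = ob X 0" "cd a = B" using B by (simp_all add: hom_iff)
  obtain Y f where Y: "Y \<in> conf" "ob Y 0 = cd a" "ob Y (Suc n) = ob X (Suc n)"
    and f: "chain_map K n X Y f" "f 0 = a" "f (Suc n) = Idt K (ob X (Suc n))"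
    by (rule conf_pushout[OF X a(1,2)])
  have cxY [simp]: "cx Y" using Y(1) by (rule conf_cx)
  have "n_exact_seq K n (cocone K n X Y f)"
    by (rule conf_n_exact[OF cocone_conf[OF X Y(1,3) f(1,3)]])
  then have "n_pushout K n X Y f"
    using chain_mapD[OF f(1) cx cxY] by (simp add: n_pushout_def n_exact_seq_def hom_iff)
  moreover have "adm_mono conf (df Y 0)" unfolding adm_mono_def using Y(1) by blast
  ultimately show "\<exists>Y f. ob Y 0 = B \<and> f 0 = a \<and> n_pushout K n X Y f \<and> adm_mono conf (df Y 0)"
    using Y(2) f(2) a(3) by blast
qed

lemma conf_E2_op: "E2_op K n conf"
  unfolding E2_op_def
proof (intro ballI)
  fix Y D c assume Y: "Y \<in> conf" and D: "D \<in> Ob K" "c \<in> Mor K D (ob Y (n+1))"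
  have cx [simp]: "cx Y" using Y by (rule conf_cx)
  have c: "arr c" "cd c = ob Y (Suc n)" "dm c = D" using D by (simp_all add: hom_iff)
  obtain X f where X: "X \<in> conf" "ob X 0 = ob Y 0" "ob X (Suc n) = dm c"
    and f: "chain_map K n X Y f" "f 0 = Idt K (ob Y 0)" "f (Suc n) = c"
    by (rule conf_pullback[OF Y c(1,2)])
  have cxX [simp]: "cx X" using X(1) by (rule conf_cx)
  have "n_exact_seq K n (cone K n X Y f)"
    by (rule conf_n_exact[OF cone_conf[OF X(1) Y X(2) f(1,2)]])
  then have "n_pullback K n X Y f"
    using chain_mapD[OF f(1) cxX cx] by (simp add: n_pullback_def n_exact_seq_def hom_iff)
  moreover have "adm_epi n conf (df X n)" unfolding adm_epi_def using X(1) by blast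
  moreover have "ob X (n+1) = D" "f (n+1) = c" using X(3) f(3) c(3) by simp_all
  ultimately show "\<exists>X f. ob X (n+1) = D \<and> f (n+1) = c \<and> n_pullback K n X Y f \<and> adm_epi n conf (df X n)"
    by blast
qed

lemma inflation_cmp:
  assumes "inflation K E s f" "inflation K E s g" "arr f" "arr g" "dm g = cd f"
  shows "inflation K E s (g \<cdot> f)"
  using EA1[unfolded EA1_def comp_closed_def, THEN conjunct1, rule_format, of "dm f" "cd f" "cd g" f g]
    assms arr_hom[of f] arr_hom[of g] by simp

lemma deflation_cmp:
  assumes "deflation K E s n f" "deflation K E s n g" "arr f" "arr g" "dm g = cd f"
  shows "deflation K E s n (g \<cdot> f)"
  using EA1[unfolded EA1_def comp_closed_def, THEN conjunct2, rule_format, of "dm f" "cd f" "cd g" f g]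
    assms arr_hom[of f] arr_hom[of g] by simp

text \<open>A morphism with identities at both ends forces the two extensions to coincide, and
  \<open>s\<close> assigns a single class to an extension.\<close>

lemma conf_hclass_eq:
  assumes X: "X \<in> conf" "X \<in> complexes_ends K n A C" and Y: "Y \<in> conf" "Y \<in> complexes_ends K n A C"
    and f: "chain_map_ends K n A C X Y f"
  shows "hclass K n A C X = hclass K n A C Y"
proof -
  have ends [simp]: "ob X 0 = A" "ob X (Suc n) = C" "ob Y 0 = A" "ob Y (Suc n) = C"
    using X(2) Y(2) by (simp_all add: complexes_ends_def)
  have AC: "A \<in> Ob K" "C \<in> Ob K"
    using cx_ob[OF conf_cx[OF X(1)], of 0] cx_ob[OF conf_cx[OF X(1)], of "Suc n"] by simp_all
  obtain \<delta> where \<delta>: "realizes X \<delta>" using X(1) by (rule conf_E)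
  obtain \<rho> where \<rho>: "realizes Y \<rho>" using Y(1) by (rule conf_E)
  have "\<delta> = \<rho>"
    using chain_map_ext[OF \<delta> \<rho>, of f] f realizes_ext[OF \<delta>] realizes_ext[OF \<rho>] AC
    by (simp add: chain_map_ends_def)
  moreover obtain Z where Z: "Z \<in> complexes_ends K n A C" "s C A \<delta> = hclass K n A C Z"
    using realization_ex[OF AC(2,1)] realizes_ext[OF \<delta>] by auto
  ultimately have "X \<in> hclass K n A C Z" "Y \<in> hclass K n A C Z"
    using \<delta> \<rho> by (simp_all add: realizes_def)
  then have "homotopy_equiv K n A C Z X" "homotopy_equiv K n A C Z Y"
    by (simp_all add: hclass_def)
  then show ?thesis
    using hclass_eq[OF Z(1) X(2) _ AC] hclass_eq[OF Z(1) Y(2) _ AC] by simp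
qed

text \<open>For isomorphisms in consecutive degrees, inverting the square gives the other
  implication. If the ends are invertible, the last square exhibits
  \<open>df Y n \<cdot> f n\<close> as a composite of deflations, and left cancellation makes
  \<open>df Y n\<close> a deflation.\<close>

lemma conf_EC:
  assumes inflation_right: "\<And>a b. \<lbrakk>arr a; arr b; dm b = cd a; inflation K E s (b \<cdot> a)\<rbrakk> \<Longrightarrow> inflation K E s a"
    and deflation_left: "\<And>a b. \<lbrakk>arr a; arr b; dm b = cd a; deflation K E s n (b \<cdot> a)\<rbrakk> \<Longrightarrow> deflation K E s n b"
  shows "EC K n conf"
  unfolding EC_def
proof (intro allI impI)
  fix X Y f
  assume X: "n_exact_seq K n X" and Y: "n_exact_seq K n Y" and f: "chain_map K n X Y f"
    and iso: "(\<exists>k\<le>n. isomor K (f k) \<and> isomor K (f (k+1))) \<or> (isomor K (f 0) \<and> isomor K (f (n+1)))"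
  have X': "n_kernel_seq K n X" "n_cokernel_seq K n X" and Y': "n_kernel_seq K n Y" "n_cokernel_seq K n Y"
    using X Y by (simp_all add: n_exact_seq_def)
  have cx [simp]: "cx X" "cx Y" using X' Y' by (simp_all add: n_cokernel_seq_iff)
  note [simp] = chain_mapD(1-3)[OF f cx]
  note nat = chain_mapD(4)[OF f cx]
  show "X \<in> conf \<longleftrightarrow> Y \<in> conf"
    using iso
  proof (elim disjE exE conjE)
    fix k assume k: "k \<le> n" and iso: "isomor K (f k)" "isomor K (f (k+1))"
    have fk: "arr (f k)" "dm (f k) = ob X k" "cd (f k) = ob Y k"
      "arr (f (Suc k))" "dm (f (Suc k)) = ob X (Suc k)" "cd (f (Suc k)) = ob Y (Suc k)"
      using k by simp_all
    obtain a where a: "arr a" "dm a = ob Y k" "cd a = ob X k"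
        "a \<cdot> f k = Idt K (ob X k)" "f k \<cdot> a = Idt K (ob Y k)"
      by (rule isomorE[OF iso(1)]) (simp add: fk)
    obtain b where b: "arr b" "dm b = ob Y (Suc k)" "cd b = ob X (Suc k)"
        "b \<cdot> f (Suc k) = Idt K (ob X (Suc k))" "f (Suc k) \<cdot> b = Idt K (ob Y (Suc k))"
      by (rule isomorE[OF iso(2)]) (simp add: fk)
    have ab: "b \<cdot> df Y k = df X k \<cdot> a"
      by (rule inverse_square[of "f k" "f (Suc k)"]) (use k a b fk nat in simp_all)
    show ?thesis
      using conf_square_iso[OF _ Y' k fk a b nat[OF k]] conf_square_iso[OF _ X' k a(1-3) b(1-3) fk(1-3) a(5,4) fk(4-6) b(5,4) ab]
      by blast
  next
    assume iso: "isomor K (f 0)" "isomor K (f (n+1))"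
    have id: "inflation K E s (f 0)" "deflation K E s n (f (Suc n))"
      using isomorE[OF iso(1)] iso_inflation isomorE[OF iso(2)] iso_deflation by (metis, metis Suc_eq_plus1)
    show ?thesis
    proof
      assume "X \<in> conf"
      then have "deflation K E s n (df X n)" unfolding adm_epi_def by blast
      then have "deflation K E s n (f (Suc n) \<cdot> df X n)" using id by (intro deflation_cmp) simp_all
      then have "deflation K E s n (df Y n \<cdot> f n)" unfolding nat[OF order_refl] .
      then have "deflation K E s n (df Y n)" by (rule deflation_left[rotated 3]) simp_all
      then show "Y \<in> conf" by (rule conf_of_deflation[OF Y'])
    next
      \<comment> \<open>The inner components of \<open>f\<close> need not be invertible, so the
        argument cannot simply be reversed; instead the first square shows that
        \<open>df X 0\<close> is an inflation.\<close>
      assume "Y \<in> conf"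
      then have "inflation K E s (df Y 0)" unfolding adm_mono_def by blast
      then have "inflation K E s (df Y 0 \<cdot> f 0)" using id by (intro inflation_cmp) simp_all
      then have "inflation K E s (f (Suc 0) \<cdot> df X 0)" unfolding nat[OF le0] .
      then have "inflation K E s (df X 0)" by (rule inflation_right[rotated 3]) simp_all
      then show "X \<in> conf" by (rule conf_of_inflation[OF X'])
    qed
  qed
qed

text \<open>Identities at the ends are isomorphisms, so (EC) first makes the n-exact sequence a
  conflation; the classes are then compared by \<open>conf_hclass_eq\<close> in whichever direction
  the morphism goes.\<close>

lemma conf_EI:
  assumes EC: "EC K n conf"
  shows "EI K n conf"
  unfolding EI_def
proof (intro ballI impI)
  fix A C X Y
  assume AC: "A \<in> Ob K" "C \<in> Ob K" and X: "X \<in> conf \<inter> complexes_ends K n A C"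
    and Y: "Y \<in> complexes_ends K n A C" "n_exact_seq K n Y"
    and f: "(\<exists>f. chain_map_ends K n A C X Y f) \<or> (\<exists>f. chain_map_ends K n A C Y X f)"
  have X': "X \<in> conf" "X \<in> complexes_ends K n A C" "n_exact_seq K n X"
    using X conf_n_exact by auto
  note EC' = EC[unfolded EC_def, rule_format]
  from f show "hclass K n A C X = hclass K n A C Y"
  proof (elim disjE exE)
    fix f assume f: "chain_map_ends K n A C X Y f"
    then have "X \<in> conf \<longleftrightarrow> Y \<in> conf"
      using EC'[OF X'(3) Y(2), of f] AC isomor_idt by (simp add: chain_map_ends_def)
    then show ?thesis using conf_hclass_eq[OF X'(1,2) _ Y(1) f] X'(1) by simp
  next
    fix f assume f: "chain_map_ends K n A C Y X f"
    then have "Y \<in> conf \<longleftrightarrow> X \<in> conf"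
      using EC'[OF Y(2) X'(3), of f] AC isomor_idt by (simp add: chain_map_ends_def)
    then show ?thesis using conf_hclass_eq[OF _ Y(1) X'(1,2) f] X'(1) by simp
  qed
qed

end

theorem proposition4p37:
  fixes K :: "('o, 'm) addcat" and E :: "('o, 'm, 'e) bifun"
    and s :: "('o, 'm, 'e) realiz" and n :: nat
  defines "\<X> \<equiv> conflations K E s"
  assumes "1 \<le> n"
    and "n_exangulated K E s n"
    and "\<And>f. inflation K E s f \<Longrightarrow> monic K f"
    and "\<And>f. deflation K E s n f \<Longrightarrow> epic K f"
  shows "((\<forall>X\<in>\<X>. n_exact_seq K n X) \<and>
          EC' K n \<X> \<and> E0 K \<X> \<and> E1 K \<X> \<and> E1_op K n \<X> \<and> E2' K n \<X> \<and> E2'_op K n \<X>) \<and>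
         ((\<forall>A\<in>Ob K. \<forall>B\<in>Ob K. \<forall>C\<in>Ob K. \<forall>a\<in>Mor K A B. \<forall>b\<in>Mor K B C.
             (inflation K E s (b \<cdot>\<^bsub>K\<^esub> a) \<longrightarrow> inflation K E s a) \<and>
             (deflation K E s n (b \<cdot>\<^bsub>K\<^esub> a) \<longrightarrow> deflation K E s n b)) \<longrightarrow>
          EI K n \<X> \<and> n_exact_category K n \<X>)"
proof -
  interpret exangulated K n E s
    using assms(2-) unfolding n_exangulated_def
    by (simp add: exangulated_def exangulated_axioms_def complex_category_def)
  have E1: "E1 K \<X>" "E1_op K n \<X>"
    using EA1 by (simp_all add: EA1_def E1_def E1_op_def \<X>_def)
  have "EI K n \<X> \<and> n_exact_category K n \<X>"
    if *: "\<forall>A\<in>Ob K. \<forall>B\<in>Ob K. \<forall>C\<in>Ob K. \<forall>a\<in>Mor K A B. \<forall>b\<in>Mor K B C.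
             (inflation K E s (b \<cdot>\<^bsub>K\<^esub> a) \<longrightarrow> inflation K E s a) \<and>
             (deflation K E s n (b \<cdot>\<^bsub>K\<^esub> a) \<longrightarrow> deflation K E s n b)"
  proof -
    have ab: "(inflation K E s (b \<cdot>\<^bsub>K\<^esub> a) \<longrightarrow> inflation K E s a) \<and>
        (deflation K E s n (b \<cdot>\<^bsub>K\<^esub> a) \<longrightarrow> deflation K E s n b)"
      if "arr a" "arr b" "dm b = cd a" for a b
      using *[rule_format, of "dm a" "cd a" "cd b" a b] that arr_hom[of a] arr_hom[of b] by simp
    have "EC K n \<X>" unfolding \<X>_def using ab by (intro conf_EC) blast+
    then show ?thesis
      using conf_EI conf_n_exact conf_E0 conf_E2 conf_E2_op E1 additive_category_axioms
      by (simp add: n_exact_category_def \<X>_def)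
  qed
  then show ?thesis
    using conf_n_exact conf_EC' conf_E0 conf_E2' conf_E2'_op E1 by (simp add: \<X>_def)
qed

end
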